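(* Let $n\ge 2$ and let $\Omega\subset\mathbb{R}^n_+$ be a domain as described in the context, with constants $0<m<M<+\infty$, $m=\inf_{(x,y)\in\Omega}y$, $M=\sup_{(x,y)\in\Omega}y$. Let $\mathcal{D}_H=\sum_{i=1}^{n-1}e_iy\partial_{x_i}-\alpha_ne_n+e_ny\partial_y$ be the Dirac operator on the hyperbolic space, where $\alpha_n=\frac{n-1}{2}$ and $\beta_n=\alpha_n+\alpha_n^2$. Let $s\in\mathbb{R}^{n+1}$ (a paravector with real part $s_0$) be such that $|s|^2-\beta_n\neq 0$, $$\big||s|^2-\beta_n\big|-\alpha_n\sqrt{1+4s_0^2}+m^2>0$$ and $$4m^2\big||s|^2-\beta_n\big|-4nM^2s_0^2-4\Big(m^2\alpha_n+M^2(1+\alpha_n)\sqrt n\Big)\sqrt{1+4s_0^2}>M^2\Big(4(1+\alpha_n)^2+n\Big).$$ Then for every $f\in L^2(\Omega,\mathbb{R}_n)$ there exists a unique $F_f\in H^1_0(\Omega,\mathbb{R}_n)$ such that $$q_s(F_f,G)=\langle f,G\rangle_2\qquad\text{for all }G\in H^1_0(\Omega,\mathbb{R}_n).$$ Moreover, writing $Q_s(\mathcal{D}_H)^{-1}f:=F_f$, this solution satisfies $$\|Q_s(\mathcal{D}_H)^{-1}f\|_2\le\frac{1}{K_{n,m,M}(s)}\|f\|_2\qquad\text{and}\qquad\|Q_s(\mathcal{D}_H)^{-1}f\|_D\le\frac{1}{K_{n,m,M}(s)}\|f\|_2,$$ where $$K_{n,m,M}(s)=\tfrac12\big||s|^2-\beta_n\big|-\tfrac12\alpha_n\sqrt{1+4s_0^2}+\tfrac12m^2-\tfrac12\sqrt{\Big(\big||s|^2-\beta_n\big|-\alpha_n\sqrt{1+4s_0^2}-m^2\Big)^2+M^2\Big(2(1+\alpha_n)+\sqrt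 n\sqrt{1+4s_0^2}\Big)^2}.$$
   Context: $\mathbb{R}_n$ is the real Clifford algebra generated by $e_1,\dots,e_n$ with $e_i^2=-1$, $e_ie_j=-e_je_i$ for $i\ne j$, with basis $e_A=e_{i_1}\cdots e_{i_r}$, $A=(i_1<\dots<i_r)$, $e_\emptyset=1$. For $x=\sum_Ax_Ae_A$: $\mathrm{Sc}(x)=x_\emptyset$, conjugation is $\overline x=\sum_Ax_A\overline{e_A}$ with $\overline{e_A}=\overline{e_{i_r}}\cdots\overline{e_{i_1}}$, $\overline{e_i}=-e_i$, and $|x|=(\sum_A|x_A|^2)^{1/2}$. $\mathbb{R}^{n+1}$ is identified with the paravectors $s=s_0+s_1e_1+\dots+s_ne_n$, $s_i\in\mathbb{R}$. $\mathbb{R}^n_+=\{(x,y): x=(x_1,\dots,x_{n-1})\in\mathbb{R}^{n-1},\ y>0\}$. $\Omega\subset\mathbb{R}^n_+$ is an open set with smooth boundary, bounded or unbounded (for example the strip $\{0<a<y<b\}$), such that $\inf_\Omega y=m$ and $\sup_\Omega y=M$ with $0<m<M<+\infty$. Functions take values in $\mathbb{R}_n$; $L^2(\Omega,\mathbb{R}_n)=L^2(\Omega,\mathbb{R})\otimes\mathbb{R}_n$ and $H^1_0(\Omega,\mathbb{R}_n)=H^1_0(\Omega,\mathbb{R})\otimes\mathbb{R}_n$ (Lebesgue measure), conjugation and derivatives being applied pointwise/componentwise. $\langle F,G\rangle_2=\int_\Omega\overline FG\,dx\in\mathbb{R}_n$, $\|F\|_2^2=\mathrm{Sc}\langle F,F\rangle_2$,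 $\|F\|_D^2=\sum_{i=1}^{n-1}\|\partial_{x_i}F\|_2^2+\|\partial_yF\|_2^2$. Elements $e_i$ act on functions by left multiplication. The sesquilinear form on $H^1_0(\Omega,\mathbb{R}_n)\times H^1_0(\Omega,\mathbb{R}_n)$, associated with the Dirichlet problem $Q_s(\mathcal{D}_H)F=f$ in $\Omega$, $F|_{\partial\Omega}=0$, where $Q_s(\mathcal{D}_H)=\mathcal{D}_H^2-2s_0\mathcal{D}_H+|s|^2$, is $$q_s(F,G)=\sum_{i=1}^{n-1}\langle y^2\partial_{x_i}F,\partial_{x_i}G\rangle_2+\langle y^2\partial_yF,\partial_yG\rangle_2+2(1+\alpha_n)\langle y\partial_yF,G\rangle_2+\langle(e_n-2s_0)\mathcal{D}_HF,G\rangle_2+\langle(|s|^2-\beta_n)F,G\rangle_2.$$ $Q_s(\mathcal{D}_H)^{-1}f$ denotes the weak solution $F_f$. *)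

theory Defs
  imports "HOL-Analysis.Analysis"
begin

section \<open>The real Clifford algebra generated by anticommuting square roots of -1\<close>

text \<open>
  The generators are indexed by a finite linear order \<^typ>\<open>'n\<close> with n = CARD('n) elements, and an
  element is the vector of its coefficients with respect to the basis of ordered products, indexed
  by the subsets of \<^typ>\<open>'n\<close>.  The library norm on this vector space is the Clifford norm
  (the root of the sum of the squared coefficients).
  Pitfall: the library constants 1 and * on vectors are componentwise and are not used here.
\<close>

type_synonym 'n clifford = "real ^ ('n set)"

text \<open>
  Moving the factors of the second product to their places in the first one costs one sign for each
  pair i > j, and each common generator contributes the square -1; hence one sign for every
  pair i \<ge> j.
\<close>

definition clif_sign :: "'n::{finite,linorder} set \<Rightarrow> 'n set \<Rightarrow> real" where
  "clif_sign A B = (\<Prod>i\<in>A. \<Prod>j\<in>B. if j \<le> i then - 1 else 1)"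

definition clif_mult :: "'n::{finite,linorder} clifford \<Rightarrow> 'n clifford \<Rightarrow> 'n clifford"
    (infixl "\<odot>" 70) where
  "x \<odot> y = (\<Sum>A\<in>UNIV. \<Sum>B\<in>UNIV. (x $ A * y $ B * clif_sign A B) *\<^sub>R axis (sym_diff A B) 1)"

definition clif_one :: "'n::{finite,linorder} clifford" where
  "clif_one = axis {} 1"

definition clif_gen :: "'n::{finite,linorder} \<Rightarrow> 'n clifford" where
  "clif_gen i = axis {i} 1"

definition clif_prod_list :: "'n::{finite,linorder} clifford list \<Rightarrow> 'n clifford" where
  "clif_prod_list xs = foldr (\<odot>) xs clif_one"

definition clif_conj :: "'n::{finite,linorder} clifford \<Rightarrow> 'n clifford" where
  "clif_conj x = (\<Sum>A\<in>UNIV. x $ A *\<^sub>R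
     clif_prod_list (map (\<lambda>i. - clif_gen i) (rev (sorted_list_of_set A))))"

definition Sc :: "'n::{finite,linorder} clifford \<Rightarrow> real" where
  "Sc x = x $ {}"

definition paravectors :: "'n::{finite,linorder} clifford set" where
  "paravectors = {s0 *\<^sub>R clif_one + (\<Sum>i\<in>UNIV. v i *\<^sub>R clif_gen i) | s0 v. True}"

text \<open>The product satisfies the defining relations, and the coordinate vectors are the ordered
  products of generators.\<close>

lemma prod_sym_diff_signs:
  fixes f :: "'a \<Rightarrow> real"
  assumes "finite A" "finite B" and f: "\<And>x. f x * f x = 1"
  shows "prod f (sym_diff A B) = prod f A * prod f B"
proof -
  have A: "prod f A = prod f (A - B) * prod f (A \<inter> B)"
    using assms by (metis Int_Diff_Un Int_Diff_disjoint finite_Diff finite_Int mult.commute prod.union_disjoint)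
  have B: "prod f B = prod f (B - A) * prod f (A \<inter> B)"
    using assms by (metis Int_Diff_Un Int_Diff_disjoint Int_commute finite_Diff finite_Int mult.commute prod.union_disjoint)
  have I: "prod f (A \<inter> B) * prod f (A \<inter> B) = 1"
    by (simp add: prod.distrib[symmetric] f)
  have "prod f (sym_diff A B) = prod f (A - B) * prod f (B - A)"
    by (rule prod.union_disjoint) (use assms in auto)
  also have "\<dots> = prod f (A - B) * prod f (B - A) * (prod f (A \<inter> B) * prod f (A \<inter> B))"
    by (simp add: I)
  finally show ?thesis by (simp add: A B mult_ac)
qed

lemma clif_sign_sym_diff_left: "clif_sign (sym_diff A B) C = clif_sign A C * clif_sign B C"
  unfolding clif_sign_def
  by (rule prod_sym_diff_signs) (auto simp: prod.distrib[symmetric] intro!: prod.neutral)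

lemma clif_sign_sym_diff_right: "clif_sign A (sym_diff B C) = clif_sign A B * clif_sign A C"
  unfolding clif_sign_def prod.distrib[symmetric]
  by (rule prod.cong[OF refl], rule prod_sym_diff_signs) auto

lemma clif_mult_axis: "axis A a \<odot> axis B b = (a * b * clif_sign A B) *\<^sub>R axis (sym_diff A B) 1"
proof -
  have *: "(\<Sum>B'\<in>UNIV. (axis A a $ A' * axis B b $ B' * clif_sign A' B') *\<^sub>R axis (sym_diff A' B') (1::real))
      = (axis A a $ A' * b * clif_sign A' B) *\<^sub>R axis (sym_diff A' B) 1" for A'
    by (subst sum.remove[of _ B]) (auto simp: axis_def intro!: sum.neutral)
  show ?thesis
    unfolding clif_mult_def *
    by (subst sum.remove[of _ A]) (auto simp: axis_def intro!: sum.neutral)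
qed

lemma clif_mult_bilinear: "bilinear (\<odot>)"
  unfolding bilinear_def clif_mult_def
  by (auto intro!: linearI simp: algebra_simps sum.distrib scaleR_sum_right)

lemma clif_mult_sum:
  "(\<Sum>i\<in>I. f i) \<odot> y = (\<Sum>i\<in>I. f i \<odot> y)" "x \<odot> (\<Sum>i\<in>I. f i) = (\<Sum>i\<in>I. x \<odot> f i)"
  using clif_mult_bilinear unfolding bilinear_def by (auto intro: linear_sum)

lemma clif_mult_scaleR: "(c *\<^sub>R x) \<odot> y = c *\<^sub>R (x \<odot> y)" "x \<odot> (c *\<^sub>R y) = c *\<^sub>R (x \<odot> y)"
  using clif_mult_bilinear unfolding bilinear_def by (auto intro: linear_cmul)

lemma clif_expand: "(x :: 'n::{finite,linorder} clifford) = (\<Sum>A\<in>UNIV. x $ A *\<^sub>R axis A 1)"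
  using basis_expansion[of x] by (simp add: scalar_mult_eq_scaleR)

lemma clif_mult_assoc: "(x \<odot> y) \<odot> z = x \<odot> (y \<odot> z)"
proof -
  note lin = clif_mult_sum clif_mult_scaleR
  have *: "(axis A 1 \<odot> axis B 1) \<odot> axis C 1 = axis A 1 \<odot> (axis B 1 \<odot> axis C 1)" for A B C :: "'a set"
  proof -
    have d: "sym_diff (sym_diff A B) C = sym_diff A (sym_diff B C)" by auto
    show ?thesis
      by (simp only: clif_mult_axis lin clif_sign_sym_diff_left clif_sign_sym_diff_right d
          scaleR_scaleR) (simp add: mult_ac)
  qed
  show ?thesis
    by (subst (1 2) clif_expand[of x], subst (1 2) clif_expand[of y], subst (1 2) clif_expand[of z])
      (simp only: lin *)
qed

lemma clif_mult_one: "clif_one \<odot> x = x" "x \<odot> clif_one = x"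
proof -
  note lin = clif_mult_sum clif_mult_scaleR
  show "clif_one \<odot> x = x"
    by (subst (2) clif_expand, subst clif_expand)
      (simp add: clif_one_def lin clif_mult_axis clif_sign_def)
  show "x \<odot> clif_one = x"
    by (subst (2) clif_expand, subst clif_expand)
      (simp add: clif_one_def lin clif_mult_axis clif_sign_def)
qed

lemma clif_gen_square: "clif_gen i \<odot> clif_gen i = - clif_one"
  by (simp add: clif_gen_def clif_one_def clif_mult_axis clif_sign_def)

lemma clif_gen_anticommute: "i \<noteq> j \<Longrightarrow> clif_gen i \<odot> clif_gen j = - (clif_gen j \<odot> clif_gen i)"
  by (auto simp: clif_gen_def clif_mult_axis clif_sign_def Un_commute)

lemma clif_basis_eq_prod: "axis A 1 = clif_prod_list (map clif_gen (sorted_list_of_set A))"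
proof -
  have "sorted_wrt (<) xs \<Longrightarrow> clif_prod_list (map clif_gen xs) = axis (set xs) 1" for xs :: "'a list"
  proof (induction xs)
    case Nil
    then show ?case by (simp add: clif_prod_list_def clif_one_def)
  next
    case (Cons i xs)
    then have lt: "\<And>j. j \<in> set xs \<Longrightarrow> i < j" and ih: "clif_prod_list (map clif_gen xs) = axis (set xs) 1"
      by auto
    have "clif_sign {i} (set xs) = 1" using lt by (force simp: clif_sign_def intro!: prod.neutral)
    moreover have "sym_diff {i} (set xs) = set (i # xs)" using lt by auto
    moreover have "clif_prod_list (map clif_gen (i # xs)) = clif_gen i \<odot> clif_prod_list (map clif_gen xs)"
      by (simp add: clif_prod_list_def)
    ultimately show ?case by (simp only: ih clif_gen_def[of i] clif_mult_axis) simp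
  qed
  from this[of "sorted_list_of_set A"] show ?thesis by simp
qed


section \<open>Smooth functions and smooth boundaries\<close>

text \<open>Intended for open sets S.\<close>

primrec Ck_on :: "nat \<Rightarrow> ('a::euclidean_space \<Rightarrow> real) \<Rightarrow> 'a set \<Rightarrow> bool" where
  "Ck_on 0 f S \<longleftrightarrow> continuous_on S f"
| "Ck_on (Suc k) f S \<longleftrightarrow> (\<forall>x\<in>S. f differentiable (at x)) \<and>
     (\<forall>v. Ck_on k (\<lambda>x. frechet_derivative f (at x) v) S)"

definition smooth_on :: "('a::euclidean_space \<Rightarrow> real) \<Rightarrow> 'a set \<Rightarrow> bool" where
  "smooth_on f S \<longleftrightarrow> (\<forall>k. Ck_on k f S)"

text \<open>Near each boundary point the set is the negativity set of a smooth function without critical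
  points (equivalently, the set lies locally on one side of a smooth graph).\<close>

definition smooth_boundary :: "'a::euclidean_space set \<Rightarrow> bool" where
  "smooth_boundary \<Omega> \<longleftrightarrow> (\<forall>p\<in>frontier \<Omega>. \<exists>U \<rho>. open U \<and> p \<in> U \<and> smooth_on \<rho> U \<and>
     (\<forall>x\<in>U. frechet_derivative \<rho> (at x) \<noteq> (\<lambda>_. 0)) \<and> \<Omega> \<inter> U = {x \<in> U. \<rho> x < 0})"


section \<open>Function spaces\<close>

text \<open>
  Elements of the Lebesgue and Sobolev spaces are represented by functions; equality in these
  spaces is equality almost everywhere in \<Omega>.
\<close>

definition L2_real :: "(real ^ 'n) set \<Rightarrow> (real ^ 'n \<Rightarrow> real) set" where
  "L2_real \<Omega> = {f \<in> borel_measurable (lebesgue_on \<Omega>). integrable (lebesgue_on \<Omega>) (\<lambda>x. (f x)\<^sup>2)}"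

definition test_functions :: "(real ^ 'n) set \<Rightarrow> (real ^ 'n \<Rightarrow> real) set" where
  "test_functions \<Omega> = {\<phi>. smooth_on \<phi> UNIV \<and> compact (closure {x. \<phi> x \<noteq> 0}) \<and>
     closure {x. \<phi> x \<noteq> 0} \<subseteq> \<Omega>}"

definition has_weak_partial ::
    "(real ^ 'n) set \<Rightarrow> 'n \<Rightarrow> (real ^ 'n \<Rightarrow> real) \<Rightarrow> (real ^ 'n \<Rightarrow> real) \<Rightarrow> bool" where
  "has_weak_partial \<Omega> i f g \<longleftrightarrow> (\<forall>\<phi>\<in>test_functions \<Omega>.
     (LINT x|lebesgue_on \<Omega>. f x * frechet_derivative \<phi> (at x) (axis i 1)) =
     - (LINT x|lebesgue_on \<Omega>. g x * \<phi> x))"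

definition H1_real :: "(real ^ 'n) set \<Rightarrow> (real ^ 'n \<Rightarrow> real) set" where
  "H1_real \<Omega> = {f \<in> L2_real \<Omega>. \<forall>i. \<exists>g\<in>L2_real \<Omega>. has_weak_partial \<Omega> i f g}"

text \<open>Unique up to null sets for functions in \<^term>\<open>H1_real \<Omega>\<close>.\<close>

definition weak_partial_real ::
    "(real ^ 'n) set \<Rightarrow> 'n \<Rightarrow> (real ^ 'n \<Rightarrow> real) \<Rightarrow> (real ^ 'n \<Rightarrow> real)" where
  "weak_partial_real \<Omega> i f = (SOME g. g \<in> L2_real \<Omega> \<and> has_weak_partial \<Omega> i f g)"

definition H1_norm_real :: "(real ^ 'n) set \<Rightarrow> (real ^ 'n \<Rightarrow> real) \<Rightarrow> real" where
  "H1_norm_real \<Omega> f = sqrt ((LINT x|lebesgue_on \<Omega>. (f x)\<^sup>2) +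
     (\<Sum>i\<in>UNIV. LINT x|lebesgue_on \<Omega>. (weak_partial_real \<Omega> i f x)\<^sup>2))"

text \<open>The closure of the test functions in the Sobolev norm.\<close>

definition H10_real :: "(real ^ 'n) set \<Rightarrow> (real ^ 'n \<Rightarrow> real) set" where
  "H10_real \<Omega> = {f \<in> H1_real \<Omega>. \<forall>\<epsilon>>0. \<exists>\<phi>\<in>test_functions \<Omega>. H1_norm_real \<Omega> (\<lambda>x. f x - \<phi> x) < \<epsilon>}"

type_synonym 'n cfun = "(real, 'n) vec \<Rightarrow> 'n clifford"

text \<open>Tensoring with the (finite-dimensional) Clifford algebra amounts to requiring membership of
  every coefficient function.\<close>

definition L2 :: "(real ^ 'n::{finite,linorder}) set \<Rightarrow> 'n cfun set" where
  "L2 \<Omega> = {F. \<forall>A. (\<lambda>x. F x $ A) \<in> L2_real \<Omega>}"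

definition H10 :: "(real ^ 'n::{finite,linorder}) set \<Rightarrow> 'n cfun set" where
  "H10 \<Omega> = {F. \<forall>A. (\<lambda>x. F x $ A) \<in> H10_real \<Omega>}"

definition weak_partial :: "(real ^ 'n::{finite,linorder}) set \<Rightarrow> 'n \<Rightarrow>
    'n cfun \<Rightarrow> 'n cfun" where
  "weak_partial \<Omega> i F = (\<lambda>x. \<chi> A. weak_partial_real \<Omega> i (\<lambda>z. F z $ A) x)"

definition inner2 :: "(real ^ 'n::{finite,linorder}) set \<Rightarrow> 'n cfun \<Rightarrow>
    'n cfun \<Rightarrow> 'n clifford" where
  "inner2 \<Omega> F G = (LINT x|lebesgue_on \<Omega>. clif_conj (F x) \<odot> G x)"

definition norm2 :: "(real ^ 'n::{finite,linorder}) set \<Rightarrow> 'n cfun \<Rightarrow> real" where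
  "norm2 \<Omega> F = sqrt (Sc (inner2 \<Omega> F F))"


section \<open>The half-space, the Dirac operator and the sesquilinear form\<close>

text \<open>The distinguished coordinate y is the one with the largest index; the remaining indices
  carry the coordinates x.\<close>

definition last_ix :: "'n::{finite,linorder}" where
  "last_ix = Max UNIV"

definition ycoord :: "real ^ 'n::{finite,linorder} \<Rightarrow> real" where
  "ycoord p = p $ last_ix"

definition half_space :: "(real ^ 'n::{finite,linorder}) set" where
  "half_space = {p. ycoord p > 0}"

definition normD :: "(real ^ 'n::{finite,linorder}) set \<Rightarrow> 'n cfun \<Rightarrow> real" where
  "normD \<Omega> F = sqrt ((\<Sum>i\<in>UNIV - {last_ix}. (norm2 \<Omega> (weak_partial \<Omega> i F))\<^sup>2) +
     (norm2 \<Omega> (weak_partial \<Omega> last_ix F))\<^sup>2)"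

definition alpha :: "nat \<Rightarrow> real" where
  "alpha n = (real n - 1) / 2"

definition beta :: "nat \<Rightarrow> real" where
  "beta n = alpha n + (alpha n)\<^sup>2"

definition dirac_H :: "(real ^ 'n::{finite,linorder}) set \<Rightarrow> 'n cfun \<Rightarrow> 'n cfun" where
  "dirac_H \<Omega> F = (\<lambda>p.
     (\<Sum>i\<in>UNIV - {last_ix}. clif_gen i \<odot> (ycoord p *\<^sub>R weak_partial \<Omega> i F p))
     - alpha CARD('n) *\<^sub>R (clif_gen last_ix \<odot> F p)
     + clif_gen last_ix \<odot> (ycoord p *\<^sub>R weak_partial \<Omega> last_ix F p))"

definition q_form :: "(real ^ 'n::{finite,linorder}) set \<Rightarrow> 'n clifford \<Rightarrow>
    'n cfun \<Rightarrow> 'n cfun \<Rightarrow> 'n clifford" where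
  "q_form \<Omega> s F G =
     (\<Sum>i\<in>UNIV - {last_ix}.
        inner2 \<Omega> (\<lambda>p. (ycoord p)\<^sup>2 *\<^sub>R weak_partial \<Omega> i F p) (weak_partial \<Omega> i G))
     + inner2 \<Omega> (\<lambda>p. (ycoord p)\<^sup>2 *\<^sub>R weak_partial \<Omega> last_ix F p) (weak_partial \<Omega> last_ix G)
     + (2 * (1 + alpha CARD('n))) *\<^sub>R inner2 \<Omega> (\<lambda>p. ycoord p *\<^sub>R weak_partial \<Omega> last_ix F p) G
     + inner2 \<Omega> (\<lambda>p. (clif_gen last_ix - (2 * Sc s) *\<^sub>R clif_one) \<odot> dirac_H \<Omega> F p) G
     + inner2 \<Omega> (\<lambda>p. ((norm s)\<^sup>2 - beta CARD('n)) *\<^sub>R F p) G"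

definition weak_solution :: "(real ^ 'n::{finite,linorder}) set \<Rightarrow> 'n clifford \<Rightarrow>
    'n cfun \<Rightarrow> 'n cfun \<Rightarrow> bool" where
  "weak_solution \<Omega> s f F \<longleftrightarrow> F \<in> H10 \<Omega> \<and> (\<forall>G\<in>H10 \<Omega>. q_form \<Omega> s F G = inner2 \<Omega> f G)"

definition Q_inverse :: "(real ^ 'n::{finite,linorder}) set \<Rightarrow> 'n clifford \<Rightarrow>
    'n cfun \<Rightarrow> 'n cfun" where
  "Q_inverse \<Omega> s f = (SOME F. weak_solution \<Omega> s f F)"

definition K_const :: "real \<Rightarrow> real \<Rightarrow> 'n::{finite,linorder} clifford \<Rightarrow> real" where
  "K_const m M s =
     1/2 * \<bar>(norm s)\<^sup>2 - beta CARD('n)\<bar> - 1/2 * alpha CARD('n) * sqrt (1 + 4 * (Sc s)\<^sup>2) + 1/2 * m\<^sup>2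
     - 1/2 * sqrt ((\<bar>(norm s)\<^sup>2 - beta CARD('n)\<bar> - alpha CARD('n) * sqrt (1 + 4 * (Sc s)\<^sup>2) - m\<^sup>2)\<^sup>2
         + M\<^sup>2 * (2 * (1 + alpha CARD('n)) + sqrt (real CARD('n)) * sqrt (1 + 4 * (Sc s)\<^sup>2))\<^sup>2)"

end

theory Submission
  imports Defs "HOL-Library.Function_Algebras"
begin

text \<open>
  The scalar part of the form is a bounded and coercive real bilinear form on the Sobolev space, so
  that the Lax--Milgram theorem gives the weak solution, and coercivity gives uniqueness and the
  estimates.

  Coercivity holds pointwise.  Write e and d for the norms of F and of its gradient at a point of
  \<open>\<Omega>\<close>, \<open>c = |s|\<^sup>2 - \<beta>\<close> and \<open>S\<close> for the square root of \<open>1 + 4 s\<^sub>0\<^sup>2\<close>.  Left multiplication by a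
  generator is an isometry, and left multiplication by \<open>e\<^sub>n - 2 s\<^sub>0\<close> multiplies norms by \<open>S\<close>;
  since \<open>m \<le> y \<le> M\<close>, the integrand of the scalar form is at least
  \<open>m\<^sup>2 d\<^sup>2 - M (2 (1 + \<alpha>) + sqrt n S) d e + (c - \<alpha> S) e\<^sup>2\<close>, provided that \<open>c\<close> is nonnegative.
  The smallest eigenvalue of this quadratic form in d and e is the constant \<open>K\<close>
  (\<open>q_op_coercive\<close>).  The last hypothesis of the theorem forces \<open>c\<close> to be nonnegative and makes the
  determinant positive, and the trace is positive by the hypothesis before it; hence \<open>K > 0\<close>
  (\<open>K_const_pos\<close>).  If F is a solution, testing with F itself gives
  \<open>K (\<parallel>F\<parallel>\<^sub>2\<^sup>2 + \<parallel>F\<parallel>\<^sub>D\<^sup>2) \<le> \<parallel>f\<parallel>\<^sub>2 \<parallel>F\<parallel>\<^sub>2\<close>, and both estimates follow.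

  It is enough to solve the scalar equation for all test elements G: the space is stable under right
  multiplication by basis elements, and the coefficients of a Clifford number z are, up to sign, the
  scalar parts of the products of z with the basis elements (\<open>weak_solution_iff\<close>).

  The remaining work concerns the function spaces.  Their elements are functions rather than classes
  modulo null sets, and a weak derivative is one chosen representative; so the Lax--Milgram theorem
  is proved for complete semi-inner product spaces, and linearity of the weak derivative almost
  everywhere rests on its uniqueness, the fundamental lemma of the calculus of variations
  (\<open>AE_eq_0_if_orthogonal_to_test_functions\<close>).  Completeness of the Sobolev space
  (\<open>semi_hilbert_space_H10\<close>) follows from the Riesz--Fischer theorem for the pairs of a function and
  its gradient.
\<close>


section \<open>The Lax--Milgram theorem in complete semi-inner product spaces\<close>

text \<open>Functions form a real vector space pointwise; function spaces are subspaces of it.\<close>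

instantiation "fun" :: (type, real_vector) real_vector
begin

definition scaleR_fun :: "real \<Rightarrow> ('a \<Rightarrow> 'b) \<Rightarrow> 'a \<Rightarrow> 'b" where
  "scaleR_fun c f = (\<lambda>x. c *\<^sub>R f x)"

instance
  by standard (auto simp: scaleR_fun_def fun_eq_iff algebra_simps)

end

lemma scaleR_fun_apply [simp]: "(c *\<^sub>R f) x = c *\<^sub>R f x"
  by (simp add: scaleR_fun_def)

lemma nonneg_quadratic_discriminant:
  fixes a b c :: real
  assumes nonneg: "\<And>t. 0 \<le> a + 2 * t * b + t\<^sup>2 * c"
  shows "b\<^sup>2 \<le> a * c"
proof (cases "c = 0")
  case True
  have "b = 0"
  proof (rule ccontr)
    assume "b \<noteq> 0"
    \<comment> \<open>At this point the affine function takes the value -1.\<close>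
    then show False
      using nonneg[of "- (a + 1) / (2 * b)"] True by (simp add: field_simps)
  qed
  then show ?thesis using True by simp
next
  case False
  have "0 \<le> c"
  proof (rule ccontr)
    assume "\<not> 0 \<le> c"
    then have c: "c < 0" by simp
    \<comment> \<open>Averaging over t and -t removes the linear term.\<close>
    have "a + 2 * t * b + t\<^sup>2 * c + (a + 2 * (-t) * b + (-t)\<^sup>2 * c) = 2 * (a + t\<^sup>2 * c)" for t
      by simp
    then have *: "0 \<le> a + t\<^sup>2 * c" for t
      using nonneg[of t] nonneg[of "-t"] by (smt (verit))
    have "(sqrt ((\<bar>a\<bar> + 1) / (- c)))\<^sup>2 * c = - (\<bar>a\<bar> + 1)"
      using c by (subst real_sqrt_pow2) (auto simp: field_simps)
    then show False using *[of "sqrt ((\<bar>a\<bar> + 1) / (- c))"] by simp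
  qed
  then have "0 < c" using False by simp
  \<comment> \<open>The minimum of the quadratic function.\<close>
  have "0 \<le> a + 2 * (- b / c) * b + (- b / c)\<^sup>2 * c" by (rule nonneg)
  also have "\<dots> = (a * c - b\<^sup>2) / c"
    using \<open>0 < c\<close> by (simp add: field_simps power2_eq_square)
  finally show ?thesis using \<open>0 < c\<close> by (simp add: field_simps)
qed

text \<open>A vector subspace with a positive semidefinite symmetric bilinear form.  Vectors of norm zero
  are not identified with zero, because the intended elements are functions rather than classes of
  functions modulo null sets.\<close>

locale semi_inner_space =
  fixes V :: "'v::real_vector set" and ip :: "'v \<Rightarrow> 'v \<Rightarrow> real"
  assumes subspace_V: "subspace V"
    and ip_commute: "\<And>u v. u \<in> V \<Longrightarrow> v \<in> V \<Longrightarrow> ip u v = ip v u"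
    and ip_add_left: "\<And>u v w. u \<in> V \<Longrightarrow> v \<in> V \<Longrightarrow> w \<in> V \<Longrightarrow> ip (u + v) w = ip u w + ip v w"
    and ip_scaleR_left: "\<And>c u v. u \<in> V \<Longrightarrow> v \<in> V \<Longrightarrow> ip (c *\<^sub>R u) v = c * ip u v"
    and ip_nonneg: "\<And>u. u \<in> V \<Longrightarrow> 0 \<le> ip u u"
begin

text \<open>The seminorm induced by the form.\<close>

definition snorm :: "'v \<Rightarrow> real" where
  "snorm u = sqrt (ip u u)"

lemma V_add: "u \<in> V \<Longrightarrow> v \<in> V \<Longrightarrow> u + v \<in> V"
  and V_diff: "u \<in> V \<Longrightarrow> v \<in> V \<Longrightarrow> u - v \<in> V"
  and V_scaleR: "u \<in> V \<Longrightarrow> c *\<^sub>R u \<in> V"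
  and V_zero: "0 \<in> V"
  using subspace_V by (auto simp: subspace_add subspace_diff subspace_scale subspace_0)

lemmas V_intros = V_add V_diff V_scaleR V_zero

lemma ip_add_right: "u \<in> V \<Longrightarrow> v \<in> V \<Longrightarrow> w \<in> V \<Longrightarrow> ip u (v + w) = ip u v + ip u w"
  by (metis ip_add_left ip_commute V_add)

lemma ip_scaleR_right: "u \<in> V \<Longrightarrow> v \<in> V \<Longrightarrow> ip u (c *\<^sub>R v) = c * ip u v"
  by (metis ip_scaleR_left ip_commute V_scaleR)

lemma ip_diff_left: "u \<in> V \<Longrightarrow> v \<in> V \<Longrightarrow> w \<in> V \<Longrightarrow> ip (u - v) w = ip u w - ip v w"
  using ip_add_left[of "u - v" v w] by (simp add: V_intros)

lemma ip_diff_right: "u \<in> V \<Longrightarrow> v \<in> V \<Longrightarrow> w \<in> V \<Longrightarrow> ip u (v - w) = ip u v - ip u w"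
  using ip_add_right[of u "v - w" w] by (simp add: V_intros)

lemmas ip_simps = ip_add_left ip_add_right ip_scaleR_left ip_scaleR_right ip_diff_left ip_diff_right

lemma snorm_nonneg: "u \<in> V \<Longrightarrow> 0 \<le> snorm u"
  by (simp add: snorm_def ip_nonneg)

lemma snorm_sq: "u \<in> V \<Longrightarrow> (snorm u)\<^sup>2 = ip u u"
  by (simp add: snorm_def ip_nonneg)

lemma Cauchy_Schwarz:
  assumes "u \<in> V" "v \<in> V"
  shows "\<bar>ip u v\<bar> \<le> snorm u * snorm v"
proof -
  have "(ip u v)\<^sup>2 \<le> ip u u * ip v v"
  proof (rule nonneg_quadratic_discriminant)
    fix t
    have "0 \<le> ip (u + t *\<^sub>R v) (u + t *\<^sub>R v)" using assms by (intro ip_nonneg V_intros)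
    also have "\<dots> = ip u u + 2 * t * ip u v + t\<^sup>2 * ip v v"
      using assms ip_commute[of v u] by (simp add: ip_simps V_intros power2_eq_square algebra_simps)
    finally show "0 \<le> ip u u + 2 * t * ip u v + t\<^sup>2 * ip v v" .
  qed
  then have "\<bar>ip u v\<bar> \<le> sqrt (ip u u * ip v v)"
    by (metis real_sqrt_abs real_sqrt_le_mono)
  then show ?thesis by (simp add: snorm_def real_sqrt_mult)
qed

lemma snorm_diff_le:
  assumes "u \<in> V" "v \<in> V"
  shows "snorm (u - v) \<le> snorm u + snorm v"
proof (rule power2_le_imp_le)
  have "(snorm (u - v))\<^sup>2 = (snorm u)\<^sup>2 - 2 * ip u v + (snorm v)\<^sup>2"
    using assms ip_commute[of v u] by (simp add: snorm_sq ip_simps V_intros)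
  also have "\<dots> \<le> (snorm u + snorm v)\<^sup>2"
    using Cauchy_Schwarz[OF assms] by (simp add: power2_sum)
  finally show "(snorm (u - v))\<^sup>2 \<le> (snorm u + snorm v)\<^sup>2" .
qed (use assms in \<open>simp add: snorm_nonneg\<close>)

lemma snorm_add_le:
  assumes "u \<in> V" "v \<in> V"
  shows "snorm (u + v) \<le> snorm u + snorm v"
proof -
  have "snorm ((-1) *\<^sub>R v) = snorm v"
    using assms unfolding snorm_def by (simp only: ip_simps V_intros) simp
  then show ?thesis using snorm_diff_le[of u "(-1) *\<^sub>R v"] assms V_scaleR[of v "-1"] by simp
qed

lemma ip_tendsto_left:
  assumes "\<And>n. u n \<in> V" "x \<in> V" "v \<in> V" and lim: "(\<lambda>n. snorm (u n - x)) \<longlonglongrightarrow> 0"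
  shows "(\<lambda>n. ip (u n) v) \<longlonglongrightarrow> ip x v"
proof (rule LIM_zero_cancel, rule Lim_null_comparison)
  show "\<forall>\<^sub>F n in sequentially. norm (ip (u n) v - ip x v) \<le> snorm (u n - x) * snorm v"
    using assms Cauchy_Schwarz[of "u _ - x" v] by (simp add: ip_diff_left V_intros)
  show "(\<lambda>n. snorm (u n - x) * snorm v) \<longlonglongrightarrow> 0"
    by (rule tendsto_mult_left_zero[OF lim])
qed

end

text \<open>Every Cauchy sequence has a limit; limits are unique only up to vectors of norm zero.\<close>

locale semi_hilbert_space = semi_inner_space +
  assumes complete: "\<And>u. \<lbrakk>\<And>n. u n \<in> V;
      \<And>e. e > 0 \<Longrightarrow> \<exists>N. \<forall>i\<ge>N. \<forall>j\<ge>N. snorm (u i - u j) < e\<rbrakk> \<Longrightarrow>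
      \<exists>l\<in>V. (\<lambda>n. snorm (u n - l)) \<longlonglongrightarrow> 0"
begin

text \<open>The representing vector minimises the quadratic functional \<^term>\<open>\<lambda>v. ip v v - 2 * l v\<close>; the
  parallelogram identity makes every minimising sequence Cauchy.\<close>

lemma Riesz_representation:
  fixes l :: "'a \<Rightarrow> real"
  assumes add: "\<And>u v. u \<in> V \<Longrightarrow> v \<in> V \<Longrightarrow> l (u + v) = l u + l v"
    and scale: "\<And>c u. u \<in> V \<Longrightarrow> l (c *\<^sub>R u) = c * l u"
    and bound: "\<And>u. u \<in> V \<Longrightarrow> \<bar>l u\<bar> \<le> C * snorm u"
  shows "\<exists>u\<in>V. \<forall>v\<in>V. ip u v = l v"
proof -
  define J where "J v = ip v v - 2 * l v" for v
  have diff: "l (u - v) = l u - l v" if "u \<in> V" "v \<in> V" for u v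
    using add[of "u - v" v] that by (simp add: V_intros)
  have J_ge: "- (C\<^sup>2) \<le> J v" if "v \<in> V" for v
  proof -
    have "0 \<le> (snorm v - C)\<^sup>2" by simp
    then show ?thesis using bound[OF that] snorm_sq[OF that]
      unfolding J_def by (simp add: power2_diff mult.commute)
  qed
  define \<mu> where "\<mu> = (INF v\<in>V. J v)"
  have bdd: "bdd_below (J ` V)" using J_ge by (auto intro!: bdd_belowI[of _ "- (C\<^sup>2)"])
  have \<mu>_le: "\<mu> \<le> J v" if "v \<in> V" for v
    unfolding \<mu>_def by (rule cINF_lower[OF bdd that])
  have "\<exists>v\<in>V. J v < \<mu> + 1 / real (Suc n)" for n
    using cINF_less_iff[OF _ bdd, of "\<mu> + 1 / real (Suc n)"] V_zero
    unfolding \<mu>_def by fastforce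
  then obtain u where u: "\<And>n. u n \<in> V" and Ju: "\<And>n. J (u n) < \<mu> + 1 / real (Suc n)"
    by metis
  have cauchy: "(snorm (u i - u j))\<^sup>2 \<le> 2 * (J (u i) - \<mu>) + 2 * (J (u j) - \<mu>)" for i j
  proof -
    let ?w = "(1/2) *\<^sub>R (u i + u j)"
    have "\<mu> \<le> J ?w" by (intro \<mu>_le V_intros u)
    moreover have "(snorm (u i - u j))\<^sup>2 = 2 * J (u i) + 2 * J (u j) - 4 * J ?w"
      unfolding J_def using u[of i] u[of j] ip_commute[of "u i" "u j"]
      by (simp add: ip_simps V_intros add scale snorm_sq) (simp add: field_simps)
    ultimately show ?thesis by simp
  qed
  have "\<exists>x\<in>V. (\<lambda>n. snorm (u n - x)) \<longlonglongrightarrow> 0"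
  proof (rule complete[OF u])
    fix e :: real assume "e > 0"
    then obtain N where N: "1 / real (Suc N) < e\<^sup>2 / 4"
      using nat_approx_posE[of "e\<^sup>2 / 4"] by (metis divide_pos_pos zero_less_numeral zero_less_power)
    have "snorm (u i - u j) < e" if "i \<ge> N" "j \<ge> N" for i j
    proof -
      have "1 / real (Suc k) \<le> 1 / real (Suc N)" if "k \<ge> N" for k
        using that by (simp add: frac_le)
      from this[OF that(1)] this[OF that(2)]
      have "(snorm (u i - u j))\<^sup>2 < e\<^sup>2"
        using cauchy[of i j] Ju[of i] Ju[of j] N by argo
      then show ?thesis using \<open>e > 0\<close> by (simp add: power_less_imp_less_base)
    qed
    then show "\<exists>N. \<forall>i\<ge>N. \<forall>j\<ge>N. snorm (u i - u j) < e" by blast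
  qed
  then obtain x where x: "x \<in> V" and lim: "(\<lambda>n. snorm (u n - x)) \<longlonglongrightarrow> 0" by blast
  have "J x \<le> \<mu>"
  proof (rule LIMSEQ_le_const)
    have J_x: "J x \<le> J (u n) + 2 * (snorm x + \<bar>C\<bar>) * snorm (u n - x)" for n
    proof -
      have "J (u n) = J x + (snorm (u n - x))\<^sup>2 + 2 * ip (u n - x) x - 2 * l (u n - x)"
        unfolding J_def using u[of n] x ip_commute[of "u n" x]
        by (simp add: ip_simps V_intros diff snorm_sq)
      moreover have "\<bar>ip (u n - x) x\<bar> \<le> snorm (u n - x) * snorm x"
        by (intro Cauchy_Schwarz V_intros u x)
      moreover have "\<bar>l (u n - x)\<bar> \<le> \<bar>C\<bar> * snorm (u n - x)"
        using bound[of "u n - x"] snorm_nonneg[of "u n - x"] u x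
        by (smt (verit) V_diff mult_right_mono)
      ultimately show ?thesis
        using zero_le_power2[of "snorm (u n - x)"] unfolding abs_le_iff
        by (simp only: distrib_left distrib_right mult.assoc mult.commute[of "snorm x"]) linarith
    qed
    show "(\<lambda>n. \<mu> + 1 / real (Suc n) + 2 * (snorm x + \<bar>C\<bar>) * snorm (u n - x)) \<longlonglongrightarrow> \<mu>"
      using tendsto_add[OF tendsto_add[OF tendsto_const[of \<mu>] LIMSEQ_Suc[OF lim_1_over_n]]
        tendsto_mult_left[OF lim, of "2 * (snorm x + \<bar>C\<bar>)"]] by simp
    show "\<exists>N. \<forall>n\<ge>N. J x \<le> \<mu> + 1 / real (Suc n) + 2 * (snorm x + \<bar>C\<bar>) * snorm (u n - x)"
      using J_x Ju by (intro exI[of _ 0]) (smt (verit))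
  qed
  have "ip x v = l v" if v: "v \<in> V" for v
  proof -
    have "(ip x v - l v)\<^sup>2 \<le> 0 * ip v v"
    proof (rule nonneg_quadratic_discriminant)
      fix t
      have "J x \<le> J (x + t *\<^sub>R v)"
        using \<open>J x \<le> \<mu>\<close> \<mu>_le[of "x + t *\<^sub>R v"] x v by (simp add: V_intros)
      also have "J (x + t *\<^sub>R v) = J x + 2 * t * (ip x v - l v) + t\<^sup>2 * ip v v"
        unfolding J_def using x v ip_commute[of x v]
        by (simp add: ip_simps V_intros add scale power2_eq_square algebra_simps)
      finally show "0 \<le> 0 + 2 * t * (ip x v - l v) + t\<^sup>2 * ip v v" by simp
    qed
    then show ?thesis by simp
  qed
  then show ?thesis using x by blast
qed

text \<open>The iteration \<open>u\<^sub>k\<^sub>+\<^sub>1 = u\<^sub>k - \<rho> r\<^sub>k\<close>, where \<open>r\<^sub>k\<close> represents the residual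
  \<open>a u\<^sub>k - l\<close>, contracts the residuals by a fixed factor when \<open>\<rho> = \<kappa> / C\<^sup>2\<close>; coercivity turns
  this into convergence of the iterates.\<close>

theorem Lax_Milgram:
  fixes a :: "'a \<Rightarrow> 'a \<Rightarrow> real" and l :: "'a \<Rightarrow> real"
  assumes a_add_left: "\<And>u v w. u \<in> V \<Longrightarrow> v \<in> V \<Longrightarrow> w \<in> V \<Longrightarrow> a (u + v) w = a u w + a v w"
    and a_scale_left: "\<And>c u w. u \<in> V \<Longrightarrow> w \<in> V \<Longrightarrow> a (c *\<^sub>R u) w = c * a u w"
    and a_add_right: "\<And>u v w. u \<in> V \<Longrightarrow> v \<in> V \<Longrightarrow> w \<in> V \<Longrightarrow> a u (v + w) = a u v + a u w"
    and a_scale_right: "\<And>c u w. u \<in> V \<Longrightarrow> w \<in> V \<Longrightarrow> a u (c *\<^sub>R w) = c * a u w"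
    and a_bound: "\<And>u v. u \<in> V \<Longrightarrow> v \<in> V \<Longrightarrow> \<bar>a u v\<bar> \<le> C * (snorm u * snorm v)"
    and a_coercive: "\<And>u. u \<in> V \<Longrightarrow> \<kappa> * (snorm u)\<^sup>2 \<le> a u u" and "0 < \<kappa>"
    and l_add: "\<And>u v. u \<in> V \<Longrightarrow> v \<in> V \<Longrightarrow> l (u + v) = l u + l v"
    and l_scale: "\<And>c u. u \<in> V \<Longrightarrow> l (c *\<^sub>R u) = c * l u"
    and l_bound: "\<And>u. u \<in> V \<Longrightarrow> \<bar>l u\<bar> \<le> D * snorm u"
  shows "\<exists>u\<in>V. \<forall>v\<in>V. a u v = l v"
proof -
  \<comment> \<open>Enlarging the bound to at least \<open>\<kappa>\<close> makes the contraction factor q below well defined.\<close>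
  define C' where "C' = max C \<kappa>"
  have C': "0 < C'" "\<kappa> \<le> C'" "C \<le> C'" using \<open>0 < \<kappa>\<close> by (auto simp: C'_def)
  have a_bound': "\<bar>a u v\<bar> \<le> C' * snorm u * snorm v" if "u \<in> V" "v \<in> V" for u v
    using a_bound[OF that] mult_right_mono[OF C'(3), of "snorm u * snorm v"] that
    by (simp add: snorm_nonneg mult.assoc)
  have a_diff_left: "a (u - v) w = a u w - a v w" if "u \<in> V" "v \<in> V" "w \<in> V" for u v w
    using a_add_left[of "u - v" v w] that by (simp add: V_intros)
  have "\<exists>Au\<in>V. \<forall>v\<in>V. ip Au v = a u v" if "u \<in> V" for u
    by (rule Riesz_representation[where C="C' * snorm u"])
      (use that in \<open>auto simp: a_add_right a_scale_right a_bound'\<close>)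
  then obtain A where A: "\<And>u. u \<in> V \<Longrightarrow> A u \<in> V" and ip_A: "\<And>u v. u \<in> V \<Longrightarrow> v \<in> V \<Longrightarrow> ip (A u) v = a u v"
    by metis
  obtain b where b: "b \<in> V" and ip_b: "\<And>v. v \<in> V \<Longrightarrow> ip b v = l v"
    using Riesz_representation[of l D] l_add l_scale l_bound by blast
  have A_bound: "snorm (A u) \<le> C' * snorm u" if "u \<in> V" for u
  proof -
    have "(snorm (A u))\<^sup>2 \<le> C' * snorm u * snorm (A u)"
      using ip_A[OF that A[OF that]] a_bound'[OF that A[OF that]] snorm_sq[OF A[OF that]] by simp
    then show ?thesis
      using snorm_nonneg[OF A[OF that]] snorm_nonneg[OF that] C'(1)
      by (cases "snorm (A u) = 0") (auto simp: power2_eq_square)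
  qed
  define \<rho> where "\<rho> = \<kappa> / C'\<^sup>2"
  have "0 < \<rho>" using C' \<open>0 < \<kappa>\<close> by (simp add: \<rho>_def)
  define q where "q = sqrt (1 - \<kappa>\<^sup>2 / C'\<^sup>2)"
  have \<kappa>C: "\<kappa>\<^sup>2 \<le> C'\<^sup>2" using C' \<open>0 < \<kappa>\<close> by (simp add: power_mono)
  then have q: "0 \<le> q" "q < 1" "q\<^sup>2 = 1 - \<kappa>\<^sup>2 / C'\<^sup>2"
    using C' \<open>0 < \<kappa>\<close> by (auto simp: q_def)
  have contract: "snorm (w - \<rho> *\<^sub>R A w) \<le> q * snorm w" if w: "w \<in> V" for w
  proof (rule power2_le_imp_le)
    have "(snorm (w - \<rho> *\<^sub>R A w))\<^sup>2 = (snorm w)\<^sup>2 - 2 * \<rho> * a w w + \<rho>\<^sup>2 * (snorm (A w))\<^sup>2"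
      using w A[OF w] ip_A[OF w w] ip_commute[of w "A w"]
      by (simp add: snorm_sq ip_simps V_intros) (simp add: power2_eq_square algebra_simps)
    also have "\<dots> \<le> (snorm w)\<^sup>2 - 2 * \<rho> * (\<kappa> * (snorm w)\<^sup>2) + \<rho>\<^sup>2 * (C' * snorm w)\<^sup>2"
      using a_coercive[OF w] A_bound[OF w] snorm_nonneg[OF A[OF w]] snorm_nonneg[OF w] \<open>0 < \<rho>\<close>
      by (intro add_mono diff_mono mult_left_mono power_mono) auto
    also have "\<dots> = (1 - \<kappa>\<^sup>2 / C'\<^sup>2) * (snorm w)\<^sup>2"
      using C' by (simp add: \<rho>_def field_simps power2_eq_square)
    finally show "(snorm (w - \<rho> *\<^sub>R A w))\<^sup>2 \<le> (q * snorm w)\<^sup>2"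
      by (simp add: power_mult_distrib q)
  qed (use w q in \<open>simp add: snorm_nonneg\<close>)
  define u where "u = rec_nat 0 (\<lambda>_ x. x - \<rho> *\<^sub>R (A x - b))"
  define r where "r k = A (u k) - b" for k
  have u_Suc: "u (Suc k) = u k - \<rho> *\<^sub>R r k" for k by (simp add: u_def r_def)
  have u: "u k \<in> V" for k
    by (induction k) (auto simp: u_Suc r_def A b V_intros, simp add: u_def V_zero)
  have r: "r k \<in> V" for k unfolding r_def by (intro V_intros A b u)
  have ip_r: "ip (r k) v = a (u k) v - l v" if "v \<in> V" for k v
    using that u[of k] by (simp add: r_def ip_simps A b ip_A ip_b)
  have r_Suc: "snorm (r (Suc k)) \<le> q * snorm (r k)" for k
  proof -
    let ?z = "r (Suc k)" and ?w = "r k - \<rho> *\<^sub>R A (r k)"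
    have a_scale_left': "a (\<rho> *\<^sub>R r k) ?z = \<rho> * a (r k) ?z" by (simp add: a_scale_left r)
    have "(snorm ?z)\<^sup>2 = a (u (Suc k)) ?z - l ?z" using ip_r[of ?z "Suc k"] r[of "Suc k"] by (simp add: snorm_sq)
    also have "\<dots> = a (u k) ?z - \<rho> * a (r k) ?z - l ?z"
      unfolding u_Suc using a_diff_left[of "u k" "\<rho> *\<^sub>R r k" "?z"] a_scale_left'
      by (simp add: u r V_intros)
    also have "\<dots> = ip ?w ?z"
      using ip_r[of ?z k] ip_A[of "r k" ?z] by (simp add: ip_simps V_intros A r)
    also have "\<dots> \<le> snorm ?w * snorm ?z"
      using Cauchy_Schwarz[of ?w ?z] by (simp add: V_intros A r)
    also have "\<dots> \<le> q * snorm (r k) * snorm ?z"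
      by (intro mult_right_mono contract r snorm_nonneg)
    finally show ?thesis
      using snorm_nonneg[OF r[of "Suc k"]] snorm_nonneg[OF r[of k]] q
      by (cases "snorm ?z = 0") (auto simp: power2_eq_square)
  qed
  have "snorm (r k) \<le> q ^ k * snorm (r 0)" for k
  proof (induction k)
    case (Suc k)
    then show ?case using r_Suc[of k] mult_left_mono[OF Suc q(1)] by simp
  qed simp
  moreover have "(\<lambda>k. q ^ k * snorm (r 0)) \<longlonglongrightarrow> 0"
    using q by (intro tendsto_mult_left_zero LIMSEQ_realpow_zero)
  ultimately have r_lim: "(\<lambda>k. snorm (r k)) \<longlonglongrightarrow> 0"
    by (rule_tac tendsto_sandwich[OF _ _ tendsto_const])
      (auto simp: snorm_nonneg r)
  \<comment> \<open>Coercivity bounds the distance of two iterates by their residuals, so the iterates are Cauchy.\<close>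
  have u_diff: "\<kappa> * snorm (u i - u j) \<le> snorm (r i) + snorm (r j)" for i j
  proof -
    let ?d = "u i - u j"
    have d: "?d \<in> V" by (intro V_intros u)
    have "\<kappa> * (snorm ?d)\<^sup>2 \<le> a ?d ?d" by (rule a_coercive[OF d])
    also have "\<dots> = ip (r i - r j) ?d"
      using d u[of i] u[of j] by (simp add: ip_diff_left r ip_r a_diff_left)
    also have "\<dots> \<le> snorm (r i - r j) * snorm ?d"
      using Cauchy_Schwarz[of "r i - r j" ?d] d by (simp add: V_intros r)
    also have "\<dots> \<le> (snorm (r i) + snorm (r j)) * snorm ?d"
      by (intro mult_right_mono snorm_diff_le r snorm_nonneg d)
    finally show ?thesis
      using snorm_nonneg[OF d] snorm_nonneg[OF r[of i]] snorm_nonneg[OF r[of j]]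
      by (cases "snorm ?d = 0") (auto simp: power2_eq_square)
  qed
  have "\<exists>x\<in>V. (\<lambda>n. snorm (u n - x)) \<longlonglongrightarrow> 0"
  proof (rule complete[OF u])
    fix e :: real assume "e > 0"
    then have "eventually (\<lambda>k. snorm (r k) < \<kappa> * e / 2) sequentially"
      using order_tendstoD(2)[OF r_lim, of "\<kappa> * e / 2"] \<open>0 < \<kappa>\<close> by simp
    then obtain N where N: "\<And>k. k \<ge> N \<Longrightarrow> snorm (r k) < \<kappa> * e / 2"
      by (auto simp: eventually_sequentially)
    have "snorm (u i - u j) < e" if "i \<ge> N" "j \<ge> N" for i j
    proof -
      have "\<kappa> * snorm (u i - u j) < \<kappa> * e" using u_diff[of i j] N[OF that(1)] N[OF that(2)] by simp
      then show ?thesis using \<open>0 < \<kappa>\<close> by simp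
    qed
    then show "\<exists>N. \<forall>i\<ge>N. \<forall>j\<ge>N. snorm (u i - u j) < e" by blast
  qed
  then obtain x where x: "x \<in> V" and lim: "(\<lambda>n. snorm (u n - x)) \<longlonglongrightarrow> 0" by blast
  have "a x v = l v" if v: "v \<in> V" for v
  proof -
    have "\<bar>a x v - l v\<bar> \<le> C' * snorm v * snorm (u k - x) + snorm v * snorm (r k)" for k
    proof -
      have "a x v - l v = ip (r k) v - a (u k - x) v"
        using v x by (simp add: ip_r a_diff_left u)
      moreover have "\<bar>ip (r k) v\<bar> \<le> snorm (r k) * snorm v" by (intro Cauchy_Schwarz r v)
      moreover have "\<bar>a (u k - x) v\<bar> \<le> C' * snorm (u k - x) * snorm v"
        by (intro a_bound' V_intros u x v)
      ultimately show ?thesis by (simp add: mult_ac)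
    qed
    moreover have "(\<lambda>k. C' * snorm v * snorm (u k - x) + snorm v * snorm (r k)) \<longlonglongrightarrow> 0"
      using tendsto_add[OF tendsto_mult_left[OF lim, of "C' * snorm v"] tendsto_mult_left[OF r_lim, of "snorm v"]]
      by simp
    ultimately have "\<bar>a x v - l v\<bar> \<le> 0"
      by (intro LIMSEQ_le_const[of _ 0]) auto
    then show ?thesis by simp
  qed
  then show ?thesis using x by blast
qed

end

section \<open>Square integrable functions\<close>

text \<open>Square integrable functions with values in a Euclidean space; functions that agree almost
  everywhere are not identified.\<close>

definition sq_integrable :: "'a measure \<Rightarrow> ('a \<Rightarrow> 'b::euclidean_space) set" where
  "sq_integrable M = {F \<in> borel_measurable M. integrable M (\<lambda>x. (norm (F x))\<^sup>2)}"

text \<open>The inner product of square integrable functions.\<close>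

definition l2_inner :: "'a measure \<Rightarrow> ('a \<Rightarrow> 'b::euclidean_space) \<Rightarrow> ('a \<Rightarrow> 'b) \<Rightarrow> real" where
  "l2_inner M F G = (LINT x|M. F x \<bullet> G x)"

lemma sq_integrable_measurable: "F \<in> sq_integrable M \<Longrightarrow> F \<in> borel_measurable M"
  and sq_integrable_integrable: "F \<in> sq_integrable M \<Longrightarrow> integrable M (\<lambda>x. (norm (F x))\<^sup>2)"
  by (auto simp: sq_integrable_def)

lemma sq_integrable_bound:
  assumes F: "F \<in> sq_integrable M" and G: "G \<in> borel_measurable M"
    and le: "\<And>x. x \<in> space M \<Longrightarrow> norm (G x) \<le> C * norm (F x)"
  shows "G \<in> sq_integrable M"
proof -
  have "integrable M (\<lambda>x. (norm (G x))\<^sup>2)"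
  proof (rule Bochner_Integration.integrable_bound)
    show "integrable M (\<lambda>x. C\<^sup>2 * (norm (F x))\<^sup>2)"
      using sq_integrable_integrable[OF F] by simp
    show "AE x in M. norm ((norm (G x))\<^sup>2) \<le> norm (C\<^sup>2 * (norm (F x))\<^sup>2)"
      using le by (intro AE_I2) (auto simp: power_mult_distrib[symmetric] intro!: power_mono)
  qed (use G in measurable)
  then show ?thesis using G by (simp add: sq_integrable_def)
qed

lemma inner_le_sum_squares: "2 * \<bar>x \<bullet> y\<bar> \<le> (norm x)\<^sup>2 + (norm y)\<^sup>2"
  using Cauchy_Schwarz_ineq2[of x y] sum_squares_bound[of "norm x" "norm y"] by simp

lemma sq_integrable_inner:
  assumes F: "F \<in> sq_integrable M" and G: "G \<in> sq_integrable M"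
  shows "integrable M (\<lambda>x. F x \<bullet> G x)"
proof (rule Bochner_Integration.integrable_bound)
  show "integrable M (\<lambda>x. (norm (F x))\<^sup>2 + (norm (G x))\<^sup>2)"
    using sq_integrable_integrable[OF F] sq_integrable_integrable[OF G] by simp
  show "AE x in M. norm (F x \<bullet> G x) \<le> norm ((norm (F x))\<^sup>2 + (norm (G x))\<^sup>2)"
    by (intro AE_I2) (smt (verit) inner_le_sum_squares real_norm_def)
qed (use sq_integrable_measurable[OF F] sq_integrable_measurable[OF G] in measurable)

lemma sq_integrable_add:
  assumes F: "F \<in> sq_integrable M" and G: "G \<in> sq_integrable M"
  shows "(\<lambda>x. F x + G x) \<in> sq_integrable M"
proof -
  have "integrable M (\<lambda>x. (norm (F x + G x))\<^sup>2)"
  proof (rule Bochner_Integration.integrable_bound)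
    show "integrable M (\<lambda>x. 2 * ((norm (F x))\<^sup>2 + (norm (G x))\<^sup>2))"
      using sq_integrable_integrable[OF F] sq_integrable_integrable[OF G] by simp
    have "(norm (F x + G x))\<^sup>2 \<le> 2 * ((norm (F x))\<^sup>2 + (norm (G x))\<^sup>2)" for x
      using inner_le_sum_squares[of "F x" "G x"]
      by (simp add: power2_norm_eq_inner inner_simps inner_commute)
    then show "AE x in M. norm ((norm (F x + G x))\<^sup>2) \<le> norm (2 * ((norm (F x))\<^sup>2 + (norm (G x))\<^sup>2))"
      by simp
  qed (use sq_integrable_measurable[OF F] sq_integrable_measurable[OF G] in measurable)
  then show ?thesis
    using sq_integrable_measurable[OF F] sq_integrable_measurable[OF G] by (simp add: sq_integrable_def)
qed

lemma sq_integrable_scaleR: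
  "F \<in> sq_integrable M \<Longrightarrow> (\<lambda>x. c *\<^sub>R F x) \<in> sq_integrable M"
  by (auto simp: sq_integrable_def power_mult_distrib)

lemma sq_integrable_linear:
  assumes F: "F \<in> sq_integrable M" and T: "bounded_linear T"
  shows "(\<lambda>x. T (F x)) \<in> sq_integrable M"
proof (rule sq_integrable_bound[OF F])
  show "(\<lambda>x. T (F x)) \<in> borel_measurable M"
    using T sq_integrable_measurable[OF F]
    by (intro borel_measurable_continuous_on[where f=T]) (auto intro: linear_continuous_on)
  show "norm (T (F x)) \<le> onorm T * norm (F x)" for x by (rule onorm[OF T])
qed

lemma subspace_sq_integrable: "subspace (sq_integrable M)"
proof (rule subspaceI)
  show "0 \<in> sq_integrable M" by (simp add: sq_integrable_def zero_fun_def)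
  show "F + G \<in> sq_integrable M" if "F \<in> sq_integrable M" "G \<in> sq_integrable M" for F G
    using sq_integrable_add[OF that] by (simp add: plus_fun_def)
  show "c *\<^sub>R F \<in> sq_integrable M" if "F \<in> sq_integrable M" for c F
    using sq_integrable_scaleR[OF that] by (simp add: scaleR_fun_def)
qed

lemma sq_integrable_diff:
  "F \<in> sq_integrable M \<Longrightarrow> G \<in> sq_integrable M \<Longrightarrow> (\<lambda>x. F x - G x) \<in> sq_integrable M"
  using subspace_diff[OF subspace_sq_integrable, of F M G] by (simp add: fun_diff_def)

lemma semi_inner_space_sq_integrable: "semi_inner_space (sq_integrable M) (l2_inner M)"
proof
  show "subspace (sq_integrable M)" by (rule subspace_sq_integrable)
qed (auto simp: l2_inner_def inner_commute inner_add_right sq_integrable_inner)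

interpretation L2: semi_inner_space "sq_integrable M" "l2_inner M" for M :: "'a measure"
  by (rule semi_inner_space_sq_integrable)

text \<open>Along a subsequence with \<open>\<parallel>F\<^sub>r\<^sub>(\<^sub>k\<^sub>+\<^sub>1\<^sub>) - F\<^sub>r\<^sub>(\<^sub>k\<^sub>)\<parallel>\<^sup>2 \<le> 8\<^sup>-\<^sup>k\<close> the series of
  \<open>4\<^sup>k |F\<^sub>r\<^sub>(\<^sub>k\<^sub>+\<^sub>1\<^sub>) - F\<^sub>r\<^sub>(\<^sub>k\<^sub>)|\<^sup>2\<close> has a finite integral, so the increments are
  dominated by a geometric sequence almost everywhere.\<close>

lemma AE_convergent_of_fast_Cauchy:
  fixes F :: "nat \<Rightarrow> 'a \<Rightarrow> 'b::euclidean_space"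
  assumes F: "\<And>k. F k \<in> sq_integrable M"
    and fast: "\<And>k. (LINT x|M. (norm (F (Suc k) x - F k x))\<^sup>2) \<le> (1/8) ^ k"
  shows "AE x in M. convergent (\<lambda>k. F k x)"
proof -
  note [measurable] = sq_integrable_measurable[OF F]
  define h where "h k x = 4 ^ k * (norm (F (Suc k) x - F k x))\<^sup>2" for k x
  have int: "integrable M (\<lambda>x. (norm (F (Suc k) x - F k x))\<^sup>2)" for k
    using sq_integrable_diff[OF F F] by (rule sq_integrable_integrable)
  have [measurable]: "h k \<in> borel_measurable M" for k unfolding h_def by measurable
  have h_int: "(\<integral>\<^sup>+x. ennreal (h k x) \<partial>M) \<le> ennreal ((1/2) ^ k)" for k
  proof -
    have "(\<integral>\<^sup>+x. ennreal (h k x) \<partial>M) = ennreal (LINT x|M. h k x)"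
      using int[of k] by (intro nn_integral_eq_integral) (auto simp: h_def)
    also have "(LINT x|M. h k x) \<le> 4 ^ k * (1/8) ^ k"
      using fast[of k] by (simp add: h_def)
    also have "(4::real) ^ k * (1/8) ^ k = (1/2) ^ k"
      by (simp add: power_mult_distrib[symmetric])
    finally show ?thesis by (simp add: ennreal_leI)
  qed
  have "(\<integral>\<^sup>+x. (\<Sum>k. ennreal (h k x)) \<partial>M) = (\<Sum>k. \<integral>\<^sup>+x. ennreal (h k x) \<partial>M)"
    by (rule nn_integral_suminf) simp
  also have "\<dots> \<le> (\<Sum>k. ennreal ((1/2) ^ k))"
    by (intro suminf_le h_int) auto
  also have "\<dots> < \<infinity>"
    by (subst suminf_ennreal2) (auto simp: ennreal_less_top)
  finally have "AE x in M. (\<Sum>k. ennreal (h k x)) \<noteq> \<infinity>"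
    by (intro nn_integral_noteq_infinite) auto
  then show ?thesis
  proof eventually_elim
    case (elim x)
    have "summable (\<lambda>k. h k x)"
      by (rule summable_suminf_not_top) (use elim in \<open>auto simp: h_def\<close>)
    then have "Bseq (\<lambda>k. h k x)" by (rule summable_imp_Bseq)
    then obtain B where "B > 0" and B: "\<And>k. norm (h k x) \<le> B" by (auto simp: Bseq_def)
    have "norm (F (Suc k) x - F k x) \<le> sqrt B * (1/2) ^ k" for k
    proof (rule power2_le_imp_le)
      have "(4::real) ^ k = (2 ^ k)\<^sup>2" by (simp add: power_mult[symmetric] power_even_eq[symmetric] power2_eq_square power_mult_distrib[symmetric])
      then show "(norm (F (Suc k) x - F k x))\<^sup>2 \<le> (sqrt B * (1/2) ^ k)\<^sup>2"
        using B[of k] \<open>B > 0\<close> by (simp add: h_def power_mult_distrib field_simps power_one_over)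
    qed (use \<open>B > 0\<close> in simp)
    moreover have "summable (\<lambda>k. sqrt B * (1/2) ^ k)" by (intro summable_mult summable_geometric) simp
    ultimately have "summable (\<lambda>k. F (Suc k) x - F k x)"
      by (rule summable_comparison_test'[where N=0, rotated])
    then have "convergent (\<lambda>n. (\<Sum>k<n. F (Suc k) x - F k x))" by (simp add: summable_iff_convergent)
    then have "convergent (\<lambda>n. F n x - F 0 x)" using sum_lessThan_telescope[of "\<lambda>k. F k x"] by simp
    then show "convergent (\<lambda>k. F k x)" by (simp add: convergent_diff_const_right_iff)
  qed
qed

text \<open>The Riesz--Fischer theorem: a fast subsequence converges almost everywhere, and Fatou's lemma
  shows that its pointwise limit is also the limit in the mean.\<close>

lemma semi_hilbert_space_sq_integrable:
  "semi_hilbert_space (sq_integrable M :: ('a \<Rightarrow> 'b::euclidean_space) set) (l2_inner M)"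
proof (intro semi_hilbert_space.intro semi_inner_space_sq_integrable semi_hilbert_space_axioms.intro)
  fix F :: "nat \<Rightarrow> 'a \<Rightarrow> 'b"
  assume F: "\<And>n. F n \<in> sq_integrable M"
    and Cauchy: "\<And>e. e > 0 \<Longrightarrow> \<exists>N. \<forall>i\<ge>N. \<forall>j\<ge>N. L2.snorm M (F i - F j) < e"
  note [measurable] = sq_integrable_measurable[OF F]
  have diff: "F i - F j \<in> sq_integrable M" for i j by (intro L2.V_diff F)
  have sq: "(L2.snorm M (F i - F j))\<^sup>2 = (LINT x|M. (norm (F i x - F j x))\<^sup>2)" for i j
    using diff by (subst L2.snorm_sq) (auto simp: l2_inner_def power2_norm_eq_inner)
  have "\<exists>N. \<forall>i\<ge>N. \<forall>j\<ge>N. (LINT x|M. (norm (F i x - F j x))\<^sup>2) < e" if "e > 0" for e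
  proof -
    obtain N where N: "\<forall>i\<ge>N. \<forall>j\<ge>N. L2.snorm M (F i - F j) < sqrt e"
      using Cauchy[of "sqrt e"] \<open>e > 0\<close> by auto
    have "(L2.snorm M (F i - F j))\<^sup>2 < e" if "i \<ge> N" "j \<ge> N" for i j
      using N that power_strict_mono[of "L2.snorm M (F i - F j)" "sqrt e" 2] \<open>e > 0\<close> L2.snorm_nonneg[OF diff]
      by simp
    then show ?thesis unfolding sq by blast
  qed
  then obtain N where N: "\<And>e i j. e > 0 \<Longrightarrow> i \<ge> N e \<Longrightarrow> j \<ge> N e \<Longrightarrow> (LINT x|M. (norm (F i x - F j x))\<^sup>2) < e"
    by metis
  \<comment> \<open>The index is beyond the thresholds for all of the first k + 1 tolerances, and at least k.\<close>
  define r where "r k = (\<Sum>i\<le>k. N ((1/8) ^ i)) + k" for k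
  have r_N: "r j \<ge> N ((1/8) ^ k)" if "j \<ge> k" for j k
    unfolding r_def using that member_le_sum[of k "{..j}" "\<lambda>i. N ((1/8) ^ i)"] by simp
  have r_ge: "r k \<ge> k" for k by (simp add: r_def)
  have "AE x in M. convergent (\<lambda>k. F (r k) x)"
    using N[of "(1/8) ^ _"] r_N F by (intro AE_convergent_of_fast_Cauchy) (auto intro!: less_imp_le)
  define L where "L x = lim (\<lambda>k. F (r k) x)" for x
  have [measurable]: "L \<in> borel_measurable M"
    unfolding L_def by (rule borel_measurable_lim_metric) simp
  have lim: "AE x in M. (\<lambda>k. F (r k) x) \<longlonglongrightarrow> L x"
    using \<open>AE x in M. convergent (\<lambda>k. F (r k) x)\<close>
    by eventually_elim (simp add: L_def convergent_LIMSEQ_iff)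
  have dist: "(\<integral>\<^sup>+x. ennreal ((norm (F n x - L x))\<^sup>2) \<partial>M) \<le> ennreal e" if "e > 0" "n \<ge> N e" for e n
  proof -
    have "(\<integral>\<^sup>+x. ennreal ((norm (F n x - L x))\<^sup>2) \<partial>M)
        = (\<integral>\<^sup>+x. liminf (\<lambda>k. ennreal ((norm (F n x - F (r k) x))\<^sup>2)) \<partial>M)"
    proof (rule nn_integral_cong_AE, use lim in eventually_elim)
      case (elim x)
      then have "(\<lambda>k. ennreal ((norm (F n x - F (r k) x))\<^sup>2)) \<longlonglongrightarrow> ennreal ((norm (F n x - L x))\<^sup>2)"
        by (intro tendsto_intros tendsto_ennrealI)
      then show ?case by (intro lim_imp_Liminf[symmetric]) auto
    qed
    also have "\<dots> \<le> liminf (\<lambda>k. \<integral>\<^sup>+x. ennreal ((norm (F n x - F (r k) x))\<^sup>2) \<partial>M)"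
      by (rule nn_integral_liminf) simp
    also have "\<dots> \<le> limsup (\<lambda>k. \<integral>\<^sup>+x. ennreal ((norm (F n x - F (r k) x))\<^sup>2) \<partial>M)"
      by (rule Liminf_le_Limsup) simp
    also have "\<dots> \<le> ennreal e"
    proof (rule Limsup_bounded)
      have "(\<integral>\<^sup>+x. ennreal ((norm (F n x - F (r k) x))\<^sup>2) \<partial>M) \<le> ennreal e" if "k \<ge> N e" for k
      proof -
        have "(\<integral>\<^sup>+x. ennreal ((norm (F n x - F (r k) x))\<^sup>2) \<partial>M) = ennreal (LINT x|M. (norm (F n x - F (r k) x))\<^sup>2)"
          using sq_integrable_integrable[OF diff[of n "r k"]] by (intro nn_integral_eq_integral) auto
        also have "\<dots> \<le> ennreal e"
          using N[of e n "r k"] \<open>e > 0\<close> \<open>n \<ge> N e\<close> that r_ge[of k] by (intro ennreal_leI less_imp_le) auto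
        finally show ?thesis .
      qed
      then show "\<forall>\<^sub>F k in sequentially. (\<integral>\<^sup>+x. ennreal ((norm (F n x - F (r k) x))\<^sup>2) \<partial>M) \<le> ennreal e"
        by (auto simp: eventually_sequentially)
    qed
    finally show ?thesis .
  qed
  have int: "integrable M (\<lambda>x. (norm (F n x - L x))\<^sup>2)" if "n \<ge> N 1" for n
    using dist[of 1 n] that by (intro integrableI_bounded) (auto intro: le_less_trans)
  have FL: "F n - L \<in> sq_integrable M" if "n \<ge> N 1" for n
    using int[OF that] by (simp add: sq_integrable_def fun_diff_def)
  have "F (N 1) - (F (N 1) - L) \<in> sq_integrable M"
    by (intro L2.V_diff F FL) simp
  then have L: "L \<in> sq_integrable M" by simp
  have sqL: "(L2.snorm M (F n - L))\<^sup>2 = (LINT x|M. (norm (F n x - L x))\<^sup>2)" for n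
    using L2.V_diff[OF F L] by (subst L2.snorm_sq) (auto simp: l2_inner_def power2_norm_eq_inner)
  have "(\<lambda>n. L2.snorm M (F n - L)) \<longlonglongrightarrow> 0"
  proof (rule LIMSEQ_I)
    fix e :: real assume "e > 0"
    define d where "d = (e / 2)\<^sup>2"
    have "d > 0" using \<open>e > 0\<close> by (simp add: d_def)
    have "L2.snorm M (F n - L) < e" if n: "n \<ge> max (N 1) (N d)" for n
    proof -
      have "ennreal (LINT x|M. (norm (F n x - L x))\<^sup>2) \<le> ennreal d"
        using dist[of d n] \<open>d > 0\<close> n nn_integral_eq_integral[OF int[of n]] by simp
      then have "(L2.snorm M (F n - L))\<^sup>2 \<le> (e / 2)\<^sup>2"
        unfolding sqL using \<open>d > 0\<close> by (simp add: d_def)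
      then have "L2.snorm M (F n - L) \<le> e / 2"
        by (rule power2_le_imp_le) (use \<open>e > 0\<close> in simp)
      then show ?thesis using \<open>e > 0\<close> by simp
    qed
    then show "\<exists>no. \<forall>n\<ge>no. norm (L2.snorm M (F n - L) - 0) < e"
      using L2.snorm_nonneg[OF L2.V_diff[OF F L]] by (intro exI[of _ "max (N 1) (N d)"]) auto
  qed
  then show "\<exists>l\<in>sq_integrable M. (\<lambda>n. L2.snorm M (F n - l)) \<longlonglongrightarrow> 0"
    using L by blast
qed

section \<open>Smooth functions and cut-off functions\<close>

lemma Ck_on_SucI:
  assumes "\<And>x. (f has_derivative f' x) (at x)" and "\<And>v. Ck_on k (\<lambda>x. f' x v) UNIV"
  shows "Ck_on (Suc k) f UNIV"
proof -
  have "frechet_derivative f (at x) = f' x" for x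
    by (rule frechet_derivative_at[OF assms(1), symmetric])
  then show ?thesis using assms by (auto simp: differentiable_def)
qed

lemma Ck_on_SucD:
  assumes "Ck_on (Suc k) f UNIV"
  shows "(f has_derivative frechet_derivative f (at x)) (at x)"
    and "Ck_on k (\<lambda>x. frechet_derivative f (at x) v) UNIV"
  using assms by (auto simp: frechet_derivative_works)

lemma Ck_on_Suc_imp: "Ck_on (Suc k) f UNIV \<Longrightarrow> Ck_on k f UNIV"
proof (induction k arbitrary: f)
  case 0
  then show ?case
    by (auto intro!: continuous_at_imp_continuous_on differentiable_imp_continuous_within)
next
  case (Suc k)
  show ?case
    by (rule Ck_on_SucI[OF Ck_on_SucD(1)[OF Suc.prems]])
      (rule Suc.IH[OF Ck_on_SucD(2)[OF Suc.prems]])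
qed

lemma Ck_on_const: "Ck_on k (\<lambda>_. c) UNIV"
proof (induction k arbitrary: c)
  case (Suc k)
  show ?case by (rule Ck_on_SucI[where f'="\<lambda>_ _. 0"]) (auto intro: Suc)
qed simp

lemma Ck_on_add:
  "Ck_on k f UNIV \<Longrightarrow> Ck_on k g UNIV \<Longrightarrow> Ck_on k (\<lambda>x. f x + g x) UNIV"
proof (induction k arbitrary: f g)
  case (Suc k)
  show ?case
    by (rule Ck_on_SucI[OF has_derivative_add[OF Ck_on_SucD(1)[OF Suc.prems(1)] Ck_on_SucD(1)[OF Suc.prems(2)]]])
      (intro Suc.IH Ck_on_SucD(2) Suc.prems)
qed (auto intro: continuous_intros)

lemma Ck_on_mult:
  "Ck_on k f UNIV \<Longrightarrow> Ck_on k g UNIV \<Longrightarrow> Ck_on k (\<lambda>x. f x * g x) UNIV"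
proof (induction k arbitrary: f g)
  case (Suc k)
  show ?case
    by (rule Ck_on_SucI[OF has_derivative_mult[OF Ck_on_SucD(1)[OF Suc.prems(1)] Ck_on_SucD(1)[OF Suc.prems(2)]]])
      (intro Ck_on_add Suc.IH Ck_on_SucD(2)[OF Suc.prems(1)] Ck_on_SucD(2)[OF Suc.prems(2)]
        Ck_on_Suc_imp[OF Suc.prems(1)] Ck_on_Suc_imp[OF Suc.prems(2)])
qed (auto intro: continuous_intros)

lemma Ck_on_cmult: "Ck_on k f UNIV \<Longrightarrow> Ck_on k (\<lambda>x. c * f x) UNIV"
  by (intro Ck_on_mult Ck_on_const)

lemma Ck_on_prod:
  "finite I \<Longrightarrow> (\<And>i. i \<in> I \<Longrightarrow> Ck_on k (f i) UNIV) \<Longrightarrow> Ck_on k (\<lambda>x. \<Prod>i\<in>I. f i x) UNIV"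
  by (induction I rule: finite_induct) (auto intro: Ck_on_const Ck_on_mult)

text \<open>For \<open>c > 0\<close> the functions \<open>exp (- c / t) / t ^ j\<close> on the positive half-line, extended by zero, are closed
  under differentiation up to linear combinations; hence all of them are smooth.\<close>

definition flat_fun :: "real \<Rightarrow> nat \<Rightarrow> real \<Rightarrow> real" where
  "flat_fun c j t = (if t > 0 then exp (- c / t) / t ^ j else 0)"

lemma flat_fun_nonneg: "0 \<le> flat_fun c j t"
  by (simp add: flat_fun_def)

text \<open>The term of order j + 2 of the exponential series of \<open>c / t\<close> dominates.  The quadratic bound is
  what gives derivative zero at the origin.\<close>

lemma flat_fun_le_square:
  assumes "c > 0"
  shows "flat_fun c j t \<le> fact (j + 2) / c ^ (j + 2) * t\<^sup>2"
proof (cases "t > 0")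
  case True
  define k where "k = j + 2"
  have "(c / t) ^ k / fact k = (\<Sum>n\<in>{k}. (c / t) ^ n /\<^sub>R fact n)"
    by (simp add: field_simps)
  also have "\<dots> \<le> exp (c / t)"
    using True assms exp_converges[of "c / t"]
    by (subst sums_unique[OF exp_converges]) (intro sum_le_suminf, auto simp: sums_iff)
  finally have "(c / t) ^ k / fact k \<le> exp (c / t)" .
  then have "exp (- c / t) \<le> fact k / (c / t) ^ k"
    using True assms by (simp add: exp_minus field_simps)
  then have "flat_fun c j t \<le> fact k / (c / t) ^ k / t ^ j"
    using True by (simp add: flat_fun_def divide_right_mono del: divide_divide_eq_left)
  also have "\<dots> = fact k / c ^ k * t\<^sup>2"
    using True assms by (simp add: k_def field_simps power_add power2_eq_square)
  finally show ?thesis by (simp add: k_def)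
qed (use assms in \<open>simp add: flat_fun_def\<close>)

lemma flat_fun_has_real_derivative:
  assumes "c > 0"
  shows "(flat_fun c j has_real_derivative c * flat_fun c (j + 2) t - real j * flat_fun c (j + 1) t) (at t)"
proof -
  consider "t > 0" | "t < 0" | "t = 0" by linarith
  then show ?thesis
  proof cases
    case 1
    have "((\<lambda>t. exp (- c / t) / t ^ j) has_real_derivative c * flat_fun c (j + 2) t - real j * flat_fun c (j + 1) t) (at t)"
      using 1 by (auto intro!: derivative_eq_intros simp: flat_fun_def field_simps power2_eq_square)
        (cases j; simp add: field_simps)
    then show ?thesis
      by (rule DERIV_cong_ev[OF refl _ refl, THEN iffD1, rotated])
        (use 1 in \<open>auto simp: flat_fun_def eventually_nhds intro!: exI[of _ "{0<..}"]\<close>)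
  next
    case 2
    have "((\<lambda>t. 0) has_real_derivative c * flat_fun c (j + 2) t - real j * flat_fun c (j + 1) t) (at t)"
      using 2 by (simp add: flat_fun_def)
    then show ?thesis
      by (rule DERIV_cong_ev[OF refl _ refl, THEN iffD1, rotated])
        (use 2 in \<open>auto simp: flat_fun_def eventually_nhds intro!: exI[of _ "{..<0}"]\<close>)
  next
    case 3
    let ?C = "fact (j + 2) / c ^ (j + 2)"
    have "((\<lambda>h. (flat_fun c j (0 + h) - flat_fun c j 0) / h) \<longlongrightarrow> 0) (at 0)"
    proof (rule Lim_null_comparison)
      show "\<forall>\<^sub>F h in at 0. norm ((flat_fun c j (0 + h) - flat_fun c j 0) / h) \<le> ?C * \<bar>h\<bar>"
      proof (rule eventually_at_filter[THEN iffD2], intro always_eventually allI impI)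
        fix h :: real assume "h \<noteq> 0"
        have "norm ((flat_fun c j (0 + h) - flat_fun c j 0) / h) = flat_fun c j h / \<bar>h\<bar>"
          using flat_fun_nonneg[of c j h] by (simp add: flat_fun_def)
        also have "\<dots> \<le> ?C * h\<^sup>2 / \<bar>h\<bar>"
          using flat_fun_le_square[OF assms, of j h] by (intro divide_right_mono) auto
        also have "\<dots> = ?C * \<bar>h\<bar>" using \<open>h \<noteq> 0\<close> by (simp add: power2_eq_square abs_if)
        finally show "norm ((flat_fun c j (0 + h) - flat_fun c j 0) / h) \<le> ?C * \<bar>h\<bar>" .
      qed
      show "((\<lambda>h. ?C * \<bar>h\<bar>) \<longlongrightarrow> 0) (at 0)"
        by (intro tendsto_eq_intros) auto
    qed
    then show ?thesis using 3 by (simp add: DERIV_def flat_fun_def)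
  qed
qed

lemma Ck_on_flat_fun:
  fixes u :: "'a::euclidean_space"
  assumes "c > 0"
  shows "Ck_on k (\<lambda>x. flat_fun c j (x \<bullet> u + d)) UNIV"
proof (induction k arbitrary: j)
  case 0
  have "isCont (flat_fun c j) t" for t
    using flat_fun_has_real_derivative[OF assms] by (rule DERIV_isCont)
  then have "continuous_on UNIV (flat_fun c j)" by (simp add: continuous_at_imp_continuous_on)
  then show ?case
    unfolding Ck_on.simps by (rule continuous_on_compose2) (auto intro!: continuous_intros)
next
  case (Suc k)
  let ?D = "\<lambda>t. c * flat_fun c (j + 2) t + (- real j) * flat_fun c (j + 1) t"
  show ?case
  proof (rule Ck_on_SucI)
    have "(flat_fun c j has_real_derivative ?D t) (at t)" for t
      using flat_fun_has_real_derivative[OF assms, of j t] by simp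
    then show "((\<lambda>x. flat_fun c j (x \<bullet> u + d)) has_derivative (\<lambda>v. ?D (x \<bullet> u + d) * (v \<bullet> u))) (at x)" for x
      by (rule has_derivative_compose[where g="flat_fun c j", rotated, OF has_field_derivative_imp_has_derivative])
        (auto intro!: derivative_eq_intros)
    show "Ck_on k (\<lambda>x. ?D (x \<bullet> u + d) * (v \<bullet> u)) UNIV" for v
      by (intro Ck_on_mult Ck_on_add Ck_on_const Suc.IH)
  qed
qed

text \<open>For \<open>c > 0\<close>, a smooth function with values in [0,1] that is positive exactly on an open box; it
  tends to the indicator function of the box as c tends to 0 from above.\<close>

definition box_bump :: "'a::euclidean_space \<Rightarrow> 'a \<Rightarrow> real \<Rightarrow> 'a \<Rightarrow> real" where
  "box_bump a b c x = (\<Prod>i\<in>Basis. flat_fun c 0 (x \<bullet> i + - (a \<bullet> i)) * flat_fun c 0 (x \<bullet> (-i) + b \<bullet> i))"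

lemma smooth_box_bump: "c > 0 \<Longrightarrow> smooth_on (box_bump a b c) UNIV"
  unfolding smooth_on_def box_bump_def
  by (intro allI Ck_on_prod Ck_on_mult Ck_on_flat_fun) auto

lemma box_bump_eq_0_iff: "box_bump a b c x = 0 \<longleftrightarrow> x \<notin> box a b"
  by (force simp: box_bump_def mem_box flat_fun_def not_less)

lemma box_bump_bounds:
  assumes "c > 0"
  shows "0 \<le> box_bump a b c x" "box_bump a b c x \<le> 1"
proof -
  have "flat_fun c 0 t \<le> 1" for t using assms by (simp add: flat_fun_def)
  then show "0 \<le> box_bump a b c x" "box_bump a b c x \<le> 1"
    unfolding box_bump_def
    by (auto intro!: prod_nonneg prod_le_1 mult_nonneg_nonneg mult_le_one flat_fun_nonneg)
qed

lemma box_bump_tendsto_indicator: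
  "(\<lambda>k. box_bump a b (1 / real (Suc k)) x) \<longlonglongrightarrow> indicator (box a b) x"
proof -
  have flat: "(\<lambda>k. flat_fun (1 / real (Suc k)) 0 t) \<longlonglongrightarrow> (if t > 0 then 1 else 0)" for t
  proof (cases "t > 0")
    case True
    have "(\<lambda>k. exp (- (1 / real (Suc k)) / t)) \<longlonglongrightarrow> exp (- 0 / t)"
      by (intro tendsto_intros LIMSEQ_Suc[OF lim_1_over_n]) (use True in auto)
    then show ?thesis using True by (simp add: flat_fun_def)
  qed (simp add: flat_fun_def)
  have "(\<lambda>k. box_bump a b (1 / real (Suc k)) x) \<longlonglongrightarrow>
      (\<Prod>i\<in>Basis. (if x \<bullet> i + - (a \<bullet> i) > 0 then 1 else 0) * (if x \<bullet> (-i) + b \<bullet> i > 0 then 1 else 0))"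
    unfolding box_bump_def by (intro tendsto_prod tendsto_mult flat)
  also have "(\<Prod>i\<in>Basis. (if x \<bullet> i + - (a \<bullet> i) > 0 then 1 else 0) * (if x \<bullet> (-i) + b \<bullet> i > 0 then 1 else 0))
      = (indicator (box a b) x :: real)"
    by (cases "x \<in> box a b") (force simp: mem_box not_less)+
  finally show ?thesis .
qed

lemma box_bump_test_function:
  fixes a b :: "real ^ 'n"
  assumes "cbox a b \<subseteq> \<Omega>" "c > 0"
  shows "box_bump a b c \<in> test_functions \<Omega>"
proof -
  have "closure {x. box_bump a b c x \<noteq> 0} \<subseteq> cbox a b"
    by (rule closure_minimal) (auto simp: box_bump_eq_0_iff intro: box_subset_cbox[THEN subsetD])
  then show ?thesis
    using assms by (auto simp: test_functions_def smooth_box_bump compact_eq_bounded_closed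
        intro: bounded_subset[OF bounded_cbox])
qed

section \<open>Test functions and weak derivatives\<close>

lemma L2_real_eq: "L2_real \<Omega> = sq_integrable (lebesgue_on \<Omega>)"
  by (simp add: L2_real_def sq_integrable_def)

lemma
  fixes h :: "'a::euclidean_space \<Rightarrow> real"
  assumes h: "continuous_on UNIV h" "compact K" "\<And>x. x \<notin> K \<Longrightarrow> h x = 0"
  shows integrable_compact_support: "integrable lborel h"
    and integrable_on_compact_support: "K \<subseteq> \<Omega> \<Longrightarrow> open \<Omega> \<Longrightarrow> integrable (lebesgue_on \<Omega>) h"
    and integral_on_compact_support: "K \<subseteq> \<Omega> \<Longrightarrow> open \<Omega> \<Longrightarrow> (LINT x|lebesgue_on \<Omega>. h x) = (LINT x|lborel. h x)"
proof -
  have eq: "(\<lambda>x. indicator K x *\<^sub>R h x) = h"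
    using h(3) by (auto simp: fun_eq_iff indicator_def)
  show int: "integrable lborel h"
    using borel_integrable_compact[OF h(2) continuous_on_subset[OF h(1)]] eq by simp
  have meas: "h \<in> borel_measurable borel" using h(1) by (rule borel_measurable_continuous_onI)
  assume \<Omega>: "K \<subseteq> \<Omega>" "open \<Omega>"
  then have leb: "\<Omega> \<in> sets lebesgue" by simp
  have eq': "(\<lambda>x. if x \<in> \<Omega> then h x else 0) = h"
    using h(3) \<Omega> by (auto simp: fun_eq_iff)
  show "integrable (lebesgue_on \<Omega>) h"
    using int meas Lebesgue_Measure.integrable_restrict_UNIV[OF leb, of h]
    by (simp add: eq' integrable_completion)
  show "(LINT x|lebesgue_on \<Omega>. h x) = (LINT x|lborel. h x)"
    using meas Lebesgue_Measure.integral_restrict_UNIV[OF leb, of h]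
    by (simp add: eq' integral_completion)
qed

text \<open>The closed support.\<close>

definition fsupport :: "('a::topological_space \<Rightarrow> real) \<Rightarrow> 'a set" where
  "fsupport \<phi> = closure {x. \<phi> x \<noteq> 0}"

lemma test_functionD:
  assumes "\<phi> \<in> test_functions \<Omega>"
  shows "Ck_on k \<phi> UNIV" "continuous_on UNIV \<phi>"
    and "(\<phi> has_derivative frechet_derivative \<phi> (at x)) (at x)"
    and "compact (fsupport \<phi>)" "fsupport \<phi> \<subseteq> \<Omega>"
proof -
  show Ck: "Ck_on k \<phi> UNIV" for k using assms by (simp add: test_functions_def smooth_on_def)
  show "continuous_on UNIV \<phi>" using Ck[of 0] by simp
  show "(\<phi> has_derivative frechet_derivative \<phi> (at x)) (at x)"
    by (rule Ck_on_SucD(1)[OF Ck[of "Suc 0"]])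
qed (use assms in \<open>auto simp: test_functions_def fsupport_def\<close>)

lemma test_function_outside: "x \<notin> fsupport \<phi> \<Longrightarrow> \<phi> x = 0"
  unfolding fsupport_def using closure_subset[of "{x. \<phi> x \<noteq> 0}"] by blast

lemma test_functionI:
  assumes "\<And>k. Ck_on k \<phi> UNIV" and "compact K" "K \<subseteq> \<Omega>" "\<And>x. x \<notin> K \<Longrightarrow> \<phi> x = 0"
  shows "\<phi> \<in> test_functions \<Omega>"
proof -
  have "closure {x. \<phi> x \<noteq> 0} \<subseteq> K"
    using assms by (intro closure_minimal) (auto intro: compact_imp_closed)
  then show ?thesis
    using assms bounded_subset[of K]
    by (auto simp: test_functions_def smooth_on_def compact_eq_bounded_closed)
qed

lemma test_function_scale:
  assumes "\<phi> \<in> test_functions \<Omega>"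
  shows "(\<lambda>x. c * \<phi> x) \<in> test_functions \<Omega>"
  by (rule test_functionI[OF Ck_on_cmult[OF test_functionD(1)[OF assms]] test_functionD(4,5)[OF assms]])
    (simp add: test_function_outside[of _ \<phi>])

lemma test_function_add:
  assumes "\<phi> \<in> test_functions \<Omega>" "\<psi> \<in> test_functions \<Omega>"
  shows "(\<lambda>x. \<phi> x + \<psi> x) \<in> test_functions \<Omega>"
  by (rule test_functionI[OF Ck_on_add[OF assms[THEN test_functionD(1)]] compact_Un[OF assms[THEN test_functionD(4)]]
      Un_least[OF assms[THEN test_functionD(5)]]])
    (simp add: test_function_outside[of _ \<phi>] test_function_outside[of _ \<psi>])

lemma test_function_mult:
  assumes "\<phi> \<in> test_functions \<Omega>" "\<psi> \<in> test_functions \<Omega>"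
  shows "(\<lambda>x. \<phi> x * \<psi> x) \<in> test_functions \<Omega>"
  by (rule test_functionI[OF Ck_on_mult[OF assms[THEN test_functionD(1)]] test_functionD(4,5)[OF assms(1)]])
    (simp add: test_function_outside[of _ \<phi>] test_function_outside[of _ \<psi>])

lemma test_function_partial:
  assumes "\<phi> \<in> test_functions \<Omega>"
  shows "(\<lambda>x. frechet_derivative \<phi> (at x) v) \<in> test_functions \<Omega>"
proof (rule test_functionI[where K="fsupport \<phi>"])
  show "Ck_on k (\<lambda>x. frechet_derivative \<phi> (at x) v) UNIV" for k
    by (rule Ck_on_SucD(2)[OF test_functionD(1)[OF assms]])
next
  fix x assume x: "x \<notin> fsupport \<phi>"
  have op: "open (- fsupport \<phi>)" by (simp add: fsupport_def open_Compl)
  have "((\<lambda>_. 0) has_derivative frechet_derivative \<phi> (at x)) (at x)"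
  proof (rule has_derivative_transform_within_open[OF test_functionD(3)[OF assms] op])
    show "x \<in> - fsupport \<phi>" using x by simp
    show "\<phi> y = 0" if "y \<in> - fsupport \<phi>" for y using that by (intro test_function_outside) simp
  qed
  then have "frechet_derivative \<phi> (at x) = (\<lambda>_. 0)"
    using has_derivative_unique[OF _ has_derivative_const] by blast
  then show "frechet_derivative \<phi> (at x) v = 0" by simp
qed (use test_functionD[OF assms] in auto)

lemma test_function_bounded:
  assumes "\<phi> \<in> test_functions \<Omega>"
  obtains B where "\<And>x. \<bar>\<phi> x\<bar> \<le> B"
proof -
  have "bounded (\<phi> ` fsupport \<phi>)"
    using test_functionD[OF assms]
    by (intro compact_imp_bounded compact_continuous_image) (auto intro: continuous_on_subset)
  then obtain B where B: "\<And>x. x \<in> fsupport \<phi> \<Longrightarrow> \<bar>\<phi> x\<bar> \<le> B"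
    by (auto simp: bounded_iff)
  have "\<bar>\<phi> x\<bar> \<le> \<bar>B\<bar>" for x
    using B[of x] test_function_outside[of x \<phi>] by (cases "x \<in> fsupport \<phi>") auto
  then show thesis by (rule that)
qed

lemma test_function_L2:
  assumes "\<phi> \<in> test_functions \<Omega>" "open \<Omega>"
  shows "\<phi> \<in> L2_real \<Omega>"
proof -
  have "\<phi> \<in> borel_measurable (lebesgue_on \<Omega>)"
    using test_functionD(2)[OF assms(1)] assms(2)
    by (intro continuous_imp_measurable_on_sets_lebesgue) (auto intro: continuous_on_subset)
  moreover have "integrable (lebesgue_on \<Omega>) (\<lambda>x. (\<phi> x)\<^sup>2)"
    using test_functionD(2,4,5)[OF assms(1)] test_function_outside[of _ \<phi>] assms(2)
    by (intro integrable_on_compact_support[where K="fsupport \<phi>"]) (auto intro: continuous_intros)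
  ultimately show ?thesis by (simp add: L2_real_def)
qed

lemma L2_mult_integrable:
  "f \<in> L2_real \<Omega> \<Longrightarrow> g \<in> L2_real \<Omega> \<Longrightarrow> integrable (lebesgue_on \<Omega>) (\<lambda>x. f x * g x)"
  using sq_integrable_inner[of f "lebesgue_on \<Omega>" g] by (simp add: L2_real_eq)

text \<open>The difference quotients of a test function have integral zero by translation invariance, and
  they converge to the directional derivative.\<close>

lemma integral_test_function_derivative:
  assumes "\<phi> \<in> test_functions \<Omega>"
  shows "(LINT x|lborel. frechet_derivative \<phi> (at x) v) = 0"
proof -
  let ?D = "\<lambda>x. frechet_derivative \<phi> (at x) v"
  let ?K = "fsupport \<phi>"
  let ?t = "\<lambda>k. 1 / real (Suc k)"
  let ?q = "\<lambda>k x. (\<phi> (?t k *\<^sub>R v + x) - \<phi> x) / ?t k"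
  note \<phi> = test_functionD[OF assms]
  have D: "?D \<in> test_functions \<Omega>" by (rule test_function_partial[OF assms])
  obtain B where B: "\<And>x. \<bar>?D x\<bar> \<le> B" using test_function_bounded[OF D] by blast
  obtain R where R: "\<And>x. x \<in> ?K \<Longrightarrow> norm x \<le> R"
    using compact_imp_bounded[OF \<phi>(4)] by (auto simp: bounded_iff)
  have [measurable]: "\<phi> \<in> borel_measurable borel" "?D \<in> borel_measurable borel"
    using \<phi>(2) test_functionD(2)[OF D] by (auto intro: borel_measurable_continuous_onI)
  have int: "integrable lborel \<phi>"
    using \<phi> test_function_outside[of _ \<phi>] by (intro integrable_compact_support[where K="?K"]) auto
  have deriv: "((\<lambda>s. \<phi> (s *\<^sub>R v + x)) has_real_derivative ?D (s *\<^sub>R v + x)) (at s)" for s x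
  proof -
    have "((\<lambda>s. \<phi> (s *\<^sub>R v + x)) has_derivative (\<lambda>h. frechet_derivative \<phi> (at (s *\<^sub>R v + x)) (h *\<^sub>R v))) (at s)"
      by (rule has_derivative_compose[OF _ \<phi>(3)]) (auto intro!: derivative_eq_intros)
    moreover have "(\<lambda>h. frechet_derivative \<phi> (at (s *\<^sub>R v + x)) (h *\<^sub>R v)) = (*) (?D (s *\<^sub>R v + x))"
      using has_derivative_linear[OF \<phi>(3)] by (simp add: fun_eq_iff linear_cmul)
    ultimately show ?thesis by (simp add: has_field_derivative_def)
  qed
  have "(\<lambda>k. LINT x|lborel. ?q k x) \<longlonglongrightarrow> (LINT x|lborel. ?D x)"
  proof (rule integral_dominated_convergence[where w="\<lambda>x. indicator (cball 0 (R + norm v)) x *\<^sub>R B"])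
    show "integrable lborel (\<lambda>x. indicator (cball 0 (R + norm v)) x *\<^sub>R B)"
      by (rule borel_integrable_compact) auto
    show "AE x in lborel. (\<lambda>k. ?q k x) \<longlonglongrightarrow> ?D x"
    proof (rule AE_I2)
      fix x
      have "((\<lambda>h. (\<phi> ((0 + h) *\<^sub>R v + x) - \<phi> (0 *\<^sub>R v + x)) / h) \<longlongrightarrow> ?D (0 *\<^sub>R v + x)) (at 0)"
        using deriv[of x 0] unfolding DERIV_def .
      then show "(\<lambda>k. ?q k x) \<longlonglongrightarrow> ?D x"
        using LIMSEQ_Suc[OF lim_1_over_n]
        by (intro filterlim_compose[of "\<lambda>h. (\<phi> (h *\<^sub>R v + x) - \<phi> x) / h" _ "at 0" ?t])
          (auto simp: filterlim_at)
    qed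
    show "AE x in lborel. norm (?q k x) \<le> indicator (cball 0 (R + norm v)) x *\<^sub>R B" for k
    proof (rule AE_I2)
      fix x
      have t: "0 < ?t k" "?t k \<le> 1" by auto
      show "norm (?q k x) \<le> indicator (cball 0 (R + norm v)) x *\<^sub>R B"
      proof (cases "norm x \<le> R + norm v")
        case True
        \<comment> \<open>The mean value theorem on the segment from \<open>x\<close> to \<open>x + t v\<close>.\<close>
        obtain s where "\<phi> (?t k *\<^sub>R v + x) - \<phi> (0 *\<^sub>R v + x) = (?t k - 0) * ?D (s *\<^sub>R v + x)"
          using MVT2[OF t(1), of "\<lambda>s. \<phi> (s *\<^sub>R v + x)" "\<lambda>s. ?D (s *\<^sub>R v + x)"] deriv by blast
        then have "?q k x = ?D (s *\<^sub>R v + x)" by (simp add: field_simps)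
        then show ?thesis using True B by simp
      next
        case False
        \<comment> \<open>Both end points of the segment are outside the support.\<close>
        then have "\<phi> x = 0" using R[of x] test_function_outside[of x \<phi>] norm_ge_zero[of v] by force
        moreover have "norm x \<le> norm (?t k *\<^sub>R v + x) + norm (?t k *\<^sub>R v)"
          using norm_triangle_ineq4[of "?t k *\<^sub>R v + x" "?t k *\<^sub>R v"] by simp
        moreover have "norm (?t k *\<^sub>R v) \<le> norm v"
          using t mult_right_mono[of "?t k" 1 "norm v"] by simp
        ultimately have "norm (?t k *\<^sub>R v + x) > R" using False by simp
        then have "\<phi> (?t k *\<^sub>R v + x) = 0"
          using R test_function_outside[of _ \<phi>] by fastforce
        with \<open>\<phi> x = 0\<close> show ?thesis using False by simp
      qed
    qed
  qed measurable
  moreover have "(LINT x|lborel. ?q k x) = 0" for k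
  proof -
    have "integrable lborel (\<lambda>x. \<phi> (?t k *\<^sub>R v + x))"
      using int integrable_distr_eq[of "(+) (?t k *\<^sub>R v)" lborel borel \<phi>] by (simp add: lborel_distr_plus)
    moreover have "(LINT x|lborel. \<phi> (?t k *\<^sub>R v + x)) = (LINT x|lborel. \<phi> x)"
      using integral_distr[of "(+) (?t k *\<^sub>R v)" lborel borel \<phi>] by (simp add: lborel_distr_plus)
    ultimately show ?thesis using int by simp
  qed
  ultimately show ?thesis by (simp add: LIMSEQ_const_iff)
qed

text \<open>Integration by parts: the derivative of the product of two test functions has integral zero.\<close>

lemma has_weak_partial_test_function:
  assumes \<phi>: "\<phi> \<in> test_functions \<Omega>" and "open \<Omega>"
  shows "has_weak_partial \<Omega> i \<phi> (\<lambda>x. frechet_derivative \<phi> (at x) (axis i 1))"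
  unfolding has_weak_partial_def
proof
  fix \<psi> assume \<psi>: "\<psi> \<in> test_functions \<Omega>"
  let ?v = "axis i 1 :: real ^ 'a"
  let ?D = "\<lambda>f x. frechet_derivative f (at x) ?v"
  let ?h = "\<lambda>x. \<phi> x * \<psi> x"
  have h: "?h \<in> test_functions \<Omega>" by (rule test_function_mult[OF \<phi> \<psi>])
  have "?D ?h x = \<phi> x * ?D \<psi> x + ?D \<phi> x * \<psi> x" for x
    by (subst frechet_derivative_at[OF has_derivative_mult[OF test_functionD(3)[OF \<phi>] test_functionD(3)[OF \<psi>]], symmetric]) simp
  then have "(LINT x|lebesgue_on \<Omega>. ?D ?h x) = (LINT x|lebesgue_on \<Omega>. \<phi> x * ?D \<psi> x) + (LINT x|lebesgue_on \<Omega>. ?D \<phi> x * \<psi> x)"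
    using \<phi> \<psi> \<open>open \<Omega>\<close> by (simp add: L2_mult_integrable test_function_L2 test_function_partial)
  moreover have "(LINT x|lebesgue_on \<Omega>. ?D ?h x) = (LINT x|lborel. ?D ?h x)"
    using test_functionD(2,4,5)[OF test_function_partial[OF h, of ?v]] test_function_outside[of _ "?D ?h"] \<open>open \<Omega>\<close>
    by (intro integral_on_compact_support[where K="fsupport (?D ?h)"]) auto
  ultimately show "(LINT x|lebesgue_on \<Omega>. \<phi> x * ?D \<psi> x) = - (LINT x|lebesgue_on \<Omega>. ?D \<phi> x * \<psi> x)"
    using integral_test_function_derivative[OF h, of ?v] by simp
qed

lemma indicator_L2:
  assumes \<Omega>: "\<Omega> \<in> sets lebesgue" and S: "S \<in> lmeasurable"
  shows "(indicator S :: real ^ 'n \<Rightarrow> real) \<in> L2_real \<Omega>"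
proof -
  let ?I = "indicator S :: real ^ 'n \<Rightarrow> real"
  have "integrable lebesgue (\<lambda>x. indicator \<Omega> x *\<^sub>R ?I x)"
    using S by (intro integrable_mult_indicator \<Omega>) (simp add: lmeasurable_iff_integrable)
  then have "integrable (lebesgue_on \<Omega>) ?I" by (simp add: integrable_restrict_space \<Omega>)
  moreover have "(\<lambda>x. (?I x)\<^sup>2) = ?I" by (auto simp: indicator_def)
  ultimately show ?thesis by (auto simp: L2_real_def)
qed

text \<open>Dominated convergence along the cut-off functions of the box.\<close>

lemma integral_box_eq_0:
  assumes "open \<Omega>" and g: "g \<in> L2_real \<Omega>"
    and orth: "\<And>\<phi>. \<phi> \<in> test_functions \<Omega> \<Longrightarrow> (LINT x|lebesgue_on \<Omega>. g x * \<phi> x) = 0"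
    and sub: "cbox a b \<subseteq> \<Omega>"
  shows "(LINT x|lebesgue_on \<Omega>. g x * indicator (box a b) x) = 0"
proof -
  have \<Omega>: "\<Omega> \<in> sets lebesgue" using \<open>open \<Omega>\<close> by simp
  have [measurable]: "g \<in> borel_measurable (lebesgue_on \<Omega>)" using g by (simp add: L2_real_def)
  let ?I = "indicator (cbox a b) :: real ^ 'a \<Rightarrow> real"
  have I: "?I \<in> L2_real \<Omega>" by (rule indicator_L2[OF \<Omega>]) simp
  have "(\<lambda>k. LINT x|lebesgue_on \<Omega>. g x * box_bump a b (1 / real (Suc k)) x) \<longlonglongrightarrow>
      (LINT x|lebesgue_on \<Omega>. g x * indicator (box a b) x)"
  proof (rule integral_dominated_convergence[where w="\<lambda>x. \<bar>g x * ?I x\<bar>"])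
    show "integrable (lebesgue_on \<Omega>) (\<lambda>x. \<bar>g x * ?I x\<bar>)"
      using L2_mult_integrable[OF g I] by simp
    show "AE x in lebesgue_on \<Omega>. (\<lambda>k. g x * box_bump a b (1 / real (Suc k)) x) \<longlonglongrightarrow> g x * indicator (box a b) x"
      by (intro AE_I2 tendsto_mult tendsto_const box_bump_tendsto_indicator)
    show "AE x in lebesgue_on \<Omega>. norm (g x * box_bump a b (1 / real (Suc k)) x) \<le> \<bar>g x * ?I x\<bar>" for k
    proof (rule AE_I2)
      fix x
      have "\<bar>box_bump a b (1 / real (Suc k)) x\<bar> \<le> ?I x"
        using box_bump_bounds[of "1 / real (Suc k)" a b x] box_bump_eq_0_iff[of a b "1 / real (Suc k)" x]
          box_subset_cbox[of a b] by (cases "x \<in> box a b") auto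
      then show "norm (g x * box_bump a b (1 / real (Suc k)) x) \<le> \<bar>g x * ?I x\<bar>"
        by (simp add: abs_mult mult_left_mono)
    qed
    have "box_bump a b (1 / real (Suc k)) \<in> L2_real \<Omega>" for k
      using box_bump_test_function[OF sub] \<open>open \<Omega>\<close> by (intro test_function_L2) auto
    then show "(\<lambda>x. g x * box_bump a b (1 / real (Suc k)) x) \<in> borel_measurable (lebesgue_on \<Omega>)" for k
      by (auto simp: L2_real_def intro!: borel_measurable_times)
    show "(\<lambda>x. g x * indicator (box a b) x) \<in> borel_measurable (lebesgue_on \<Omega>)"
      using sub box_subset_cbox[of a b]
      by (intro borel_measurable_times borel_measurable_indicator) (auto simp: sets_restrict_space_iff \<Omega>)
  qed
  moreover have "(LINT x|lebesgue_on \<Omega>. g x * box_bump a b (1 / real (Suc k)) x) = 0" for k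
    using box_bump_test_function[OF sub] by (intro orth) auto
  ultimately show ?thesis by (simp add: LIMSEQ_const_iff)
qed

text \<open>The fundamental lemma of the calculus of variations: cut-off functions approximate indicators of
  boxes, and almost every value is a limit of averages over small cubes.\<close>

lemma AE_eq_0_if_orthogonal_to_test_functions:
  assumes "open \<Omega>" and g: "g \<in> L2_real \<Omega>"
    and orth: "\<And>\<phi>. \<phi> \<in> test_functions \<Omega> \<Longrightarrow> (LINT x|lebesgue_on \<Omega>. g x * \<phi> x) = 0"
  shows "AE x in lebesgue_on \<Omega>. g x = 0"
proof -
  have \<Omega>: "\<Omega> \<in> sets lebesgue" using \<open>open \<Omega>\<close> by simp
  define f where "f x = (if x \<in> \<Omega> then g x else 0)" for x
  have int_S: "set_integrable lebesgue S f" if S: "S \<in> lmeasurable" for S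
  proof -
    let ?I = "indicator S :: real ^ 'a \<Rightarrow> real"
    have "?I \<in> L2_real \<Omega>" by (rule indicator_L2[OF \<Omega> S])
    from L2_mult_integrable[OF g this]
    have "integrable lebesgue (\<lambda>x. if x \<in> \<Omega> then g x * ?I x else 0)"
      by (simp add: Lebesgue_Measure.integrable_restrict_UNIV[OF \<Omega>])
    moreover have "(\<lambda>x. if x \<in> \<Omega> then g x * ?I x else 0) = (\<lambda>x. ?I x *\<^sub>R f x)"
      by (auto simp: f_def indicator_def)
    ultimately show ?thesis by (simp add: set_integrable_def)
  qed
  have "f integrable_on cbox a b" for a b
    by (intro set_lebesgue_integral_eq_integral(1) int_S) simp
  then obtain N where N: "negligible N" and avg: "\<And>x e. \<lbrakk>x \<notin> N; 0 < e\<rbrakk> \<Longrightarrow>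
      \<exists>d>0. \<forall>h. 0 < h \<and> h < d \<longrightarrow> norm (integral (cbox x (x + h *\<^sub>R One)) f /\<^sub>R h ^ DIM(real ^ 'a) - f x) < e"
    by (rule integrable_ccontinuous_explicit) blast
  have zero: "integral (cbox a b) f = 0" if sub: "cbox a b \<subseteq> \<Omega>" for a b
  proof -
    have "integral (cbox a b) f = integral (box a b) f" by (simp add: integral_open_interval)
    also have "\<dots> = (LINT x:box a b|lebesgue. f x)"
      by (intro set_lebesgue_integral_eq_integral(2)[symmetric] int_S) simp
    also have "\<dots> = (LINT x|lebesgue. (if x \<in> \<Omega> then g x * indicator (box a b) x else 0))"
      unfolding set_lebesgue_integral_def
      by (intro Bochner_Integration.integral_cong) (auto simp: f_def indicator_def)
    also have "\<dots> = 0"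
      by (simp add: Lebesgue_Measure.integral_restrict_UNIV[OF \<Omega>] integral_box_eq_0[OF assms sub])
    finally show ?thesis .
  qed
  have "g x = 0" if x: "x \<in> \<Omega>" "x \<notin> N" for x
  proof (rule ccontr)
    assume "g x \<noteq> 0"
    then obtain d where "d > 0" and d: "\<And>h. 0 < h \<Longrightarrow> h < d \<Longrightarrow>
        norm (integral (cbox x (x + h *\<^sub>R One)) f /\<^sub>R h ^ DIM(real ^ 'a) - f x) < \<bar>g x\<bar>"
      using avg[of x "\<bar>g x\<bar>"] x by auto
    obtain r where "r > 0" and r: "cball x r \<subseteq> \<Omega>"
      using \<open>open \<Omega>\<close> x by (auto simp: open_contains_cball)
    \<comment> \<open>The cube of side h at x lies in the ball, since its points have distance at most n h from x.\<close>
    define h where "h = min (d / 2) (r / real CARD('a))"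
    have h: "0 < h" "h < d" "h * real CARD('a) \<le> r"
      using \<open>d > 0\<close> \<open>r > 0\<close> by (auto simp: h_def min_def field_simps)
    have "cbox x (x + h *\<^sub>R One) \<subseteq> cball x r"
    proof
      fix z assume z: "z \<in> cbox x (x + h *\<^sub>R One)"
      have "norm (z - x) \<le> (\<Sum>b\<in>Basis. \<bar>(z - x) \<bullet> b\<bar>)" by (rule norm_le_l1)
      also have "\<dots> \<le> (\<Sum>b\<in>(Basis :: (real ^ 'a) set). h)"
        using z by (intro sum_mono) (auto simp: mem_box inner_diff_left inner_add_left)
      also have "\<dots> = h * real CARD('a)" by simp
      also have "\<dots> \<le> r" by (rule h(3))
      finally show "z \<in> cball x r" by (simp add: dist_norm norm_minus_commute)
    qed
    then show False using d[OF h(1,2)] zero[of x "x + h *\<^sub>R One"] r x by (simp add: f_def)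
  qed
  then have "AE x in lebesgue. x \<in> \<Omega> \<longrightarrow> g x = 0"
    using N by (intro AE_I'[of N]) (auto simp: negligible_iff_null_sets)
  then show ?thesis by (simp add: AE_restrict_space_iff \<Omega>)
qed

lemma has_weak_partial_unique:
  assumes "open \<Omega>" "g \<in> L2_real \<Omega>" "g' \<in> L2_real \<Omega>"
    and "has_weak_partial \<Omega> i f g" "has_weak_partial \<Omega> i f g'"
  shows "AE x in lebesgue_on \<Omega>. g x = g' x"
proof -
  have "AE x in lebesgue_on \<Omega>. g x - g' x = 0"
  proof (rule AE_eq_0_if_orthogonal_to_test_functions[OF \<open>open \<Omega>\<close>])
    show "(\<lambda>x. g x - g' x) \<in> L2_real \<Omega>"
      using assms sq_integrable_diff unfolding L2_real_eq by blast
    fix \<phi> assume \<phi>: "\<phi> \<in> test_functions \<Omega>"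
    then have "(LINT x|lebesgue_on \<Omega>. g x * \<phi> x) = (LINT x|lebesgue_on \<Omega>. g' x * \<phi> x)"
      using assms(4,5) unfolding has_weak_partial_def by fastforce
    then show "(LINT x|lebesgue_on \<Omega>. (g x - g' x) * \<phi> x) = 0"
      using assms \<phi> by (simp add: left_diff_distrib L2_mult_integrable test_function_L2)
  qed
  then show ?thesis by simp
qed

section \<open>The Sobolev space of functions with zero boundary values\<close>

lemma l2_inner_cong_AE:
  assumes "F \<in> sq_integrable M" "F' \<in> sq_integrable M" "G \<in> sq_integrable M" "G' \<in> sq_integrable M"
    and "AE x in M. F x = F' x" "AE x in M. G x = G' x"
  shows "l2_inner M F G = l2_inner M F' G'"
  unfolding l2_inner_def
proof (rule integral_cong_AE)
  show "AE x in M. F x \<bullet> G x = F' x \<bullet> G' x" using assms(5,6) by eventually_elim simp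
qed (use assms(1-4)[THEN sq_integrable_measurable] in measurable)

lemma snorm_cong_AE:
  assumes "F \<in> sq_integrable M" "F' \<in> sq_integrable M" "AE x in M. F x = F' x"
  shows "L2.snorm M F = L2.snorm M F'"
  unfolding L2.snorm_def using l2_inner_cong_AE[OF assms(1,2,1,2,3,3)] by simp

text \<open>The norm of real-valued square integrable functions.\<close>

abbreviation L2norm :: "(real ^ 'n) set \<Rightarrow> (real ^ 'n \<Rightarrow> real) \<Rightarrow> real" where
  "L2norm \<Omega> \<equiv> L2.snorm (lebesgue_on \<Omega>)"

text \<open>The classical partial derivative.\<close>

abbreviation partial_deriv :: "'n \<Rightarrow> (real ^ 'n \<Rightarrow> real) \<Rightarrow> real ^ 'n \<Rightarrow> real" where
  "partial_deriv i \<phi> \<equiv> \<lambda>x. frechet_derivative \<phi> (at x) (axis i 1)"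

lemma subspace_L2_real: "subspace (L2_real \<Omega>)"
  unfolding L2_real_eq by (rule subspace_sq_integrable)

lemma L2norm_add_le: "u \<in> L2_real \<Omega> \<Longrightarrow> v \<in> L2_real \<Omega> \<Longrightarrow> L2norm \<Omega> (u + v) \<le> L2norm \<Omega> u + L2norm \<Omega> v"
  unfolding L2_real_eq by (rule L2.snorm_add_le)

lemma L2norm_scaleR: "u \<in> L2_real \<Omega> \<Longrightarrow> L2norm \<Omega> (c *\<^sub>R u) = \<bar>c\<bar> * L2norm \<Omega> u"
  unfolding L2_real_eq L2.snorm_def
  by (simp add: L2.ip_simps L2.V_intros real_sqrt_mult mult.assoc[symmetric])

lemma L2norm_minus_commute: "u \<in> L2_real \<Omega> \<Longrightarrow> v \<in> L2_real \<Omega> \<Longrightarrow> L2norm \<Omega> (u - v) = L2norm \<Omega> (v - u)"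
  using L2norm_scaleR[of "u - v" \<Omega> "-1"] subspace_diff[OF subspace_L2_real, of u \<Omega> v] by simp

lemma has_weak_partial_lincomb:
  assumes "open \<Omega>" "f \<in> L2_real \<Omega>" "f' \<in> L2_real \<Omega>" "g \<in> L2_real \<Omega>" "g' \<in> L2_real \<Omega>"
    and "has_weak_partial \<Omega> i f g" "has_weak_partial \<Omega> i f' g'"
  shows "has_weak_partial \<Omega> i (\<lambda>x. a * f x + b * f' x) (\<lambda>x. a * g x + b * g' x)"
  unfolding has_weak_partial_def
proof
  fix \<phi> assume \<phi>: "\<phi> \<in> test_functions \<Omega>"
  have L: "\<phi> \<in> L2_real \<Omega>" "partial_deriv i \<phi> \<in> L2_real \<Omega>"
    using \<phi> \<open>open \<Omega>\<close> by (simp_all add: test_function_L2 test_function_partial)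
  show "(LINT x|lebesgue_on \<Omega>. (a * f x + b * f' x) * partial_deriv i \<phi> x) =
      - (LINT x|lebesgue_on \<Omega>. (a * g x + b * g' x) * \<phi> x)"
    using assms(6,7) \<phi> assms(2-5) L
    by (simp add: has_weak_partial_def distrib_right mult.assoc L2_mult_integrable)
qed

lemma has_weak_partial_limit:
  assumes "open \<Omega>" "\<And>k. f k \<in> L2_real \<Omega>" "\<And>k. g k \<in> L2_real \<Omega>" "F \<in> L2_real \<Omega>" "G \<in> L2_real \<Omega>"
    and weak: "\<And>k. has_weak_partial \<Omega> i (f k) (g k)"
    and f: "(\<lambda>k. L2norm \<Omega> (f k - F)) \<longlonglongrightarrow> 0" and g: "(\<lambda>k. L2norm \<Omega> (g k - G)) \<longlonglongrightarrow> 0"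
  shows "has_weak_partial \<Omega> i F G"
  unfolding has_weak_partial_def
proof
  fix \<phi> assume \<phi>: "\<phi> \<in> test_functions \<Omega>"
  have L: "\<phi> \<in> L2_real \<Omega>" "partial_deriv i \<phi> \<in> L2_real \<Omega>"
    using \<phi> \<open>open \<Omega>\<close> by (simp_all add: test_function_L2 test_function_partial)
  let ?ip = "l2_inner (lebesgue_on \<Omega>)"
  have "(\<lambda>k. ?ip (f k) (partial_deriv i \<phi>)) \<longlonglongrightarrow> ?ip F (partial_deriv i \<phi>)"
    using assms(2-5) L f unfolding L2_real_eq by (intro L2.ip_tendsto_left)
  moreover have "(\<lambda>k. - ?ip (g k) \<phi>) \<longlonglongrightarrow> - ?ip G \<phi>"
    using assms(2-5) L g unfolding L2_real_eq by (intro tendsto_minus L2.ip_tendsto_left)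
  moreover have "?ip (f k) (partial_deriv i \<phi>) = - ?ip (g k) \<phi>" for k
    using weak[of k] \<phi> by (simp add: has_weak_partial_def l2_inner_def)
  ultimately have "?ip F (partial_deriv i \<phi>) = - ?ip G \<phi>"
    by (simp add: LIMSEQ_unique)
  then show "(LINT x|lebesgue_on \<Omega>. F x * partial_deriv i \<phi> x) = - (LINT x|lebesgue_on \<Omega>. G x * \<phi> x)"
    by (simp add: l2_inner_def)
qed

lemma weak_partial_real:
  assumes "f \<in> H1_real \<Omega>"
  shows "weak_partial_real \<Omega> i f \<in> L2_real \<Omega>" "has_weak_partial \<Omega> i f (weak_partial_real \<Omega> i f)"
proof -
  have "\<exists>g. g \<in> L2_real \<Omega> \<and> has_weak_partial \<Omega> i f g" using assms by (auto simp: H1_real_def)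
  then have "weak_partial_real \<Omega> i f \<in> L2_real \<Omega> \<and> has_weak_partial \<Omega> i f (weak_partial_real \<Omega> i f)"
    unfolding weak_partial_real_def by (rule someI_ex)
  then show "weak_partial_real \<Omega> i f \<in> L2_real \<Omega>" "has_weak_partial \<Omega> i f (weak_partial_real \<Omega> i f)"
    by auto
qed

lemma weak_partial_real_AE_eq:
  assumes "open \<Omega>" "f \<in> H1_real \<Omega>" "g \<in> L2_real \<Omega>" "has_weak_partial \<Omega> i f g"
  shows "AE x in lebesgue_on \<Omega>. weak_partial_real \<Omega> i f x = g x"
  using has_weak_partial_unique[OF assms(1) weak_partial_real(1)[OF assms(2)] assms(3)
      weak_partial_real(2)[OF assms(2)] assms(4)] .

lemma H10_real_H1: "f \<in> H10_real \<Omega> \<Longrightarrow> f \<in> H1_real \<Omega>"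
  by (simp add: H10_real_def)

lemma H1_real_L2: "f \<in> H1_real \<Omega> \<Longrightarrow> f \<in> L2_real \<Omega>"
  by (simp add: H1_real_def)

lemma H1_norm_real_diff_test:
  assumes "open \<Omega>" "f \<in> H1_real \<Omega>" "\<phi> \<in> test_functions \<Omega>"
  shows "H1_norm_real \<Omega> (\<lambda>x. f x - \<phi> x) = sqrt ((L2norm \<Omega> (f - \<phi>))\<^sup>2 +
     (\<Sum>i\<in>UNIV. (L2norm \<Omega> (weak_partial_real \<Omega> i f - partial_deriv i \<phi>))\<^sup>2))"
proof -
  note f = assms(2)
  let ?w = "\<lambda>i. weak_partial_real \<Omega> i f - partial_deriv i \<phi>"
  have \<phi>: "\<phi> \<in> L2_real \<Omega>" "partial_deriv i \<phi> \<in> L2_real \<Omega>" for i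
    using assms by (simp_all add: test_function_L2 test_function_partial)
  have d: "f - \<phi> \<in> L2_real \<Omega>" "?w i \<in> L2_real \<Omega>" for i
    using f \<phi> by (auto intro!: subspace_diff[OF subspace_L2_real] H1_real_L2[OF f] weak_partial_real(1)[OF f])
  have weak: "has_weak_partial \<Omega> i (f - \<phi>) (?w i)" for i
    using has_weak_partial_lincomb[OF \<open>open \<Omega>\<close> H1_real_L2[OF f] \<phi>(1) weak_partial_real(1)[OF f] \<phi>(2)
        weak_partial_real(2)[OF f] has_weak_partial_test_function[OF assms(3,1)], where a=1 and b="-1"]
    by (simp add: fun_diff_def)
  have H1: "f - \<phi> \<in> H1_real \<Omega>" using d weak by (auto simp: H1_real_def)
  have sq: "(LINT x|lebesgue_on \<Omega>. (u x)\<^sup>2) = (L2norm \<Omega> u)\<^sup>2" if "u \<in> L2_real \<Omega>" for u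
    using that unfolding L2_real_eq by (simp add: L2.snorm_sq l2_inner_def) (simp add: power2_eq_square)
  have "L2norm \<Omega> (weak_partial_real \<Omega> i (f - \<phi>)) = L2norm \<Omega> (?w i)" for i
    by (rule snorm_cong_AE) (use weak_partial_real_AE_eq[OF \<open>open \<Omega>\<close> H1 d(2) weak] weak_partial_real(1)[OF H1] d(2)
      in \<open>auto simp: L2_real_eq\<close>)
  then show ?thesis
    unfolding H1_norm_real_def fun_diff_def[symmetric, of f \<phi>]
    by (simp only: sq[OF d(1)] sq[OF weak_partial_real(1)[OF H1]])
qed

lemma H10_real_approx:
  assumes "open \<Omega>" "f \<in> H10_real \<Omega>" "e > 0"
  obtains \<phi> where "\<phi> \<in> test_functions \<Omega>" "L2norm \<Omega> (f - \<phi>) < e"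
    "\<And>i. L2norm \<Omega> (weak_partial_real \<Omega> i f - partial_deriv i \<phi>) < e"
proof -
  have f: "f \<in> H1_real \<Omega>" using assms(2) by (rule H10_real_H1)
  obtain \<phi> where \<phi>: "\<phi> \<in> test_functions \<Omega>" and less: "H1_norm_real \<Omega> (\<lambda>x. f x - \<phi> x) < e"
    using assms(2,3) unfolding H10_real_def by blast
  let ?a = "L2norm \<Omega> (f - \<phi>)" and ?b = "\<lambda>i. L2norm \<Omega> (weak_partial_real \<Omega> i f - partial_deriv i \<phi>)"
  have sum: "?a\<^sup>2 + (\<Sum>i\<in>UNIV. (?b i)\<^sup>2) < e\<^sup>2"
    using less H1_norm_real_diff_test[OF assms(1) f \<phi>] \<open>e > 0\<close>
      real_sqrt_less_iff[of "?a\<^sup>2 + (\<Sum>i\<in>UNIV. (?b i)\<^sup>2)" "e\<^sup>2"] by simp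
  have "(\<Sum>i\<in>UNIV. (?b i)\<^sup>2) \<ge> 0" by (intro sum_nonneg) simp
  then have "?a < e" using sum \<open>e > 0\<close> by (intro power_less_imp_less_base[of ?a 2 e]) auto
  moreover have "?b i < e" for i
  proof -
    have "(?b i)\<^sup>2 \<le> (\<Sum>i\<in>UNIV. (?b i)\<^sup>2)" by (rule member_le_sum) auto
    then have "(?b i)\<^sup>2 < e\<^sup>2" using sum zero_le_power2[of ?a] by linarith
    then show ?thesis using \<open>e > 0\<close> by (intro power_less_imp_less_base[of "?b i" 2 e]) auto
  qed
  ultimately show thesis using that \<phi> by blast
qed

text \<open>A function is in the space as soon as it and some square integrable functions are the limits of
  test functions and their partial derivatives; the latter limits are then its weak derivatives.\<close>

lemma H10_real_limitI:
  assumes "open \<Omega>" and \<phi>: "\<And>k. \<phi> k \<in> test_functions \<Omega>" and f: "f \<in> L2_real \<Omega>" and g: "\<And>i. g i \<in> L2_real \<Omega>"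
    and lim: "(\<lambda>k. L2norm \<Omega> (\<phi> k - f)) \<longlonglongrightarrow> 0" "\<And>i. (\<lambda>k. L2norm \<Omega> (partial_deriv i (\<phi> k) - g i)) \<longlonglongrightarrow> 0"
  shows "f \<in> H10_real \<Omega>" "AE x in lebesgue_on \<Omega>. weak_partial_real \<Omega> i f x = g i x"
proof -
  have L: "\<phi> k \<in> L2_real \<Omega>" "partial_deriv i (\<phi> k) \<in> L2_real \<Omega>" for k i
    using \<phi> \<open>open \<Omega>\<close> by (simp_all add: test_function_L2 test_function_partial)
  have weak: "has_weak_partial \<Omega> i f (g i)" for i
    by (rule has_weak_partial_limit[OF \<open>open \<Omega>\<close> L f g has_weak_partial_test_function[OF \<phi> \<open>open \<Omega>\<close>] lim])
  have H1: "f \<in> H1_real \<Omega>" using f g weak by (auto simp: H1_real_def)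
  show AE: "AE x in lebesgue_on \<Omega>. weak_partial_real \<Omega> i f x = g i x" for i
    by (rule weak_partial_real_AE_eq[OF \<open>open \<Omega>\<close> H1 g weak])
  have eq: "L2norm \<Omega> (weak_partial_real \<Omega> i f - partial_deriv i (\<phi> k)) = L2norm \<Omega> (partial_deriv i (\<phi> k) - g i)" for i k
  proof -
    have "L2norm \<Omega> (weak_partial_real \<Omega> i f - partial_deriv i (\<phi> k)) = L2norm \<Omega> (g i - partial_deriv i (\<phi> k))"
    proof (rule snorm_cong_AE, unfold L2_real_eq[symmetric])
      show "AE x in lebesgue_on \<Omega>. (weak_partial_real \<Omega> i f - partial_deriv i (\<phi> k)) x = (g i - partial_deriv i (\<phi> k)) x"
        using AE[of i] by eventually_elim simp
    qed (intro subspace_diff[OF subspace_L2_real] weak_partial_real(1)[OF H1] g L)+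
    then show ?thesis by (simp add: L2norm_minus_commute[OF g L(2)])
  qed
  have "(\<lambda>k. H1_norm_real \<Omega> (\<lambda>x. f x - \<phi> k x)) \<longlonglongrightarrow> sqrt (0\<^sup>2 + (\<Sum>i\<in>(UNIV :: 'a set). 0\<^sup>2))"
    unfolding H1_norm_real_diff_test[OF \<open>open \<Omega>\<close> H1 \<phi>] eq L2norm_minus_commute[OF f L(1)]
    by (intro tendsto_intros lim)
  then have "\<exists>\<phi>\<in>test_functions \<Omega>. H1_norm_real \<Omega> (\<lambda>x. f x - \<phi> x) < e" if "e > 0" for e
    using order_tendstoD(2)[of _ 0 sequentially e] that \<phi> by (fastforce simp: eventually_sequentially)
  then show "f \<in> H10_real \<Omega>" using H1 by (simp add: H10_real_def)
qed

lemma H10_real_approx_seq: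
  assumes "open \<Omega>" "f \<in> H10_real \<Omega>"
  obtains \<phi> where "\<And>k. \<phi> k \<in> test_functions \<Omega>" "(\<lambda>k. L2norm \<Omega> (\<phi> k - f)) \<longlonglongrightarrow> 0"
    "\<And>i. (\<lambda>k. L2norm \<Omega> (partial_deriv i (\<phi> k) - weak_partial_real \<Omega> i f)) \<longlonglongrightarrow> 0"
proof -
  have f: "f \<in> H1_real \<Omega>" using assms(2) by (rule H10_real_H1)
  have "\<exists>\<phi>\<in>test_functions \<Omega>. L2norm \<Omega> (f - \<phi>) < 1 / real (Suc k) \<and>
      (\<forall>i. L2norm \<Omega> (weak_partial_real \<Omega> i f - partial_deriv i \<phi>) < 1 / real (Suc k))" for k
    using H10_real_approx[OF assms, of "1 / real (Suc k)"] by auto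
  then obtain \<phi> where \<phi>: "\<And>k. \<phi> k \<in> test_functions \<Omega>" and a: "\<And>k. L2norm \<Omega> (f - \<phi> k) < 1 / real (Suc k)"
    and b: "\<And>k i. L2norm \<Omega> (weak_partial_real \<Omega> i f - partial_deriv i (\<phi> k)) < 1 / real (Suc k)"
    by metis
  have L: "\<phi> k \<in> L2_real \<Omega>" "partial_deriv i (\<phi> k) \<in> L2_real \<Omega>" for k i
    using \<phi> \<open>open \<Omega>\<close> by (simp_all add: test_function_L2 test_function_partial)
  have nn: "0 \<le> L2norm \<Omega> (u - v)" if "u \<in> L2_real \<Omega>" "v \<in> L2_real \<Omega>" for u v
    using that unfolding L2_real_eq by (intro L2.snorm_nonneg L2.V_diff)
  have "(\<lambda>k. L2norm \<Omega> (\<phi> k - f)) \<longlonglongrightarrow> 0"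
    unfolding L2norm_minus_commute[OF L(1) H1_real_L2[OF f]]
    by (rule tendsto_sandwich[OF _ _ tendsto_const LIMSEQ_Suc[OF lim_1_over_n]])
      (intro always_eventually allI nn less_imp_le[OF a] L H1_real_L2[OF f])+
  moreover have "(\<lambda>k. L2norm \<Omega> (partial_deriv i (\<phi> k) - weak_partial_real \<Omega> i f)) \<longlonglongrightarrow> 0" for i
    unfolding L2norm_minus_commute[OF L(2) weak_partial_real(1)[OF f]]
    by (rule tendsto_sandwich[OF _ _ tendsto_const LIMSEQ_Suc[OF lim_1_over_n]])
      (intro always_eventually allI nn less_imp_le[OF b] L weak_partial_real(1)[OF f])+
  ultimately show thesis using that \<phi> by blast
qed

lemma H10_real_lincomb:
  assumes "open \<Omega>" and f: "f \<in> H10_real \<Omega>" and g: "g \<in> H10_real \<Omega>"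
  shows "(\<lambda>x. a * f x + b * g x) \<in> H10_real \<Omega>"
    and "AE x in lebesgue_on \<Omega>. weak_partial_real \<Omega> i (\<lambda>x. a * f x + b * g x) x =
        a * weak_partial_real \<Omega> i f x + b * weak_partial_real \<Omega> i g x"
proof -
  obtain \<phi> where \<phi>: "\<And>k. \<phi> k \<in> test_functions \<Omega>" "(\<lambda>k. L2norm \<Omega> (\<phi> k - f)) \<longlonglongrightarrow> 0"
    "\<And>i. (\<lambda>k. L2norm \<Omega> (partial_deriv i (\<phi> k) - weak_partial_real \<Omega> i f)) \<longlonglongrightarrow> 0"
    by (rule H10_real_approx_seq[OF \<open>open \<Omega>\<close> f]) blast
  obtain \<psi> where \<psi>: "\<And>k. \<psi> k \<in> test_functions \<Omega>" "(\<lambda>k. L2norm \<Omega> (\<psi> k - g)) \<longlonglongrightarrow> 0"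
    "\<And>i. (\<lambda>k. L2norm \<Omega> (partial_deriv i (\<psi> k) - weak_partial_real \<Omega> i g)) \<longlonglongrightarrow> 0"
    by (rule H10_real_approx_seq[OF \<open>open \<Omega>\<close> g]) blast
  have L: "\<phi> k \<in> L2_real \<Omega>" "partial_deriv i (\<phi> k) \<in> L2_real \<Omega>" "\<psi> k \<in> L2_real \<Omega>" "partial_deriv i (\<psi> k) \<in> L2_real \<Omega>" for k i
    using \<phi> \<psi> \<open>open \<Omega>\<close> by (simp_all add: test_function_L2 test_function_partial)
  have fg: "f \<in> L2_real \<Omega>" "g \<in> L2_real \<Omega>" "weak_partial_real \<Omega> i f \<in> L2_real \<Omega>" "weak_partial_real \<Omega> i g \<in> L2_real \<Omega>" for i
    using H10_real_H1[OF f] H10_real_H1[OF g] by (simp_all add: H1_real_L2 weak_partial_real(1))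
  have comb: "(\<lambda>k. L2norm \<Omega> ((\<lambda>x. a * u k x + b * v k x) - (\<lambda>x. a * p x + b * q x))) \<longlonglongrightarrow> 0"
    if uL: "\<And>k. u k \<in> L2_real \<Omega>" and vL: "\<And>k. v k \<in> L2_real \<Omega>" and pL: "p \<in> L2_real \<Omega>" and qL: "q \<in> L2_real \<Omega>"
      and u: "(\<lambda>k. L2norm \<Omega> (u k - p)) \<longlonglongrightarrow> 0" and v: "(\<lambda>k. L2norm \<Omega> (v k - q)) \<longlonglongrightarrow> 0" for u v p q
  proof (rule tendsto_sandwich[OF _ _ tendsto_const])
    note S = subspace_L2_real[of \<Omega>]
    have eq: "(\<lambda>x. a * u k x + b * v k x) - (\<lambda>x. a * p x + b * q x) = a *\<^sub>R (u k - p) + b *\<^sub>R (v k - q)" for k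
      by (auto simp: fun_eq_iff algebra_simps)
    have mem: "u k - p \<in> L2_real \<Omega>" "v k - q \<in> L2_real \<Omega>" for k
      using uL vL pL qL by (auto intro: subspace_diff[OF S])
    have mem': "a *\<^sub>R (u k - p) \<in> L2_real \<Omega>" "b *\<^sub>R (v k - q) \<in> L2_real \<Omega>" for k
      using mem by (auto intro: subspace_scale[OF S])
    show "\<forall>\<^sub>F k in sequentially. 0 \<le> L2norm \<Omega> ((\<lambda>x. a * u k x + b * v k x) - (\<lambda>x. a * p x + b * q x))"
      unfolding eq using subspace_add[OF S mem'] L2.snorm_nonneg unfolding L2_real_eq by (intro always_eventually) blast
    show "\<forall>\<^sub>F k in sequentially. L2norm \<Omega> ((\<lambda>x. a * u k x + b * v k x) - (\<lambda>x. a * p x + b * q x))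
        \<le> \<bar>a\<bar> * L2norm \<Omega> (u k - p) + \<bar>b\<bar> * L2norm \<Omega> (v k - q)"
      unfolding eq using L2norm_add_le[OF mem'] L2norm_scaleR[OF mem(1)] L2norm_scaleR[OF mem(2)]
      by (intro always_eventually) auto
    show "(\<lambda>k. \<bar>a\<bar> * L2norm \<Omega> (u k - p) + \<bar>b\<bar> * L2norm \<Omega> (v k - q)) \<longlonglongrightarrow> 0"
      using tendsto_add[OF tendsto_mult_left[OF u, of "\<bar>a\<bar>"] tendsto_mult_left[OF v, of "\<bar>b\<bar>"]] by simp
  qed
  have L2_comb: "(\<lambda>x. a * p x + b * q x) \<in> L2_real \<Omega>" if "p \<in> L2_real \<Omega>" "q \<in> L2_real \<Omega>" for p q
    using sq_integrable_add[OF sq_integrable_scaleR[of p _ a] sq_integrable_scaleR[of q _ b]] that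
    unfolding L2_real_eq by simp
  have deriv: "partial_deriv i (\<lambda>x. a * \<phi> k x + b * \<psi> k x) = (\<lambda>x. a * partial_deriv i (\<phi> k) x + b * partial_deriv i (\<psi> k) x)" for i k
    by (intro ext, subst frechet_derivative_at[symmetric, OF has_derivative_add[OF
          has_derivative_mult_right[OF test_functionD(3)[OF \<phi>(1)]] has_derivative_mult_right[OF test_functionD(3)[OF \<psi>(1)]]]]) simp
  have T: "(\<lambda>x. a * \<phi> k x + b * \<psi> k x) \<in> test_functions \<Omega>" for k
    by (intro test_function_add test_function_scale \<phi> \<psi>)
  note * = H10_real_limitI[OF \<open>open \<Omega>\<close>, of "\<lambda>k x. a * \<phi> k x + b * \<psi> k x" "\<lambda>x. a * f x + b * g x"
      "\<lambda>i x. a * weak_partial_real \<Omega> i f x + b * weak_partial_real \<Omega> i g x", unfolded deriv,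
      OF T L2_comb[OF fg(1,2)] L2_comb[OF fg(3,4)]
        comb[OF L(1,3) fg(1,2) \<phi>(2) \<psi>(2)] comb[OF L(2,4) fg(3,4) \<phi>(3) \<psi>(3)]]
  show "(\<lambda>x. a * f x + b * g x) \<in> H10_real \<Omega>" by (rule *(1))
  show "AE x in lebesgue_on \<Omega>. weak_partial_real \<Omega> i (\<lambda>x. a * f x + b * g x) x =
        a * weak_partial_real \<Omega> i f x + b * weak_partial_real \<Omega> i g x" by (rule *(2))
qed

text \<open>The space is closed under limits in the Sobolev norm: replace the k-th function by a test function
  at distance less than \<open>1 / (k + 1)\<close>.\<close>

lemma H10_real_closed:
  assumes "open \<Omega>" and f: "\<And>k. f k \<in> H10_real \<Omega>" and F: "F \<in> L2_real \<Omega>" and G: "\<And>i. G i \<in> L2_real \<Omega>"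
    and lim: "(\<lambda>k. L2norm \<Omega> (f k - F)) \<longlonglongrightarrow> 0" "\<And>i. (\<lambda>k. L2norm \<Omega> (weak_partial_real \<Omega> i (f k) - G i)) \<longlonglongrightarrow> 0"
  shows "F \<in> H10_real \<Omega>" "AE x in lebesgue_on \<Omega>. weak_partial_real \<Omega> i F x = G i x"
proof -
  have "\<exists>\<phi>\<in>test_functions \<Omega>. L2norm \<Omega> (f k - \<phi>) < 1 / real (Suc k) \<and>
      (\<forall>i. L2norm \<Omega> (weak_partial_real \<Omega> i (f k) - partial_deriv i \<phi>) < 1 / real (Suc k))" for k
    using H10_real_approx[OF \<open>open \<Omega>\<close> f, of "1 / real (Suc k)" k] by auto
  then obtain \<phi> where \<phi>: "\<And>k. \<phi> k \<in> test_functions \<Omega>" and a: "\<And>k. L2norm \<Omega> (f k - \<phi> k) < 1 / real (Suc k)"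
    and b: "\<And>k i. L2norm \<Omega> (weak_partial_real \<Omega> i (f k) - partial_deriv i (\<phi> k)) < 1 / real (Suc k)"
    by metis
  have L: "\<phi> k \<in> L2_real \<Omega>" "partial_deriv i (\<phi> k) \<in> L2_real \<Omega>" for k i
    using \<phi> \<open>open \<Omega>\<close> by (simp_all add: test_function_L2 test_function_partial)
  have fL: "f k \<in> L2_real \<Omega>" "weak_partial_real \<Omega> i (f k) \<in> L2_real \<Omega>" for k i
    using H10_real_H1[OF f[of k]] by (simp_all add: H1_real_L2 weak_partial_real(1))
  have near: "(\<lambda>k. L2norm \<Omega> (p k - q)) \<longlonglongrightarrow> 0"
    if p: "\<And>k. p k \<in> L2_real \<Omega>" and u: "\<And>k. u k \<in> L2_real \<Omega>" and q: "q \<in> L2_real \<Omega>"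
      and near: "\<And>k. L2norm \<Omega> (u k - p k) < 1 / real (Suc k)" and lim: "(\<lambda>k. L2norm \<Omega> (u k - q)) \<longlonglongrightarrow> 0" for p u q
  proof (rule tendsto_sandwich[OF _ _ tendsto_const])
    show "\<forall>\<^sub>F k in sequentially. 0 \<le> L2norm \<Omega> (p k - q)"
      using p q unfolding L2_real_eq by (intro always_eventually allI L2.snorm_nonneg L2.V_diff)
    have "L2norm \<Omega> (p k - q) \<le> L2norm \<Omega> (u k - q) + 1 / real (Suc k)" for k
    proof -
      have "L2norm \<Omega> ((u k - q) - (u k - p k)) \<le> L2norm \<Omega> (u k - q) + L2norm \<Omega> (u k - p k)"
        using p q u unfolding L2_real_eq by (intro L2.snorm_diff_le L2.V_diff)
      then show ?thesis using near[of k] by simp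
    qed
    then show "\<forall>\<^sub>F k in sequentially. L2norm \<Omega> (p k - q) \<le> L2norm \<Omega> (u k - q) + 1 / real (Suc k)"
      by simp
    show "(\<lambda>k. L2norm \<Omega> (u k - q) + 1 / real (Suc k)) \<longlonglongrightarrow> 0"
      using tendsto_add[OF lim LIMSEQ_Suc[OF lim_1_over_n]] by simp
  qed
  note * = H10_real_limitI[OF \<open>open \<Omega>\<close> \<phi> F G near[OF L(1) fL(1) F a lim(1)] near[OF L(2) fL(2) G b lim(2)]]
  show "F \<in> H10_real \<Omega>" by (rule *(1))
  show "AE x in lebesgue_on \<Omega>. weak_partial_real \<Omega> i F x = G i x" by (rule *(2))
qed

section \<open>Clifford multiplication and the Euclidean inner product\<close>

lemma linear_clif_mult_right: "linear (\<lambda>y. x \<odot> y)"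
  and linear_clif_mult_left: "linear (\<lambda>x. x \<odot> y)"
  using clif_mult_bilinear by (auto simp: bilinear_def)

lemmas clif_mult_linear =
  linear_add[OF linear_clif_mult_right] linear_add[OF linear_clif_mult_left]
  linear_diff[OF linear_clif_mult_right] linear_diff[OF linear_clif_mult_left]
  linear_neg[OF linear_clif_mult_right] linear_neg[OF linear_clif_mult_left]
  clif_mult_scaleR clif_mult_sum

lemma clif_sign_square: "clif_sign A B * clif_sign A B = 1"
  unfolding clif_sign_def prod.distrib[symmetric] by (intro prod.neutral ballI) simp

lemma clif_axis_square: "axis A 1 \<odot> axis A 1 = clif_sign A A *\<^sub>R clif_one"
  by (simp add: clif_mult_axis clif_one_def)

lemma clif_prod_list_append: "clif_prod_list (xs @ ys) = clif_prod_list xs \<odot> clif_prod_list ys"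
  by (induction xs) (simp_all add: clif_prod_list_def clif_mult_one clif_mult_assoc)

lemma clif_prod_list_rev_minus:
  "clif_prod_list (map (\<lambda>i. - clif_gen i) (rev xs)) \<odot> clif_prod_list (map clif_gen xs) = clif_one"
proof (induction xs)
  case Nil
  then show ?case by (simp add: clif_prod_list_def clif_mult_one)
next
  case (Cons i xs)
  let ?P = "clif_prod_list (map (\<lambda>i. - clif_gen i) (rev xs))" and ?Q = "clif_prod_list (map clif_gen xs)"
  have "clif_prod_list (map (\<lambda>i. - clif_gen i) (rev (i # xs))) \<odot> clif_prod_list (map clif_gen (i # xs))
      = ?P \<odot> ((- clif_gen i \<odot> clif_gen i) \<odot> ?Q)"
    by (simp add: clif_prod_list_append clif_mult_assoc)
      (simp add: clif_prod_list_def clif_mult_one)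
  also have "- clif_gen i \<odot> clif_gen i = clif_one"
    by (simp add: clif_mult_linear clif_gen_square)
  finally show ?case by (simp add: clif_mult_one Cons)
qed

text \<open>The conjugate of a basis element is its inverse; since its square is a sign, this is the element
  itself up to that sign.\<close>

lemma clif_conj_eq: "clif_conj x = (\<Sum>A\<in>UNIV. (x $ A * clif_sign A A) *\<^sub>R axis A 1)"
proof -
  have "clif_prod_list (map (\<lambda>i. - clif_gen i) (rev (sorted_list_of_set A))) = clif_sign A A *\<^sub>R axis A 1"
    (is "?c = _") for A :: "'a set"
  proof -
    have "?c \<odot> axis A 1 = clif_one"
      using clif_prod_list_rev_minus[of "sorted_list_of_set A"] by (simp add: clif_basis_eq_prod)
    then have "(?c \<odot> axis A 1) \<odot> axis A 1 = axis A 1" by (simp add: clif_mult_one)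
    then have "clif_sign A A *\<^sub>R ?c = axis A 1"
      by (simp add: clif_mult_assoc clif_axis_square clif_mult_scaleR clif_mult_one)
    then have "clif_sign A A *\<^sub>R axis A 1 = (clif_sign A A * clif_sign A A) *\<^sub>R ?c"
      by (metis scaleR_scaleR)
    then show ?thesis by (simp add: clif_sign_square)
  qed
  then show ?thesis by (simp add: clif_conj_def)
qed

lemma Sc_axis_mult: "Sc (axis A 1 \<odot> axis B 1) = (if A = B then clif_sign A A else 0)"
  unfolding Sc_def clif_mult_axis by (auto simp: axis_def)

lemma Sc_linear [simp]:
  "Sc (x + y) = Sc x + Sc y" "Sc (c *\<^sub>R x) = c * Sc x" "Sc (\<Sum>i\<in>I. f i) = (\<Sum>i\<in>I. Sc (f i))"
  by (simp_all add: Sc_def)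

text \<open>The scalar part of the Clifford pairing is the Euclidean inner product of the coefficients.\<close>

lemma Sc_conj_mult: "Sc (clif_conj x \<odot> y) = x \<bullet> y"
proof -
  have "clif_conj x \<odot> y = clif_conj x \<odot> (\<Sum>B\<in>UNIV. y $ B *\<^sub>R axis B 1)"
    using clif_expand[of y] by simp
  then have "Sc (clif_conj x \<odot> y) = (\<Sum>A\<in>UNIV. \<Sum>B\<in>UNIV. if A = B then x $ A * y $ B * (clif_sign A A * clif_sign A A) else 0)"
    by (simp add: clif_conj_eq clif_mult_linear Sc_axis_mult sum_distrib_left mult_ac if_distrib cong: if_cong)
  also have "\<dots> = x \<bullet> y" by (simp add: clif_sign_square inner_vec_def)
  finally show ?thesis .
qed

text \<open>Every coefficient is a scalar part after right multiplication, up to sign.\<close>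

lemma clif_component: "z $ A = clif_sign A A * Sc (z \<odot> axis A 1)"
proof -
  have "Sc (z \<odot> axis A 1) = Sc ((\<Sum>B\<in>UNIV. z $ B *\<^sub>R axis B 1) \<odot> axis A 1)"
    using clif_expand[of z] by simp
  also have "\<dots> = z $ A * clif_sign A A" 
    by (simp add: clif_mult_linear Sc_axis_mult if_distrib cong: if_cong)
  finally show ?thesis by (simp add: mult.left_commute clif_sign_square)
qed

lemma clif_conj_mult_component: "(clif_conj x \<odot> y) $ A = clif_sign A A * (x \<bullet> (y \<odot> axis A 1))"
  by (simp add: clif_component[of "clif_conj x \<odot> y"] clif_mult_assoc Sc_conj_mult)

text \<open>Left multiplication by a generator is skew-adjoint; as its square is -1, it is an isometry.\<close>

lemma clif_gen_adjoint: "(clif_gen i \<odot> x) \<bullet> y = - (x \<bullet> (clif_gen i \<odot> y))"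
proof -
  have "(\<lambda>x y. (clif_gen i \<odot> x) \<bullet> y) = (\<lambda>x y. - (x \<bullet> (clif_gen i \<odot> y)))"
  proof (rule bilinear_eq_stdbasis)
    show "bilinear (\<lambda>x y. (clif_gen i \<odot> x) \<bullet> y)" "bilinear (\<lambda>x y. - (x \<bullet> (clif_gen i \<odot> y)))"
      unfolding bilinear_def by (auto intro!: linearI simp: clif_mult_linear inner_simps)
    fix a b :: "'a clifford" assume "a \<in> Basis" "b \<in> Basis"
    then obtain A B where ab: "a = axis A 1" "b = axis B 1" by (auto simp: Basis_vec_def)
    have inv: "sym_diff {i} A = B \<longleftrightarrow> A = sym_diff {i} B" by auto
    have "clif_sign {i} (sym_diff {i} A) = - clif_sign {i} A"
      unfolding clif_sign_sym_diff_right by (simp add: clif_sign_def)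
    then show "(clif_gen i \<odot> a) \<bullet> b = - (a \<bullet> (clif_gen i \<odot> b))"
      using inv by (auto simp: ab clif_gen_def clif_mult_axis inner_axis_axis)
  qed
  then show ?thesis by metis
qed

lemma norm_clif_gen_mult: "norm (clif_gen i \<odot> x) = norm x"
proof -
  have "(clif_gen i \<odot> x) \<bullet> (clif_gen i \<odot> x) = x \<bullet> x"
    by (simp add: clif_gen_adjoint clif_mult_assoc[symmetric] clif_gen_square clif_mult_linear clif_mult_one)
  then show ?thesis by (simp add: norm_eq_sqrt_inner)
qed

lemma norm_clif_gen_minus_scalar_mult:
  "norm ((clif_gen i - c *\<^sub>R clif_one) \<odot> x) = sqrt (1 + c\<^sup>2) * norm x"
proof -
  have "x \<bullet> (clif_gen i \<odot> x) = 0" "(clif_gen i \<odot> x) \<bullet> x = 0"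
    using clif_gen_adjoint[of i x x] by (simp_all add: inner_commute)
  moreover have "(clif_gen i \<odot> x) \<bullet> (clif_gen i \<odot> x) = x \<bullet> x"
    using norm_clif_gen_mult[of i x] by (simp add: norm_eq_sqrt_inner)
  ultimately have "((clif_gen i - c *\<^sub>R clif_one) \<odot> x) \<bullet> ((clif_gen i - c *\<^sub>R clif_one) \<odot> x) = (1 + c\<^sup>2) * (x \<bullet> x)"
    by (simp add: clif_mult_linear clif_mult_one inner_simps power2_eq_square algebra_simps)
  then show ?thesis by (simp add: norm_eq_sqrt_inner real_sqrt_mult)
qed

section \<open>Clifford-valued functions\<close>

lemma sq_integrable_sum:
  assumes "\<And>i. i \<in> I \<Longrightarrow> F i \<in> sq_integrable M"
  shows "(\<lambda>x. \<Sum>i\<in>I. F i x) \<in> sq_integrable M"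
  using assms
proof (induction I rule: infinite_finite_induct)
  case (insert i I)
  then show ?case using sq_integrable_add[of "F i" M "\<lambda>x. \<Sum>i\<in>I. F i x"] by simp
qed (simp_all add: sq_integrable_def)

lemma sq_integrable_scale_bounded:
  assumes "F \<in> sq_integrable M" "c \<in> borel_measurable M" "\<And>x. x \<in> space M \<Longrightarrow> \<bar>c x\<bar> \<le> C"
  shows "(\<lambda>x. c x *\<^sub>R F x) \<in> sq_integrable M"
proof (rule sq_integrable_bound[OF assms(1)])
  show "(\<lambda>x. c x *\<^sub>R F x) \<in> borel_measurable M"
    by (intro borel_measurable_scaleR assms(2) sq_integrable_measurable[OF assms(1)])
  show "norm (c x *\<^sub>R F x) \<le> C * norm (F x)" if "x \<in> space M" for x
    using assms(3)[OF that] by (simp add: mult_right_mono)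
qed

lemma snorm_le_mult:
  assumes "F \<in> sq_integrable M" "G \<in> sq_integrable M" "0 \<le> C"
    and "\<And>x. x \<in> space M \<Longrightarrow> norm (G x) \<le> C * norm (F x)"
  shows "L2.snorm M G \<le> C * L2.snorm M F"
proof (rule power2_le_imp_le)
  have "(L2.snorm M G)\<^sup>2 = (LINT x|M. (norm (G x))\<^sup>2)"
    using assms(2) by (simp add: L2.snorm_sq l2_inner_def power2_norm_eq_inner)
  also have "\<dots> \<le> (LINT x|M. C\<^sup>2 * (norm (F x))\<^sup>2)"
    using assms power_mono[OF assms(4)] by (intro integral_mono)
      (auto simp: power_mult_distrib sq_integrable_integrable)
  also have "\<dots> = (C * L2.snorm M F)\<^sup>2"
    using assms(1) by (simp add: L2.snorm_sq l2_inner_def power2_norm_eq_inner power_mult_distrib)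
  finally show "(L2.snorm M G)\<^sup>2 \<le> (C * L2.snorm M F)\<^sup>2" .
qed (use assms in \<open>simp add: L2.snorm_nonneg\<close>)

lemma L2_eq: "L2 \<Omega> = sq_integrable (lebesgue_on \<Omega>)"
proof (intro set_eqI iffI)
  fix F assume F: "F \<in> L2 \<Omega>"
  have "(\<lambda>x. \<Sum>A\<in>UNIV. F x $ A *\<^sub>R axis A (1::real)) \<in> sq_integrable (lebesgue_on \<Omega>)"
  proof (rule sq_integrable_sum)
    fix A :: "'a set"
    have "(\<lambda>x. F x $ A) \<in> sq_integrable (lebesgue_on \<Omega>)" using F by (simp add: L2_def L2_real_eq)
    then show "(\<lambda>x. F x $ A *\<^sub>R axis A (1::real)) \<in> sq_integrable (lebesgue_on \<Omega>)"
      by (rule sq_integrable_linear) (rule bounded_linear_scaleR_left)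
  qed
  moreover have "(\<lambda>x. \<Sum>A\<in>UNIV. F x $ A *\<^sub>R axis A (1::real)) = F"
    by (rule ext) (rule clif_expand[symmetric])
  ultimately show "F \<in> sq_integrable (lebesgue_on \<Omega>)" by (simp only:)
next
  fix F :: "'a cfun" assume F: "F \<in> sq_integrable (lebesgue_on \<Omega>)"
  then show "F \<in> L2 \<Omega>"
    using sq_integrable_linear[OF F bounded_linear_vec_nth] by (simp add: L2_def L2_real_eq)
qed

lemma bounded_linear_clif_mult: "bounded_linear (\<lambda>y. x \<odot> y)" "bounded_linear (\<lambda>x. x \<odot> y)"
  by (simp_all add: linear_conv_bounded_linear[symmetric] linear_clif_mult_right linear_clif_mult_left)

lemma inner2_component:
  assumes F: "F \<in> sq_integrable (lebesgue_on \<Omega>)" and G: "G \<in> sq_integrable (lebesgue_on \<Omega>)"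
  shows "inner2 \<Omega> F G $ A = clif_sign A A * l2_inner (lebesgue_on \<Omega>) F (\<lambda>x. G x \<odot> axis A 1)"
proof -
  have int: "integrable (lebesgue_on \<Omega>) (\<lambda>x. F x \<bullet> (G x \<odot> axis A 1))" for A
    by (intro sq_integrable_inner F sq_integrable_linear[OF G] bounded_linear_clif_mult)
  have "clif_conj (F x) \<odot> G x = (\<Sum>A\<in>UNIV. (clif_sign A A * (F x \<bullet> (G x \<odot> axis A 1))) *\<^sub>R axis A 1)" for x
    by (subst clif_expand) (simp add: clif_conj_mult_component)
  then have "integrable (lebesgue_on \<Omega>) (\<lambda>x. clif_conj (F x) \<odot> G x)"
    using int by simp
  then show ?thesis
    unfolding inner2_def l2_inner_def
    by (subst integral_bounded_linear[OF bounded_linear_vec_nth, symmetric])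
      (simp_all add: clif_conj_mult_component)
qed

text \<open>The scalar part is the coefficient at the empty set, where the sign is 1 and the basis element is
  the unit.\<close>

lemma norm2_eq_snorm: "F \<in> sq_integrable (lebesgue_on \<Omega>) \<Longrightarrow> norm2 \<Omega> F = L2.snorm (lebesgue_on \<Omega>) F"
  by (simp add: norm2_def Sc_def inner2_component L2.snorm_def)
    (simp add: clif_sign_def clif_one_def[symmetric] clif_mult_one)

lemma H10_real_sum:
  assumes "open \<Omega>" "finite I" "\<And>j. j \<in> I \<Longrightarrow> f j \<in> H10_real \<Omega>"
  shows "(\<lambda>x. \<Sum>j\<in>I. c j * f j x) \<in> H10_real \<Omega> \<and> (AE x in lebesgue_on \<Omega>.
    weak_partial_real \<Omega> i (\<lambda>x. \<Sum>j\<in>I. c j * f j x) x = (\<Sum>j\<in>I. c j * weak_partial_real \<Omega> i (f j) x))"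
  using assms(2,3)
proof (induction I rule: finite_induct)
  case empty
  have T: "(\<lambda>_. 0) \<in> test_functions \<Omega>"
    by (rule test_functionI[where K="{}"]) (auto intro: Ck_on_const)
  have "partial_deriv i (\<lambda>_. 0) = (\<lambda>_. 0)" for i :: 'a
    by (simp add: fun_eq_iff frechet_derivative_const)
  then show ?case
    using H10_real_limitI[OF \<open>open \<Omega>\<close>, of "\<lambda>_ _. 0" "\<lambda>_. 0" "\<lambda>_ _. 0"] T test_function_L2[OF T \<open>open \<Omega>\<close>]
    by (simp add: L2.snorm_def l2_inner_def)
next
  case (insert j I)
  let ?g = "\<lambda>x. \<Sum>j\<in>I. c j * f j x"
  have g: "?g \<in> H10_real \<Omega>"
    "AE x in lebesgue_on \<Omega>. weak_partial_real \<Omega> i ?g x = (\<Sum>j\<in>I. c j * weak_partial_real \<Omega> i (f j) x)"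
    using insert by auto
  have "(\<lambda>x. c j * f j x + 1 * ?g x) \<in> H10_real \<Omega>"
    and 1: "AE x in lebesgue_on \<Omega>. weak_partial_real \<Omega> i (\<lambda>x. c j * f j x + 1 * ?g x) x
      = c j * weak_partial_real \<Omega> i (f j) x + 1 * weak_partial_real \<Omega> i ?g x"
    using H10_real_lincomb[OF \<open>open \<Omega>\<close> _ g(1), of "f j", where a="c j" and b=1] insert.prems by auto
  moreover have "AE x in lebesgue_on \<Omega>. weak_partial_real \<Omega> i (\<lambda>x. c j * f j x + 1 * ?g x) x
      = c j * weak_partial_real \<Omega> i (f j) x + (\<Sum>j\<in>I. c j * weak_partial_real \<Omega> i (f j) x)"
    using 1 g(2) by eventually_elim simp
  ultimately show ?case using insert.hyps by simp
qed

lemma weak_partial_AE_I: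
  assumes "\<And>A. AE x in M. weak_partial_real \<Omega> i (\<lambda>z. F z $ A) x = G x $ A"
  shows "AE x in M. weak_partial \<Omega> i F x = G x"
proof -
  have "AE x in M. \<forall>A. weak_partial_real \<Omega> i (\<lambda>z. F z $ A) x = G x $ A"
    by (rule eventually_all_finite[OF assms])
  then show ?thesis by eventually_elim (simp add: weak_partial_def vec_eq_iff)
qed

lemma
  assumes "open \<Omega>" and F: "F \<in> H10 \<Omega>" and G: "G \<in> H10 \<Omega>"
  shows H10_lincomb: "(\<lambda>x. a *\<^sub>R F x + b *\<^sub>R G x) \<in> H10 \<Omega>"
    and weak_partial_lincomb: "AE x in lebesgue_on \<Omega>. weak_partial \<Omega> i (\<lambda>x. a *\<^sub>R F x + b *\<^sub>R G x) x =
        a *\<^sub>R weak_partial \<Omega> i F x + b *\<^sub>R weak_partial \<Omega> i G x"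
proof -
  have *: "(\<lambda>x. F x $ A) \<in> H10_real \<Omega>" "(\<lambda>x. G x $ A) \<in> H10_real \<Omega>" for A
    using F G by (auto simp: H10_def)
  show "(\<lambda>x. a *\<^sub>R F x + b *\<^sub>R G x) \<in> H10 \<Omega>"
    using H10_real_lincomb(1)[OF \<open>open \<Omega>\<close> *] by (simp add: H10_def)
  show "AE x in lebesgue_on \<Omega>. weak_partial \<Omega> i (\<lambda>x. a *\<^sub>R F x + b *\<^sub>R G x) x =
        a *\<^sub>R weak_partial \<Omega> i F x + b *\<^sub>R weak_partial \<Omega> i G x"
    using H10_real_lincomb(2)[OF \<open>open \<Omega>\<close> *] by (intro weak_partial_AE_I) (simp add: weak_partial_def)
qed

text \<open>Weak differentiation commutes with real-linear maps of the values, because the coefficients of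
  the image are fixed linear combinations of the coefficients.\<close>

lemma
  fixes T :: "'n::{finite,linorder} clifford \<Rightarrow> 'n clifford"
  assumes "open \<Omega>" and F: "F \<in> H10 \<Omega>" and T: "linear T"
  shows H10_linear: "(\<lambda>x. T (F x)) \<in> H10 \<Omega>"
    and weak_partial_linear: "AE x in lebesgue_on \<Omega>. weak_partial \<Omega> i (\<lambda>x. T (F x)) x = T (weak_partial \<Omega> i F x)"
proof -
  have *: "(\<lambda>x. F x $ A) \<in> H10_real \<Omega>" for A using F by (auto simp: H10_def)
  have T_comp: "T v $ B = (\<Sum>A\<in>UNIV. T (axis A 1) $ B * v $ A)" for v B
  proof -
    have "T v = T (\<Sum>A\<in>UNIV. v $ A *\<^sub>R axis A 1)" using clif_expand[of v] by simp
    then show ?thesis by (simp add: linear_sum[OF T] linear_cmul[OF T] mult.commute)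
  qed
  have both: "(\<lambda>x. \<Sum>A\<in>UNIV. c A * F x $ A) \<in> H10_real \<Omega> \<and> (AE x in lebesgue_on \<Omega>.
      weak_partial_real \<Omega> i (\<lambda>x. \<Sum>A\<in>UNIV. c A * F x $ A) x =
      (\<Sum>A\<in>UNIV. c A * weak_partial_real \<Omega> i (\<lambda>x. F x $ A) x))" for c
    by (rule H10_real_sum[OF \<open>open \<Omega>\<close> finite]) (rule *)
  have comp_eq: "(\<lambda>x. T (F x) $ B) = (\<lambda>x. \<Sum>A\<in>UNIV. T (axis A 1) $ B * F x $ A)" for B
    by (rule ext) (rule T_comp)
  show "(\<lambda>x. T (F x)) \<in> H10 \<Omega>"
    unfolding H10_def mem_Collect_eq comp_eq by (intro allI both[THEN conjunct1])
  show "AE x in lebesgue_on \<Omega>. weak_partial \<Omega> i (\<lambda>x. T (F x)) x = T (weak_partial \<Omega> i F x)"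
  proof (rule weak_partial_AE_I)
    fix B
    show "AE x in lebesgue_on \<Omega>. weak_partial_real \<Omega> i (\<lambda>z. T (F z) $ B) x = T (weak_partial \<Omega> i F x) $ B"
      unfolding comp_eq T_comp[of "weak_partial \<Omega> i F _"] using both by (simp add: weak_partial_def)
  qed
qed

lemma H10_L2:
  assumes "F \<in> H10 \<Omega>"
  shows "F \<in> sq_integrable (lebesgue_on \<Omega>)" "weak_partial \<Omega> i F \<in> sq_integrable (lebesgue_on \<Omega>)"
proof -
  have *: "(\<lambda>x. F x $ A) \<in> H1_real \<Omega>" for A using assms by (auto simp: H10_def H10_real_H1)
  show "F \<in> sq_integrable (lebesgue_on \<Omega>)" "weak_partial \<Omega> i F \<in> sq_integrable (lebesgue_on \<Omega>)"
    unfolding L2_eq[symmetric] using H1_real_L2[OF *] weak_partial_real(1)[OF *]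
    by (simp_all add: L2_def weak_partial_def)
qed

section \<open>The Sobolev space as a complete semi-inner product space\<close>

text \<open>A function together with its weak gradient, as a function with values in a Euclidean space;
  the Sobolev inner product of functions is the inner product of their jets.\<close>

type_synonym 'n jet = "'n clifford \<times> ('n clifford, 'n) vec"

definition jet :: "(real ^ 'n::{finite,linorder}) set \<Rightarrow> 'n cfun \<Rightarrow> (real, 'n) vec \<Rightarrow> 'n jet" where
  "jet \<Omega> F x = (F x, \<chi> i. weak_partial \<Omega> i F x)"

lemma bounded_linear_jet_fst: "bounded_linear (\<lambda>u. (u, 0) :: 'n::{finite,linorder} jet)"
  and bounded_linear_jet_axis: "bounded_linear (\<lambda>u. (0, axis i u) :: 'n::{finite,linorder} jet)"
  unfolding linear_conv_bounded_linear[symmetric]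
  by (auto intro!: linearI simp: axis_def vec_eq_iff)

lemma sq_integrable_jetI:
  fixes F :: "'a \<Rightarrow> 'n::{finite,linorder} clifford"
  assumes "F \<in> sq_integrable M" "\<And>i. P i \<in> sq_integrable M"
  shows "(\<lambda>x. (F x, \<chi> i. P i x) :: 'n jet) \<in> sq_integrable M"
proof -
  have "(\<lambda>x. (F x, 0) + (\<Sum>i\<in>UNIV. (0, axis i (P i x))) :: 'n jet) \<in> sq_integrable M"
    by (intro sq_integrable_add sq_integrable_sum sq_integrable_linear[OF assms(1) bounded_linear_jet_fst]
        sq_integrable_linear[OF assms(2) bounded_linear_jet_axis])
  moreover have "(F x, 0) + (\<Sum>i\<in>UNIV. (0, axis i (P i x))) = ((F x, \<chi> i. P i x) :: 'n jet)" for x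
    by (simp add: prod_eq_iff fst_sum snd_sum vec_eq_iff axis_def if_distrib sum_component cong: if_cong)
  ultimately show ?thesis by simp
qed

lemma sq_integrable_jet: "F \<in> H10 \<Omega> \<Longrightarrow> jet \<Omega> F \<in> sq_integrable (lebesgue_on \<Omega>)"
  unfolding jet_def[abs_def] by (intro sq_integrable_jetI H10_L2)

lemma AE_all_partials:
  "(\<And>i::'n::finite. AE x in M. P i x) \<Longrightarrow> AE x in M. \<forall>i. P i x"
  by (rule eventually_all_finite)

lemma jet_lincomb:
  assumes "open \<Omega>" "F \<in> H10 \<Omega>" "G \<in> H10 \<Omega>"
  shows "AE x in lebesgue_on \<Omega>. jet \<Omega> (\<lambda>x. a *\<^sub>R F x + b *\<^sub>R G x) x = a *\<^sub>R jet \<Omega> F x + b *\<^sub>R jet \<Omega> G x"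
  using AE_all_partials[OF weak_partial_lincomb[OF assms]]
  by eventually_elim (simp add: jet_def vec_eq_iff)

lemma jet_linear:
  assumes "open \<Omega>" "F \<in> H10 \<Omega>" "linear T"
  shows "AE x in lebesgue_on \<Omega>. jet \<Omega> (\<lambda>x. T (F x)) x = (T (fst (jet \<Omega> F x)), \<chi> i. T (snd (jet \<Omega> F x) $ i))"
  using AE_all_partials[OF weak_partial_linear[OF assms]]
  by eventually_elim (simp add: jet_def vec_eq_iff)

lemma
  assumes "open \<Omega>" "F \<in> H10 \<Omega>" "G \<in> H10 \<Omega>"
  shows jet_add: "AE x in lebesgue_on \<Omega>. jet \<Omega> (F + G) x = jet \<Omega> F x + jet \<Omega> G x"
    and jet_diff: "AE x in lebesgue_on \<Omega>. jet \<Omega> (F - G) x = jet \<Omega> F x - jet \<Omega> G x"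
    and jet_scaleR: "AE x in lebesgue_on \<Omega>. jet \<Omega> (c *\<^sub>R F) x = c *\<^sub>R jet \<Omega> F x"
    and H10_add: "F + G \<in> H10 \<Omega>" and H10_diff: "F - G \<in> H10 \<Omega>" and H10_scaleR: "c *\<^sub>R F \<in> H10 \<Omega>"
proof -
  have eq: "F + G = (\<lambda>x. 1 *\<^sub>R F x + 1 *\<^sub>R G x)" "F - G = (\<lambda>x. 1 *\<^sub>R F x + (-1) *\<^sub>R G x)"
    "c *\<^sub>R F = (\<lambda>x. c *\<^sub>R F x + 0 *\<^sub>R G x)"
    by (auto simp: fun_eq_iff)
  show "F + G \<in> H10 \<Omega>" "F - G \<in> H10 \<Omega>" "c *\<^sub>R F \<in> H10 \<Omega>"
    unfolding eq by (intro H10_lincomb assms)+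
  show "AE x in lebesgue_on \<Omega>. jet \<Omega> (F + G) x = jet \<Omega> F x + jet \<Omega> G x"
    "AE x in lebesgue_on \<Omega>. jet \<Omega> (F - G) x = jet \<Omega> F x - jet \<Omega> G x"
    "AE x in lebesgue_on \<Omega>. jet \<Omega> (c *\<^sub>R F) x = c *\<^sub>R jet \<Omega> F x"
    unfolding eq using jet_lincomb[OF assms, of 1 1] jet_lincomb[OF assms, of 1 "-1"] jet_lincomb[OF assms, of c 0]
    by simp_all
qed

text \<open>The Sobolev inner product.\<close>

definition H1_inner :: "(real ^ 'n::{finite,linorder}) set \<Rightarrow> 'n cfun \<Rightarrow> 'n cfun \<Rightarrow> real" where
  "H1_inner \<Omega> F G = l2_inner (lebesgue_on \<Omega>) (jet \<Omega> F) (jet \<Omega> G)"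

lemma H10_zero:
  assumes "open \<Omega>"
  shows "(0 :: 'n::{finite,linorder} cfun) \<in> H10 \<Omega>"
  using H10_real_sum[OF assms finite.emptyI, of "\<lambda>_ _. 0"] by (simp add: H10_def)

lemma l2_inner_jet_left:
  assumes "open \<Omega>" and FG: "F \<in> H10 \<Omega>" "G \<in> H10 \<Omega>" and V: "V \<in> sq_integrable (lebesgue_on \<Omega>)"
  shows "l2_inner (lebesgue_on \<Omega>) (jet \<Omega> (F + G)) V = l2_inner (lebesgue_on \<Omega>) (jet \<Omega> F) V + l2_inner (lebesgue_on \<Omega>) (jet \<Omega> G) V"
    and "l2_inner (lebesgue_on \<Omega>) (jet \<Omega> (c *\<^sub>R F)) V = c * l2_inner (lebesgue_on \<Omega>) (jet \<Omega> F) V"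
proof -
  note J = sq_integrable_jet[OF FG(1)] sq_integrable_jet[OF FG(2)]
  have "l2_inner (lebesgue_on \<Omega>) (jet \<Omega> (F + G)) V = l2_inner (lebesgue_on \<Omega>) (jet \<Omega> F + jet \<Omega> G) V"
    using jet_add[OF assms(1) FG]
    by (intro l2_inner_cong_AE V sq_integrable_jet H10_add assms(1) FG L2.V_add) auto
  then show "l2_inner (lebesgue_on \<Omega>) (jet \<Omega> (F + G)) V = l2_inner (lebesgue_on \<Omega>) (jet \<Omega> F) V + l2_inner (lebesgue_on \<Omega>) (jet \<Omega> G) V"
    using J V by (simp add: L2.ip_add_left)
  have "l2_inner (lebesgue_on \<Omega>) (jet \<Omega> (c *\<^sub>R F)) V = l2_inner (lebesgue_on \<Omega>) (c *\<^sub>R jet \<Omega> F) V"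
    using jet_scaleR[OF assms(1) FG]
    by (intro l2_inner_cong_AE V sq_integrable_jet H10_scaleR[OF assms(1) FG] FG L2.V_scaleR) auto
  then show "l2_inner (lebesgue_on \<Omega>) (jet \<Omega> (c *\<^sub>R F)) V = c * l2_inner (lebesgue_on \<Omega>) (jet \<Omega> F) V"
    using J V by (simp add: L2.ip_scaleR_left)
qed

lemma semi_inner_space_H10:
  assumes "open \<Omega>"
  shows "semi_inner_space (H10 \<Omega>) (H1_inner \<Omega>)"
proof
  show "subspace (H10 \<Omega>)"
    by (rule subspaceI) (auto intro: H10_zero H10_add H10_scaleR assms)
qed (use assms in \<open>auto simp: H1_inner_def l2_inner_jet_left sq_integrable_jet L2.ip_nonneg intro: L2.ip_commute\<close>)

text \<open>The jets of a Cauchy sequence converge in the mean, and the coefficients of the limit are the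
  limits of the coefficients and of their weak derivatives; so the limit is again a jet.\<close>

lemma semi_hilbert_space_H10:
  fixes \<Omega> :: "(real ^ 'n::{finite,linorder}) set"
  assumes "open \<Omega>"
  shows "semi_hilbert_space (H10 \<Omega>) (H1_inner \<Omega>)"
proof -
  let ?M = "lebesgue_on \<Omega>"
  interpret H: semi_inner_space "H10 \<Omega>" "H1_inner \<Omega>" by (rule semi_inner_space_H10[OF assms])
  have snorm_eq: "H.snorm F = L2.snorm ?M (jet \<Omega> F)" for F
    by (simp add: H.snorm_def L2.snorm_def H1_inner_def)
  show ?thesis
  proof
    fix F :: "nat \<Rightarrow> 'n cfun"
    assume F: "\<And>n. F n \<in> H10 \<Omega>" and Cauchy: "\<And>e. e > 0 \<Longrightarrow> \<exists>N. \<forall>i\<ge>N. \<forall>j\<ge>N. H.snorm (F i - F j) < e"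
    have J: "jet \<Omega> (F k) \<in> sq_integrable ?M" for k by (rule sq_integrable_jet[OF F])
    have "H.snorm (F i - F j) = L2.snorm ?M (jet \<Omega> (F i) - jet \<Omega> (F j))" for i j
      unfolding snorm_eq using jet_diff[OF assms F F]
      by (intro snorm_cong_AE sq_integrable_jet H10_diff[OF assms] F L2.V_diff) auto
    then obtain U where U: "U \<in> sq_integrable ?M" and lim: "(\<lambda>n. L2.snorm ?M (jet \<Omega> (F n) - U)) \<longlonglongrightarrow> 0"
      using semi_hilbert_space.complete[OF semi_hilbert_space_sq_integrable, of "\<lambda>k. jet \<Omega> (F k)" ?M] J Cauchy
      by (metis (no_types, lifting))
    have JU: "jet \<Omega> (F n) - U \<in> sq_integrable ?M" for n by (intro L2.V_diff J U)
    have component: "(\<lambda>x. T (U x)) \<in> L2_real \<Omega>"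
      "(\<lambda>n. L2norm \<Omega> ((\<lambda>x. T (jet \<Omega> (F n) x)) - (\<lambda>x. T (U x)))) \<longlonglongrightarrow> 0"
      if T: "linear T" and T1: "\<And>u. norm (T u) \<le> norm u" for T :: "'n jet \<Rightarrow> real"
    proof -
      have bl: "bounded_linear T" using T by (simp add: linear_conv_bounded_linear)
      show "(\<lambda>x. T (U x)) \<in> L2_real \<Omega>" unfolding L2_real_eq by (rule sq_integrable_linear[OF U bl])
      have d: "(\<lambda>x. T (jet \<Omega> (F n) x)) - (\<lambda>x. T (U x)) = (\<lambda>x. T ((jet \<Omega> (F n) - U) x))" for n
        by (simp add: fun_eq_iff linear_diff[OF T])
      have sq: "(\<lambda>x. T ((jet \<Omega> (F n) - U) x)) \<in> sq_integrable ?M" for n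
        by (rule sq_integrable_linear[OF JU bl])
      show "(\<lambda>n. L2norm \<Omega> ((\<lambda>x. T (jet \<Omega> (F n) x)) - (\<lambda>x. T (U x)))) \<longlonglongrightarrow> 0"
        unfolding d
      proof (rule tendsto_sandwich[OF _ _ tendsto_const lim]; intro always_eventually allI)
        show "0 \<le> L2norm \<Omega> (\<lambda>x. T ((jet \<Omega> (F n) - U) x))" for n by (rule L2.snorm_nonneg[OF sq])
        show "L2norm \<Omega> (\<lambda>x. T ((jet \<Omega> (F n) - U) x)) \<le> L2.snorm ?M (jet \<Omega> (F n) - U)" for n
          using snorm_le_mult[OF JU sq, of 1] T1 by simp
      qed
    qed
    have lin: "linear (\<lambda>u. fst u $ A :: real)" "linear (\<lambda>u. snd u $ i $ A :: real)" for i :: 'n and A :: "'n set"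
      by (auto intro!: linearI)
    have le1: "norm (fst u $ A) \<le> norm u" "norm (snd u $ i $ A) \<le> norm u" for u :: "'n jet" and i A
      by (metis Finite_Cartesian_Product.norm_nth_le norm_fst_le order_trans prod.collapse)
        (metis Finite_Cartesian_Product.norm_nth_le norm_snd_le order_trans prod.collapse)
    define G where "G = (\<lambda>x. fst (U x))"
    have G: "(\<lambda>x. G x $ A) \<in> H10_real \<Omega>"
      "AE x in ?M. weak_partial_real \<Omega> i (\<lambda>x. G x $ A) x = snd (U x) $ i $ A" for i A
    proof -
      have "(\<lambda>x. F k x $ A) \<in> H10_real \<Omega>" for k using F by (auto simp: H10_def)
      moreover have "(\<lambda>x. G x $ A) \<in> L2_real \<Omega>" "(\<lambda>x. snd (U x) $ i $ A) \<in> L2_real \<Omega>" for i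
        unfolding G_def by (rule component(1)[OF lin(1) le1(1)], rule component(1)[OF lin(2) le1(2)])
      moreover have "(\<lambda>k. L2norm \<Omega> ((\<lambda>x. F k x $ A) - (\<lambda>x. G x $ A))) \<longlonglongrightarrow> 0"
        using component(2)[OF lin(1) le1(1), of A] by (simp add: G_def jet_def)
      moreover have "(\<lambda>k. L2norm \<Omega> (weak_partial_real \<Omega> i (\<lambda>x. F k x $ A) - (\<lambda>x. snd (U x) $ i $ A))) \<longlonglongrightarrow> 0" for i
        using component(2)[OF lin(2)[of i A] le1(2)] by (simp add: jet_def weak_partial_def)
      ultimately show "(\<lambda>x. G x $ A) \<in> H10_real \<Omega>"
        "AE x in ?M. weak_partial_real \<Omega> i (\<lambda>x. G x $ A) x = snd (U x) $ i $ A"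
        using H10_real_closed[OF assms, of "\<lambda>k x. F k x $ A" "\<lambda>x. G x $ A" "\<lambda>i x. snd (U x) $ i $ A"] by blast+
    qed
    then have GH: "G \<in> H10 \<Omega>" by (simp add: H10_def)
    have "AE x in ?M. \<forall>i. weak_partial \<Omega> i G x = snd (U x) $ i"
      by (intro AE_all_partials weak_partial_AE_I G)
    then have GU: "AE x in ?M. jet \<Omega> G x = U x"
      by eventually_elim (simp add: jet_def prod_eq_iff vec_eq_iff G_def)
    have "H.snorm (F n - G) = L2.snorm ?M (jet \<Omega> (F n) - U)" for n
      unfolding snorm_eq
    proof (rule snorm_cong_AE)
      show "AE x in ?M. jet \<Omega> (F n - G) x = (jet \<Omega> (F n) - U) x"
        using jet_diff[OF assms F GH] GU by eventually_elim simp
    qed (intro JU sq_integrable_jet H10_diff[OF assms] F GH)+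
    then have "(\<lambda>n. H.snorm (F n - G)) \<longlonglongrightarrow> 0" using lim by (simp only:)
    then show "\<exists>l\<in>H10 \<Omega>. (\<lambda>n. H.snorm (F n - l)) \<longlonglongrightarrow> 0"
      using GH by blast
  qed
qed

section \<open>Coercivity of the form\<close>

text \<open>The factor on the left is the smallest eigenvalue of the matrix of the quadratic form on the
  right; the estimate is the Cauchy--Schwarz inequality for the vectors \<open>(r - a, b)\<close> and
  \<open>(d\<^sup>2 - e\<^sup>2, 2 d e)\<close>, the second of which has norm \<open>d\<^sup>2 + e\<^sup>2\<close>.\<close>

lemma quadratic_form_ge_eigenvalue:
  fixes a b r d e :: real
  shows "(a + r - sqrt ((r - a)\<^sup>2 + b\<^sup>2)) / 2 * (d\<^sup>2 + e\<^sup>2) \<le> a * d\<^sup>2 - b * d * e + r * e\<^sup>2"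
proof -
  have "((r - a) * (d\<^sup>2 - e\<^sup>2) + b * (2 * d * e))\<^sup>2 \<le> ((r - a)\<^sup>2 + b\<^sup>2) * (d\<^sup>2 + e\<^sup>2)\<^sup>2"
  proof -
    have "((r - a)\<^sup>2 + b\<^sup>2) * (d\<^sup>2 + e\<^sup>2)\<^sup>2 - ((r - a) * (d\<^sup>2 - e\<^sup>2) + b * (2 * d * e))\<^sup>2
        = ((r - a) * (2 * d * e) - b * (d\<^sup>2 - e\<^sup>2))\<^sup>2"
      by (simp add: power2_eq_square algebra_simps)
    then show ?thesis by (smt (verit) zero_le_power2)
  qed
  then have "\<bar>(r - a) * (d\<^sup>2 - e\<^sup>2) + b * (2 * d * e)\<bar> \<le> sqrt (((r - a)\<^sup>2 + b\<^sup>2) * (d\<^sup>2 + e\<^sup>2)\<^sup>2)"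
    by (metis real_sqrt_abs real_sqrt_le_mono)
  also have "\<dots> = sqrt ((r - a)\<^sup>2 + b\<^sup>2) * (d\<^sup>2 + e\<^sup>2)"
    by (simp add: real_sqrt_mult)
  finally have "(r - a) * (d\<^sup>2 - e\<^sup>2) + b * (2 * d * e) \<le> sqrt ((r - a)\<^sup>2 + b\<^sup>2) * (d\<^sup>2 + e\<^sup>2)"
    by simp
  then show ?thesis by (simp add: field_simps)
qed

text \<open>The left factor of the Dirac operator in the form.\<close>

definition q_factor :: "'n::{finite,linorder} clifford \<Rightarrow> 'n clifford" where
  "q_factor s = clif_gen last_ix - (2 * Sc s) *\<^sub>R clif_one"

text \<open>The scalar part of the form at F and G is the integral of the inner product of
  \<open>q_op s y (jet F)\<close> with the jet of G, where y is the last coordinate.  The three linear maps are the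
  coefficients of the powers of y.\<close>

definition q_op0 :: "'n::{finite,linorder} clifford \<Rightarrow> 'n jet \<Rightarrow> 'n jet" where
  "q_op0 s U = (((norm s)\<^sup>2 - beta CARD('n)) *\<^sub>R fst U -
     alpha CARD('n) *\<^sub>R (q_factor s \<odot> (clif_gen last_ix \<odot> fst U)), 0)"

definition q_op1 :: "'n::{finite,linorder} clifford \<Rightarrow> 'n jet \<Rightarrow> 'n jet" where
  "q_op1 s U = ((2 * (1 + alpha CARD('n))) *\<^sub>R (snd U $ last_ix) +
     q_factor s \<odot> (\<Sum>i\<in>UNIV. clif_gen i \<odot> (snd U $ i)), 0)"

definition q_op2 :: "'n::{finite,linorder} jet \<Rightarrow> 'n jet" where
  "q_op2 U = (0, snd U)"

definition q_op :: "'n::{finite,linorder} clifford \<Rightarrow> real \<Rightarrow> 'n jet \<Rightarrow> 'n jet" where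
  "q_op s y U = q_op0 s U + y *\<^sub>R q_op1 s U + y\<^sup>2 *\<^sub>R q_op2 U"

lemma linear_q_op0: "linear (q_op0 s)"
  and linear_q_op1: "linear (q_op1 s)"
  and linear_q_op2: "linear q_op2"
  unfolding q_op0_def q_op1_def q_op2_def
  by (auto intro!: linearI simp: clif_mult_linear algebra_simps sum.distrib scaleR_sum_right)

lemma linear_q_op: "linear (q_op s y)"
  unfolding q_op_def
  by (intro linear_compose_add linear_compose_scale_right linear_q_op0 linear_q_op1 linear_q_op2)

lemma norm_q_factor_mult:
  "norm (q_factor s \<odot> x) = sqrt (1 + 4 * (Sc s)\<^sup>2) * norm x"
  by (simp add: q_factor_def norm_clif_gen_minus_scalar_mult power_mult_distrib)

lemma sum_norm_le_sqrt_card: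
  fixes p :: "('a::real_normed_vector) ^ 'n"
  shows "(\<Sum>i\<in>UNIV. norm (p $ i)) \<le> sqrt (real CARD('n)) * norm p"
proof (rule power2_le_imp_le)
  have "(\<Sum>i\<in>UNIV. norm (p $ i))\<^sup>2 \<le> (\<Sum>i\<in>UNIV. (norm (p $ i))\<^sup>2) * real CARD('n)"
    by (rule sum_squared_le_sum_of_squares)
  also have "(\<Sum>i\<in>UNIV. (norm (p $ i))\<^sup>2) = (norm p)\<^sup>2"
    by (simp add: norm_vec_def L2_set_def sum_nonneg)
  finally show "(\<Sum>i\<in>UNIV. norm (p $ i))\<^sup>2 \<le> (sqrt (real CARD('n)) * norm p)\<^sup>2"
    by (simp add: power_mult_distrib mult.commute)
qed simp

text \<open>Pointwise coercivity: for \<open>U = (u, p)\<close>, \<open>e = |u|\<close> and \<open>d = |p|\<close> the right-hand side is bounded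
  below by a quadratic form in d and e, whose smallest eigenvalue is the constant \<open>K\<close>.\<close>

lemma q_op_coercive:
  fixes s :: "'n::{finite,linorder} clifford"
  assumes y: "0 < m" "m \<le> y" "y \<le> M" and c: "0 \<le> (norm s)\<^sup>2 - beta CARD('n)"
  shows "K_const m M s * (norm U)\<^sup>2 \<le> q_op s y U \<bullet> U"
proof -
  obtain u p where U: "U = (u, p)" by (cases U)
  define S where "S = sqrt (1 + 4 * (Sc s)\<^sup>2)"
  define d where "d = norm p"
  define e where "e = norm u"
  define \<alpha> where "\<alpha> = alpha CARD('n)"
  define c where "c = (norm s)\<^sup>2 - beta CARD('n)"
  define B where "B = 2 * (1 + \<alpha>) + sqrt (real CARD('n)) * S"
  let ?V = "\<Sum>i\<in>UNIV. clif_gen i \<odot> (p $ i)"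
  have "1 \<le> CARD('n)" by (simp add: Suc_leI)
  then have \<alpha>: "0 \<le> \<alpha>" by (simp add: \<alpha>_def alpha_def)
  have S: "0 \<le> S" by (simp add: S_def)
  have B: "0 \<le> B" using \<alpha> S by (simp add: B_def)
  have de: "0 \<le> d" "0 \<le> e" by (auto simp: d_def e_def)
  have bound1: "\<bar>(q_factor s \<odot> (clif_gen last_ix \<odot> u)) \<bullet> u\<bar> \<le> S * e\<^sup>2"
    using Cauchy_Schwarz_ineq2[of "q_factor s \<odot> (clif_gen last_ix \<odot> u)" u]
    by (simp add: norm_q_factor_mult norm_clif_gen_mult S_def e_def power2_eq_square mult.assoc)
  have bound2: "\<bar>(p $ last_ix) \<bullet> u\<bar> \<le> d * e"
    using Cauchy_Schwarz_ineq2[of "p $ last_ix" u] mult_right_mono[OF Finite_Cartesian_Product.norm_nth_le[of p last_ix] norm_ge_zero[of u]]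
    by (simp add: d_def e_def)
  have "norm ?V \<le> (\<Sum>i\<in>UNIV. norm (clif_gen i \<odot> (p $ i)))" by (rule norm_sum)
  also have "\<dots> \<le> sqrt (real CARD('n)) * d"
    using sum_norm_le_sqrt_card[of p] by (simp add: norm_clif_gen_mult d_def)
  finally have V: "norm ?V \<le> sqrt (real CARD('n)) * d" .
  have bound3: "\<bar>(q_factor s \<odot> ?V) \<bullet> u\<bar> \<le> sqrt (real CARD('n)) * S * (d * e)"
  proof -
    have "\<bar>(q_factor s \<odot> ?V) \<bullet> u\<bar> \<le> S * norm ?V * e"
      using Cauchy_Schwarz_ineq2[of "q_factor s \<odot> ?V" u] by (simp add: norm_q_factor_mult S_def e_def)
    also have "\<dots> \<le> S * (sqrt (real CARD('n)) * d) * e"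
      using V S de by (intro mult_right_mono mult_left_mono) auto
    finally show ?thesis by (simp add: mult_ac)
  qed
  have yM: "0 \<le> y" using y by simp
  have 1: "- (\<alpha> * S * e\<^sup>2) \<le> - (\<alpha> * ((q_factor s \<odot> (clif_gen last_ix \<odot> u)) \<bullet> u))"
    using mult_left_mono[OF bound1 \<alpha>] \<alpha> by (simp add: abs_mult mult.assoc abs_le_iff)
      (smt (verit) bound1 mult_left_mono)
  have 2: "- (M * B * d * e) \<le> y * (2 * (1 + \<alpha>) * ((p $ last_ix) \<bullet> u) + (q_factor s \<odot> ?V) \<bullet> u)"
  proof -
    have "2 * (1 + \<alpha>) * ((p $ last_ix) \<bullet> u) \<ge> - (2 * (1 + \<alpha>) * (d * e))"
      using mult_left_mono[of "- (d * e)" "(p $ last_ix) \<bullet> u" "2 * (1 + \<alpha>)"] bound2 \<alpha> by (simp add: abs_le_iff)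
    then have "- (B * (d * e)) \<le> 2 * (1 + \<alpha>) * ((p $ last_ix) \<bullet> u) + (q_factor s \<odot> ?V) \<bullet> u" (is "_ \<le> ?w")
      using bound3 by (simp add: B_def distrib_right abs_le_iff)
    then have "y * - (B * (d * e)) \<le> y * ?w" using yM by (rule mult_left_mono)
    moreover have "y * (B * (d * e)) \<le> M * (B * (d * e))"
      using y B de by (intro mult_right_mono) auto
    ultimately show ?thesis by (simp add: mult.assoc)
  qed
  have 3: "m\<^sup>2 * d\<^sup>2 \<le> y\<^sup>2 * d\<^sup>2" using y by (intro mult_right_mono power_mono) auto
  have form: "q_op s y U \<bullet> U = c * e\<^sup>2 - \<alpha> * ((q_factor s \<odot> (clif_gen last_ix \<odot> u)) \<bullet> u)
      + y * (2 * (1 + \<alpha>) * ((p $ last_ix) \<bullet> u) + (q_factor s \<odot> ?V) \<bullet> u) + y\<^sup>2 * d\<^sup>2"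
    by (simp add: q_op_def q_op0_def q_op1_def q_op2_def U inner_simps \<alpha>_def c_def e_def d_def power2_norm_eq_inner)
  have "K_const m M s * (norm U)\<^sup>2 = (m\<^sup>2 + (c - \<alpha> * S) - sqrt ((c - \<alpha> * S - m\<^sup>2)\<^sup>2 + (M * B)\<^sup>2)) / 2 * (d\<^sup>2 + e\<^sup>2)"
  proof -
    have "K_const m M s = (m\<^sup>2 + (c - \<alpha> * S) - sqrt ((c - \<alpha> * S - m\<^sup>2)\<^sup>2 + (M * B)\<^sup>2)) / 2"
      using c unfolding K_const_def c_def[symmetric] \<alpha>_def[symmetric] S_def[symmetric] B_def[symmetric]
      by (simp add: power_mult_distrib field_simps)
    moreover have "(norm U)\<^sup>2 = d\<^sup>2 + e\<^sup>2" by (simp add: U norm_Pair d_def e_def)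
    ultimately show ?thesis by simp
  qed
  also have "\<dots> \<le> m\<^sup>2 * d\<^sup>2 - (M * B) * d * e + (c - \<alpha> * S) * e\<^sup>2"
    by (rule quadratic_form_ge_eigenvalue)
  also have "\<dots> \<le> q_op s y U \<bullet> U"
    using 1 2 3 unfolding form by (simp add: left_diff_distrib)
  finally show ?thesis .
qed

text \<open>The hypothesis on the determinant excludes \<open>|s|\<^sup>2 < \<beta>\<close>, because \<open>m < M\<close> and
  \<open>\<beta> \<le> (1 + \<alpha>)\<^sup>2\<close>.  Up to the factor 4 it then says that the determinant of the quadratic form is
  positive, and the other hypothesis says the same of the trace.\<close>

lemma
  fixes s :: "'n::{finite,linorder} clifford"
  assumes mM: "0 < m" "m < M"
    and trace: "\<bar>(norm s)\<^sup>2 - beta CARD('n)\<bar> - alpha CARD('n) * sqrt (1 + 4 * (Sc s)\<^sup>2) + m\<^sup>2 > 0"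
    and det: "4 * m\<^sup>2 * \<bar>(norm s)\<^sup>2 - beta CARD('n)\<bar> - 4 * real CARD('n) * M\<^sup>2 * (Sc s)\<^sup>2
          - 4 * (m\<^sup>2 * alpha CARD('n) + M\<^sup>2 * (1 + alpha CARD('n)) * sqrt (real CARD('n)))
              * sqrt (1 + 4 * (Sc s)\<^sup>2)
         > M\<^sup>2 * (4 * (1 + alpha CARD('n))\<^sup>2 + real CARD('n))"
  shows norm_square_ge_beta: "0 \<le> (norm s)\<^sup>2 - beta CARD('n)"
    and K_const_pos: "0 < K_const m M s"
proof -
  define S where "S = sqrt (1 + 4 * (Sc s)\<^sup>2)"
  define \<alpha> where "\<alpha> = alpha CARD('n)"
  define \<beta> where "\<beta> = beta CARD('n)"
  define c where "c = \<bar>(norm s)\<^sup>2 - \<beta>\<bar>"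
  define r where "r = sqrt (real CARD('n))"
  define t where "t = (Sc s)\<^sup>2"
  have r2: "r\<^sup>2 = real CARD('n)" "0 \<le> r" by (auto simp: r_def)
  have S2: "S\<^sup>2 = 1 + 4 * t" "0 \<le> S" "0 \<le> t" by (auto simp: S_def t_def)
  have "1 \<le> CARD('n)" by (simp add: Suc_leI)
  then have \<alpha>: "0 \<le> \<alpha>" by (simp add: \<alpha>_def alpha_def)
  have det': "4 * m\<^sup>2 * c - 4 * r\<^sup>2 * M\<^sup>2 * t - 4 * (m\<^sup>2 * \<alpha> + M\<^sup>2 * (1 + \<alpha>) * r) * S > M\<^sup>2 * (4 * (1 + \<alpha>)\<^sup>2 + r\<^sup>2)"
    using det by (simp add: r2 c_def \<alpha>_def \<beta>_def S_def t_def) (simp add: r_def)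
  show "0 \<le> (norm s)\<^sup>2 - beta CARD('n)"
  proof (rule ccontr)
    assume "\<not> ?thesis"
    then have "c \<le> \<beta>" using zero_le_power2[of "norm s"] by (simp add: c_def \<beta>_def)
    also have "\<beta> \<le> (1 + \<alpha>)\<^sup>2" using \<alpha> by (simp add: \<beta>_def beta_def \<alpha>_def power2_eq_square algebra_simps)
    finally have "c \<le> (1 + \<alpha>)\<^sup>2" .
    moreover have "m\<^sup>2 \<le> M\<^sup>2" using mM by (simp add: power_mono)
    ultimately have "m\<^sup>2 * c \<le> M\<^sup>2 * (1 + \<alpha>)\<^sup>2" by (intro mult_mono) (auto simp: c_def)
    moreover have "0 \<le> r\<^sup>2 * M\<^sup>2 * t" "0 \<le> (m\<^sup>2 * \<alpha> + M\<^sup>2 * (1 + \<alpha>) * r) * S" "0 \<le> M\<^sup>2 * r\<^sup>2"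
      using \<alpha> S2 r2 by auto
    moreover have "4 * (M\<^sup>2 * (1 + \<alpha>)\<^sup>2) + M\<^sup>2 * r\<^sup>2
        < 4 * (m\<^sup>2 * c) - 4 * (r\<^sup>2 * M\<^sup>2 * t) - 4 * ((m\<^sup>2 * \<alpha> + M\<^sup>2 * (1 + \<alpha>) * r) * S)"
      using det' by (simp add: algebra_simps)
    ultimately show False by linarith
  qed
  define R where "R = c - \<alpha> * S"
  define B where "B = 2 * (1 + \<alpha>) + r * S"
  have "M\<^sup>2 * B\<^sup>2 = M\<^sup>2 * (4 * (1 + \<alpha>)\<^sup>2 + r\<^sup>2) + 4 * r\<^sup>2 * M\<^sup>2 * t + 4 * M\<^sup>2 * (1 + \<alpha>) * r * S"
  proof -
    have "B\<^sup>2 = 4 * (1 + \<alpha>)\<^sup>2 + 4 * (1 + \<alpha>) * r * S + r\<^sup>2 * S\<^sup>2"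
      by (simp add: B_def power2_eq_square algebra_simps)
    then show ?thesis by (simp add: S2 algebra_simps)
  qed
  then have MB: "M\<^sup>2 * B\<^sup>2 < 4 * m\<^sup>2 * R"
    using det' by (simp add: R_def algebra_simps)
  have "0 < R + m\<^sup>2" using trace by (simp add: R_def c_def \<alpha>_def \<beta>_def S_def)
  moreover have "(R - m\<^sup>2)\<^sup>2 + M\<^sup>2 * B\<^sup>2 < (R + m\<^sup>2)\<^sup>2"
    using MB by (simp add: power2_eq_square algebra_simps)
  ultimately have "sqrt ((R - m\<^sup>2)\<^sup>2 + M\<^sup>2 * B\<^sup>2) < R + m\<^sup>2"
    by (intro real_less_lsqrt) auto
  then show "0 < K_const m M s"
    unfolding K_const_def \<beta>_def[symmetric] \<alpha>_def[symmetric] S_def[symmetric] c_def[symmetric] r_def[symmetric]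
      B_def[symmetric] R_def[symmetric] by (simp add: R_def algebra_simps)
qed

section \<open>The form on the Sobolev space\<close>

lemma ycoord_measurable: "open \<Omega> \<Longrightarrow> ycoord \<in> borel_measurable (lebesgue_on \<Omega>)"
  unfolding ycoord_def[abs_def]
  by (intro continuous_imp_measurable_on_sets_lebesgue) (auto intro!: continuous_intros)

text \<open>The operator \<^const>\<open>q_op\<close> applied to the jet of a function.\<close>

definition q_jet :: "(real ^ 'n::{finite,linorder}) set \<Rightarrow> 'n clifford \<Rightarrow> 'n cfun \<Rightarrow> (real, 'n) vec \<Rightarrow> 'n jet" where
  "q_jet \<Omega> s F x = q_op s (ycoord x) (jet \<Omega> F x)"

text \<open>From here on \<open>\<Omega>\<close> is an open subset of the slab \<open>m \<le> y \<le> M\<close> with \<open>m > 0\<close>.\<close>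

context
  fixes \<Omega> :: "(real ^ 'n::{finite,linorder}) set" and m M :: real
  assumes \<Omega>: "open \<Omega>" and y_bounds: "\<And>x. x \<in> \<Omega> \<Longrightarrow> m \<le> ycoord x" "\<And>x. x \<in> \<Omega> \<Longrightarrow> ycoord x \<le> M"
    and m_pos: "0 < m"
begin

lemma ycoord_abs_le: "x \<in> \<Omega> \<Longrightarrow> \<bar>ycoord x\<bar> \<le> M"
  using y_bounds[of x] m_pos by simp

lemma sq_integrable_ycoord_scaleR:
  "F \<in> sq_integrable (lebesgue_on \<Omega>) \<Longrightarrow> (\<lambda>x. ycoord x *\<^sub>R F x) \<in> sq_integrable (lebesgue_on \<Omega>)"
  by (rule sq_integrable_scale_bounded[where C=M]) (auto simp: ycoord_measurable[OF \<Omega>] ycoord_abs_le)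

lemma sq_integrable_ycoord_square_scaleR:
  "F \<in> sq_integrable (lebesgue_on \<Omega>) \<Longrightarrow> (\<lambda>x. (ycoord x)\<^sup>2 *\<^sub>R F x) \<in> sq_integrable (lebesgue_on \<Omega>)"
  using sq_integrable_ycoord_scaleR[OF sq_integrable_ycoord_scaleR] by (simp add: power2_eq_square)

lemmas sq_integrable_ycoord = sq_integrable_ycoord_scaleR sq_integrable_ycoord_square_scaleR

lemma sq_integrable_q_op:
  assumes U: "U \<in> sq_integrable (lebesgue_on \<Omega>)"
  shows "(\<lambda>x. q_op s (ycoord x) (U x)) \<in> sq_integrable (lebesgue_on \<Omega>)"
  unfolding q_op_def
  using linear_q_op0[of s] linear_q_op1[of s] linear_q_op2
  by (intro sq_integrable_add sq_integrable_ycoord sq_integrable_linear[OF U])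
    (simp_all add: linear_conv_bounded_linear)

lemma sq_integrable_q_jet: "F \<in> H10 \<Omega> \<Longrightarrow> q_jet \<Omega> s F \<in> sq_integrable (lebesgue_on \<Omega>)"
  unfolding q_jet_def[abs_def] by (intro sq_integrable_q_op sq_integrable_jet)

lemma q_op_bound:
  fixes s :: "'n clifford"
  shows "\<exists>C\<ge>0. \<forall>x\<in>\<Omega>. \<forall>U. norm (q_op s (ycoord x) U) \<le> C * norm U"
proof -
  have bl: "bounded_linear (q_op0 s)" "bounded_linear (q_op1 s)" "bounded_linear (q_op2 :: 'n jet \<Rightarrow> _)"
    by (simp_all add: linear_conv_bounded_linear[symmetric] linear_q_op0 linear_q_op1 linear_q_op2)
  let ?C = "onorm (q_op0 s) + M * onorm (q_op1 s) + M\<^sup>2 * onorm (q_op2 :: 'n jet \<Rightarrow> _)"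
  have "norm (q_op s (ycoord x) U) \<le> \<bar>?C\<bar> * norm U" if x: "x \<in> \<Omega>" for x U
  proof -
    have "norm (q_op s (ycoord x) U) \<le> norm (q_op0 s U) + \<bar>ycoord x\<bar> * norm (q_op1 s U) + (ycoord x)\<^sup>2 * norm (q_op2 U)"
      unfolding q_op_def by (intro norm_triangle_le add_mono) auto
    also have "\<dots> \<le> onorm (q_op0 s) * norm U + M * (onorm (q_op1 s) * norm U) + M\<^sup>2 * (onorm (q_op2 :: 'n jet \<Rightarrow> _) * norm U)"
      using ycoord_abs_le[OF x] power_mono[OF ycoord_abs_le[OF x], of 2]
      by (intro add_mono mult_mono onorm[OF bl(1)] onorm[OF bl(2)] onorm[OF bl(3)]) auto
    also have "\<dots> = ?C * norm U" by (simp add: algebra_simps)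
    also have "\<dots> \<le> \<bar>?C\<bar> * norm U" by (intro mult_right_mono) auto
    finally show ?thesis .
  qed
  then show ?thesis by (intro exI[of _ "\<bar>?C\<bar>"]) auto
qed

lemma sq_integrable_dirac:
  assumes F: "F \<in> H10 \<Omega>"
  shows "dirac_H \<Omega> F \<in> sq_integrable (lebesgue_on \<Omega>)"
proof -
  show ?thesis
    unfolding dirac_H_def
    by (intro sq_integrable_add sq_integrable_diff sq_integrable_sum sq_integrable_scaleR
        sq_integrable_linear[OF _ bounded_linear_clif_mult(1)] sq_integrable_ycoord H10_L2[OF F])
qed

lemma dirac_H_eq:
  "dirac_H \<Omega> F x = ycoord x *\<^sub>R (\<Sum>i\<in>UNIV. clif_gen i \<odot> weak_partial \<Omega> i F x) - alpha CARD('n) *\<^sub>R (clif_gen last_ix \<odot> F x)"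
  by (simp add: dirac_H_def sum.remove[of UNIV last_ix] clif_mult_scaleR scaleR_sum_right algebra_simps)

text \<open>The coefficient of the form at a basis element is, up to sign, the scalar form with the second
  argument multiplied by that element on the right.\<close>

lemma q_form_component:
  assumes F: "F \<in> H10 \<Omega>" and G: "G \<in> H10 \<Omega>"
  shows "q_form \<Omega> s F G $ A =
    clif_sign A A * l2_inner (lebesgue_on \<Omega>) (q_jet \<Omega> s F) (jet \<Omega> (\<lambda>x. G x \<odot> axis A 1))"
proof -
  let ?M = "lebesgue_on \<Omega>"
  let ?e = "axis A 1 :: 'n clifford"
  let ?Q = "\<lambda>x. (G x \<odot> ?e, \<chi> i. weak_partial \<Omega> i G x \<odot> ?e) :: 'n jet"
  let ?T = "\<lambda>i x. ((ycoord x)\<^sup>2 *\<^sub>R weak_partial \<Omega> i F x) \<bullet> (weak_partial \<Omega> i G x \<odot> ?e)"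
  let ?P1 = "\<lambda>x. ycoord x *\<^sub>R weak_partial \<Omega> last_ix F x"
  let ?P2 = "\<lambda>x. q_factor s \<odot> dirac_H \<Omega> F x"
  let ?P3 = "\<lambda>x. ((norm s)\<^sup>2 - beta CARD('n)) *\<^sub>R F x"
  note e = bounded_linear_clif_mult(2)[of ?e]
  have P: "?P1 \<in> sq_integrable ?M" "?P2 \<in> sq_integrable ?M" "?P3 \<in> sq_integrable ?M"
    by (intro sq_integrable_ycoord sq_integrable_scaleR H10_L2[OF F]
        sq_integrable_linear[OF _ bounded_linear_clif_mult(1)] sq_integrable_dirac[OF F])+
  have W: "(\<lambda>x. (ycoord x)\<^sup>2 *\<^sub>R weak_partial \<Omega> i F x) \<in> sq_integrable ?M" for i
    by (intro sq_integrable_ycoord H10_L2[OF F])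
  have Ge: "(\<lambda>x. G x \<odot> ?e) \<in> sq_integrable ?M" "(\<lambda>x. weak_partial \<Omega> i G x \<odot> ?e) \<in> sq_integrable ?M" for i
    by (intro sq_integrable_linear[OF _ e] H10_L2[OF G])+
  have int: "integrable ?M (?T i)" "integrable ?M (\<lambda>x. ?P1 x \<bullet> (G x \<odot> ?e))"
    "integrable ?M (\<lambda>x. ?P2 x \<bullet> (G x \<odot> ?e))" "integrable ?M (\<lambda>x. ?P3 x \<bullet> (G x \<odot> ?e))" for i
    by (intro sq_integrable_inner P W Ge)+
  have split: "(\<Sum>i\<in>UNIV. integral\<^sup>L ?M (?T i)) = integral\<^sup>L ?M (?T last_ix) + (\<Sum>i\<in>UNIV - {last_ix}. integral\<^sup>L ?M (?T i))"
    by (rule sum.remove) auto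
  have "q_form \<Omega> s F G $ A = clif_sign A A * ((\<Sum>i\<in>UNIV. integral\<^sup>L ?M (?T i))
      + 2 * (1 + alpha CARD('n)) * (LINT x|?M. ?P1 x \<bullet> (G x \<odot> ?e))
      + (LINT x|?M. ?P2 x \<bullet> (G x \<odot> ?e)) + (LINT x|?M. ?P3 x \<bullet> (G x \<odot> ?e)))"
    using inner2_component[OF W H10_L2(2)[OF G]] inner2_component[OF P(1) H10_L2(1)[OF G]]
      inner2_component[OF P(2) H10_L2(1)[OF G]] inner2_component[OF P(3) H10_L2(1)[OF G]]
    unfolding q_form_def q_factor_def[symmetric] split
    by (simp only: vector_add_component sum_component vector_scaleR_component l2_inner_def real_scaleR_def)
      (simp only: distrib_left sum_distrib_left mult_ac add_ac)
  also have "(\<Sum>i\<in>UNIV. integral\<^sup>L ?M (?T i))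
      + 2 * (1 + alpha CARD('n)) * (LINT x|?M. ?P1 x \<bullet> (G x \<odot> ?e))
      + (LINT x|?M. ?P2 x \<bullet> (G x \<odot> ?e)) + (LINT x|?M. ?P3 x \<bullet> (G x \<odot> ?e))
      = (LINT x|?M. (\<Sum>i\<in>UNIV. ?T i x) + 2 * (1 + alpha CARD('n)) * (?P1 x \<bullet> (G x \<odot> ?e))
      + ?P2 x \<bullet> (G x \<odot> ?e) + ?P3 x \<bullet> (G x \<odot> ?e))"
    using int by (simp del: inner_scaleR_left)
  also have "\<dots> = l2_inner ?M (q_jet \<Omega> s F) ?Q"
    unfolding l2_inner_def
  proof (rule Bochner_Integration.integral_cong[OF refl])
    fix x
    show "(\<Sum>i\<in>UNIV. ?T i x) + 2 * (1 + alpha CARD('n)) * (?P1 x \<bullet> (G x \<odot> ?e))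
      + ?P2 x \<bullet> (G x \<odot> ?e) + ?P3 x \<bullet> (G x \<odot> ?e) = q_jet \<Omega> s F x \<bullet> ?Q x"
      by (simp add: q_jet_def q_op_def q_op0_def q_op1_def q_op2_def jet_def dirac_H_eq
          inner_vec_def[of "\<chi> i. _ i"] inner_simps clif_mult_linear sum_distrib_left algebra_simps)
  qed
  also have "\<dots> = l2_inner ?M (q_jet \<Omega> s F) (jet \<Omega> (\<lambda>x. G x \<odot> ?e))"
  proof (rule l2_inner_cong_AE)
    have "AE x in ?M. jet \<Omega> (\<lambda>x. G x \<odot> ?e) x = ?Q x"
      using jet_linear[OF \<Omega> G linear_clif_mult_left[of ?e]] by (simp add: jet_def)
    then show "AE x in ?M. ?Q x = jet \<Omega> (\<lambda>x. G x \<odot> ?e) x" by eventually_elim simp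
  qed (auto intro!: sq_integrable_q_jet F sq_integrable_jetI Ge sq_integrable_jet H10_linear[OF \<Omega> G linear_clif_mult_left])
  finally show ?thesis .
qed

text \<open>The scalar equation for all G implies the Clifford-valued one, since G may be replaced by its
  product with a basis element.\<close>

lemma weak_solution_iff:
  assumes f: "f \<in> L2 \<Omega>"
  shows "weak_solution \<Omega> s f F \<longleftrightarrow> F \<in> H10 \<Omega> \<and>
    (\<forall>G\<in>H10 \<Omega>. l2_inner (lebesgue_on \<Omega>) (q_jet \<Omega> s F) (jet \<Omega> G) = l2_inner (lebesgue_on \<Omega>) f G)"
    (is "?L \<longleftrightarrow> ?R")
proof -
  have f: "f \<in> sq_integrable (lebesgue_on \<Omega>)" using f by (simp add: L2_eq)
  show ?thesis
  proof
    assume L: ?L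
    show ?R
    proof (intro conjI ballI)
      show F: "F \<in> H10 \<Omega>" using L by (simp add: weak_solution_def)
      fix G assume G: "G \<in> H10 \<Omega>"
      have "q_form \<Omega> s F G $ {} = inner2 \<Omega> f G $ {}" using L G by (simp add: weak_solution_def)
      then show "l2_inner (lebesgue_on \<Omega>) (q_jet \<Omega> s F) (jet \<Omega> G) = l2_inner (lebesgue_on \<Omega>) f G"
        unfolding q_form_component[OF F G] inner2_component[OF f H10_L2(1)[OF G]]
        by (simp add: clif_sign_def clif_one_def[symmetric] clif_mult_one)
    qed
  next
    assume R: ?R
    then have F: "F \<in> H10 \<Omega>" by simp
    have "q_form \<Omega> s F G $ A = inner2 \<Omega> f G $ A" if G: "G \<in> H10 \<Omega>" for G A
      unfolding q_form_component[OF F G] inner2_component[OF f H10_L2(1)[OF G]]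
      using R H10_linear[OF \<Omega> G linear_clif_mult_left[of "axis A 1"]] by simp
    then show ?L using F by (simp add: weak_solution_def vec_eq_iff)
  qed
qed

lemma H1_inner_eq_norms:
  assumes F: "F \<in> H10 \<Omega>"
  shows "H1_inner \<Omega> F F = (norm2 \<Omega> F)\<^sup>2 + (normD \<Omega> F)\<^sup>2"
proof -
  let ?M = "lebesgue_on \<Omega>"
  have sq: "(norm2 \<Omega> P)\<^sup>2 = (LINT x|?M. P x \<bullet> P x)" if "P \<in> sq_integrable ?M" for P
    using that by (simp add: norm2_eq_snorm L2.snorm_sq l2_inner_def)
  have "(normD \<Omega> F)\<^sup>2 = (\<Sum>i\<in>UNIV. (norm2 \<Omega> (weak_partial \<Omega> i F))\<^sup>2)"
    by (simp add: normD_def sum_nonneg sum.remove[of UNIV last_ix] add.commute)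
  moreover have "H1_inner \<Omega> F F = (LINT x|?M. F x \<bullet> F x + (\<Sum>i\<in>UNIV. weak_partial \<Omega> i F x \<bullet> weak_partial \<Omega> i F x))"
    by (simp add: H1_inner_def l2_inner_def jet_def inner_vec_def[of "\<chi> i. _ i"])
  ultimately show ?thesis
    using sq_integrable_inner[OF H10_L2(1)[OF F] H10_L2(1)[OF F]] sq_integrable_inner[OF H10_L2(2)[OF F] H10_L2(2)[OF F]]
    by (simp add: sq[OF H10_L2(1)[OF F]] sq[OF H10_L2(2)[OF F]])
qed

lemma q_jet_coercive:
  assumes F: "F \<in> H10 \<Omega>" and s: "0 \<le> (norm s)\<^sup>2 - beta CARD('n)"
  shows "K_const m M s * H1_inner \<Omega> F F \<le> l2_inner (lebesgue_on \<Omega>) (q_jet \<Omega> s F) (jet \<Omega> F)"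
proof -
  let ?M = "lebesgue_on \<Omega>"
  have "K_const m M s * H1_inner \<Omega> F F = (LINT x|?M. K_const m M s * (jet \<Omega> F x \<bullet> jet \<Omega> F x))"
    by (simp add: H1_inner_def l2_inner_def)
  also have "\<dots> \<le> (LINT x|?M. q_jet \<Omega> s F x \<bullet> jet \<Omega> F x)"
  proof (rule integral_mono)
    show "integrable ?M (\<lambda>x. K_const m M s * (jet \<Omega> F x \<bullet> jet \<Omega> F x))"
      by (intro integrable_mult_right sq_integrable_inner sq_integrable_jet F)
    show "integrable ?M (\<lambda>x. q_jet \<Omega> s F x \<bullet> jet \<Omega> F x)"
      by (intro sq_integrable_inner sq_integrable_q_jet sq_integrable_jet F)
    show "K_const m M s * (jet \<Omega> F x \<bullet> jet \<Omega> F x) \<le> q_jet \<Omega> s F x \<bullet> jet \<Omega> F x" if "x \<in> space ?M" for x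
      using q_op_coercive[OF m_pos y_bounds(1)[of x] y_bounds(2)[of x] s, of "jet \<Omega> F x"] that
      by (simp add: q_jet_def power2_norm_eq_inner)
  qed
  finally show ?thesis by (simp add: l2_inner_def)
qed

lemma q_jet_lincomb:
  assumes F: "F \<in> H10 \<Omega>" and G: "G \<in> H10 \<Omega>" and V: "V \<in> sq_integrable (lebesgue_on \<Omega>)"
  shows "l2_inner (lebesgue_on \<Omega>) (q_jet \<Omega> s (F + G)) V =
      l2_inner (lebesgue_on \<Omega>) (q_jet \<Omega> s F) V + l2_inner (lebesgue_on \<Omega>) (q_jet \<Omega> s G) V"
    and "l2_inner (lebesgue_on \<Omega>) (q_jet \<Omega> s (c *\<^sub>R F)) V = c * l2_inner (lebesgue_on \<Omega>) (q_jet \<Omega> s F) V"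
proof -
  let ?M = "lebesgue_on \<Omega>"
  note Q = sq_integrable_q_jet[OF F, of s] sq_integrable_q_jet[OF G, of s]
  have "l2_inner ?M (q_jet \<Omega> s (F + G)) V = l2_inner ?M (q_jet \<Omega> s F + q_jet \<Omega> s G) V"
  proof (rule l2_inner_cong_AE)
    show "AE x in ?M. q_jet \<Omega> s (F + G) x = (q_jet \<Omega> s F + q_jet \<Omega> s G) x"
      using jet_add[OF \<Omega> F G] by eventually_elim (simp add: q_jet_def linear_add[OF linear_q_op])
  qed (auto intro!: V L2.V_add Q sq_integrable_q_jet H10_add[OF \<Omega> F G])
  then show "l2_inner ?M (q_jet \<Omega> s (F + G)) V = l2_inner ?M (q_jet \<Omega> s F) V + l2_inner ?M (q_jet \<Omega> s G) V"
    using Q V by (simp add: L2.ip_add_left)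
  have "l2_inner ?M (q_jet \<Omega> s (c *\<^sub>R F)) V = l2_inner ?M (c *\<^sub>R q_jet \<Omega> s F) V"
  proof (rule l2_inner_cong_AE)
    show "AE x in ?M. q_jet \<Omega> s (c *\<^sub>R F) x = (c *\<^sub>R q_jet \<Omega> s F) x"
      using jet_scaleR[OF \<Omega> F G, of c] by eventually_elim (simp add: q_jet_def linear_cmul[OF linear_q_op])
  qed (auto intro!: V L2.V_scaleR Q sq_integrable_q_jet H10_scaleR[OF \<Omega> F G])
  then show "l2_inner ?M (q_jet \<Omega> s (c *\<^sub>R F)) V = c * l2_inner ?M (q_jet \<Omega> s F) V"
    using Q V by (simp add: L2.ip_scaleR_left)
qed

lemma weak_solution_exists:
  assumes s: "0 \<le> (norm s)\<^sup>2 - beta CARD('n)" and K: "0 < K_const m M s" and f: "f \<in> L2 \<Omega>"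
  shows "\<exists>F. weak_solution \<Omega> s f F"
proof -
  let ?M = "lebesgue_on \<Omega>"
  interpret H: semi_hilbert_space "H10 \<Omega>" "H1_inner \<Omega>" by (rule semi_hilbert_space_H10[OF \<Omega>])
  have f': "f \<in> sq_integrable ?M" using f by (simp add: L2_eq)
  obtain C where C: "0 \<le> C" and op: "\<And>x U. x \<in> \<Omega> \<Longrightarrow> norm (q_op s (ycoord x) U) \<le> C * norm U"
    using q_op_bound[of s] by blast
  have snorm_eq: "H.snorm F = L2.snorm ?M (jet \<Omega> F)" for F
    by (simp add: H.snorm_def L2.snorm_def H1_inner_def)
  have jet_right: "l2_inner ?M V (jet \<Omega> (F + G)) = l2_inner ?M V (jet \<Omega> F) + l2_inner ?M V (jet \<Omega> G)"
    "l2_inner ?M V (jet \<Omega> (c *\<^sub>R F)) = c * l2_inner ?M V (jet \<Omega> F)"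
    if "F \<in> H10 \<Omega>" "G \<in> H10 \<Omega>" "V \<in> sq_integrable ?M" for F G V c
    using l2_inner_jet_left[OF \<Omega> that]
    by (simp_all add: l2_inner_def inner_commute[of "V _"])
  have "\<exists>F\<in>H10 \<Omega>. \<forall>G\<in>H10 \<Omega>. l2_inner ?M (q_jet \<Omega> s F) (jet \<Omega> G) = l2_inner ?M f G"
  proof (rule H.Lax_Milgram[where C=C and \<kappa>="K_const m M s" and D="L2.snorm ?M f"])
    fix F G assume F: "F \<in> H10 \<Omega>" and G: "G \<in> H10 \<Omega>"
    have "\<bar>l2_inner ?M (q_jet \<Omega> s F) (jet \<Omega> G)\<bar> \<le> L2.snorm ?M (q_jet \<Omega> s F) * L2.snorm ?M (jet \<Omega> G)"
      by (intro L2.Cauchy_Schwarz sq_integrable_q_jet sq_integrable_jet F G)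
    also have "\<dots> \<le> (C * L2.snorm ?M (jet \<Omega> F)) * L2.snorm ?M (jet \<Omega> G)"
      using op by (intro mult_right_mono snorm_le_mult sq_integrable_q_jet sq_integrable_jet F G C L2.snorm_nonneg)
        (simp add: q_jet_def)
    finally show "\<bar>l2_inner ?M (q_jet \<Omega> s F) (jet \<Omega> G)\<bar> \<le> C * (H.snorm F * H.snorm G)"
      by (simp add: snorm_eq mult.assoc)
  next
    fix F assume F: "F \<in> H10 \<Omega>"
    show "K_const m M s * (H.snorm F)\<^sup>2 \<le> l2_inner ?M (q_jet \<Omega> s F) (jet \<Omega> F)"
      using q_jet_coercive[OF F s] by (simp add: H.snorm_sq[OF F])
    have "L2.snorm ?M F \<le> 1 * L2.snorm ?M (jet \<Omega> F)"
    proof (rule snorm_le_mult)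
      show "norm (F x) \<le> 1 * norm (jet \<Omega> F x)" for x
        by (simp add: jet_def norm_fst_le)
    qed (auto intro: F sq_integrable_jet H10_L2)
    moreover have "\<bar>l2_inner ?M f F\<bar> \<le> L2.snorm ?M f * L2.snorm ?M F"
      by (intro L2.Cauchy_Schwarz f' H10_L2 F)
    ultimately show "\<bar>l2_inner ?M f F\<bar> \<le> L2.snorm ?M f * H.snorm F"
      using mult_left_mono[of "L2.snorm ?M F" "L2.snorm ?M (jet \<Omega> F)" "L2.snorm ?M f"] L2.snorm_nonneg[OF f']
      by (simp add: snorm_eq)
  qed (use K f' in \<open>auto simp: q_jet_lincomb jet_right sq_integrable_jet sq_integrable_q_jet L2.ip_add_right
      L2.ip_scaleR_right H10_L2\<close>)
  then show ?thesis by (auto simp: weak_solution_iff[OF f])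
qed

text \<open>Coercivity gives \<open>K (a\<^sup>2 + d\<^sup>2) \<le> b a\<close> for the norms a, d of the solution and b of the
  right-hand side.  This yields \<open>K a \<le> b\<close>, and then \<open>(K d)\<^sup>2 \<le> b (K a) \<le> b\<^sup>2\<close>.\<close>

lemma weak_solution_bounds:
  assumes s: "0 \<le> (norm s)\<^sup>2 - beta CARD('n)" and K: "0 < K_const m M s" and f: "f \<in> L2 \<Omega>"
    and sol: "weak_solution \<Omega> s f F"
  shows "norm2 \<Omega> F \<le> 1 / K_const m M s * norm2 \<Omega> f" "normD \<Omega> F \<le> 1 / K_const m M s * norm2 \<Omega> f"
proof -
  let ?M = "lebesgue_on \<Omega>" and ?K = "K_const m M s"
  have f': "f \<in> sq_integrable ?M" using f by (simp add: L2_eq)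
  have F: "F \<in> H10 \<Omega>" and eq: "l2_inner ?M (q_jet \<Omega> s F) (jet \<Omega> F) = l2_inner ?M f F"
    using sol by (auto simp: weak_solution_iff[OF f])
  define a b d where "a = norm2 \<Omega> F" and "b = norm2 \<Omega> f" and "d = normD \<Omega> F"
  have nonneg: "0 \<le> a" "0 \<le> b"
    by (simp_all add: a_def b_def norm2_eq_snorm[OF f'] norm2_eq_snorm[OF H10_L2(1)[OF F]] L2.snorm_nonneg f' H10_L2[OF F])
  have "?K * (a\<^sup>2 + d\<^sup>2) \<le> l2_inner ?M f F"
    using q_jet_coercive[OF F s] by (simp add: eq H1_inner_eq_norms[OF F] a_def d_def)
  also have "\<dots> \<le> b * a"
    using L2.Cauchy_Schwarz[OF f' H10_L2(1)[OF F]]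
    by (simp add: a_def b_def norm2_eq_snorm[OF f'] norm2_eq_snorm[OF H10_L2(1)[OF F]])
  finally have energy: "?K * (a\<^sup>2 + d\<^sup>2) \<le> b * a" .
  have Ka: "?K * a \<le> b"
  proof (cases "a = 0")
    case False
    have "?K * a\<^sup>2 \<le> ?K * (a\<^sup>2 + d\<^sup>2)" using K by simp
    then have "(?K * a) * a \<le> b * a" using energy by (simp add: power2_eq_square mult.assoc)
    then show ?thesis using False nonneg by simp
  qed (use nonneg in simp)
  have "(?K * d)\<^sup>2 \<le> ?K * (?K * (a\<^sup>2 + d\<^sup>2))"
  proof -
    have "?K * (?K * (a\<^sup>2 + d\<^sup>2)) = (?K * a)\<^sup>2 + (?K * d)\<^sup>2"
      by (simp add: power2_eq_square distrib_left mult_ac)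
    then show ?thesis by simp
  qed
  also have "\<dots> \<le> ?K * (b * a)" using energy K by simp
  also have "\<dots> = b * (?K * a)" by simp
  also have "\<dots> \<le> b * b" by (intro mult_left_mono Ka nonneg)
  finally have "?K * d \<le> b" unfolding power2_eq_square[of b, symmetric] by (rule power2_le_imp_le[OF _ nonneg(2)])
  with Ka show "norm2 \<Omega> F \<le> 1 / ?K * norm2 \<Omega> f" "normD \<Omega> F \<le> 1 / ?K * norm2 \<Omega> f"
    using K by (simp_all add: a_def b_def d_def field_simps)
qed

lemma weak_solution_unique:
  assumes s: "0 \<le> (norm s)\<^sup>2 - beta CARD('n)" and K: "0 < K_const m M s" and f: "f \<in> L2 \<Omega>"
    and sol: "weak_solution \<Omega> s f F" "weak_solution \<Omega> s f F'"
  shows "AE x in lebesgue_on \<Omega>. F' x = F x"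
proof -
  let ?M = "lebesgue_on \<Omega>"
  have F: "F \<in> H10 \<Omega>" "F' \<in> H10 \<Omega>" using sol by (auto simp: weak_solution_def)
  have D: "F' - F \<in> H10 \<Omega>" "(-1) *\<^sub>R F \<in> H10 \<Omega>"
    by (rule H10_diff[OF \<Omega> F(2,1)], rule H10_scaleR[OF \<Omega> F(1,1)])
  have "l2_inner ?M (q_jet \<Omega> s (F' + (-1) *\<^sub>R F)) (jet \<Omega> (F' - F)) = 0"
    using sol D by (simp only: q_jet_lincomb[OF F(2) D(2) sq_integrable_jet[OF D(1)]]
      q_jet_lincomb(2)[OF F(1,1) sq_integrable_jet[OF D(1)]]) (simp add: weak_solution_iff[OF f])
  then have "K_const m M s * ((norm2 \<Omega> (F' - F))\<^sup>2 + (normD \<Omega> (F' - F))\<^sup>2) \<le> 0"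
    using q_jet_coercive[OF D(1) s] by (simp add: H1_inner_eq_norms[OF D(1)])
  then have "(norm2 \<Omega> (F' - F))\<^sup>2 + (normD \<Omega> (F' - F))\<^sup>2 \<le> 0"
    using K by (simp add: mult_le_0_iff)
  then have "norm2 \<Omega> (F' - F) = 0"
    by (smt (verit) zero_le_power2 zero_eq_power2)
  then have "(LINT x|?M. (F' x - F x) \<bullet> (F' x - F x)) = 0"
    using H10_L2(1)[OF D(1)] L2.snorm_sq[of "F' - F" ?M] by (simp add: norm2_eq_snorm l2_inner_def)
  then have "AE x in ?M. (F' x - F x) \<bullet> (F' x - F x) = 0"
    using sq_integrable_inner[OF H10_L2(1)[OF D(1)] H10_L2(1)[OF D(1)]]
    by (subst (asm) integral_nonneg_eq_0_iff_AE) auto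
  then show ?thesis by eventually_elim simp
qed

end

theorem theorem4p7:
  fixes \<Omega> :: "(real ^ 'n::{finite,linorder}) set"
    and m M :: real
    and s :: "'n clifford"
  assumes "CARD('n) \<ge> 2"
    and "open \<Omega>" and "\<Omega> \<noteq> {}" and "\<Omega> \<subseteq> half_space" and "smooth_boundary \<Omega>"
    and "bdd_above (ycoord ` \<Omega>)"
    and "m = (INF p\<in>\<Omega>. ycoord p)" and "M = (SUP p\<in>\<Omega>. ycoord p)"
    and "0 < m" and "m < M"
    and "s \<in> paravectors"
    and "(norm s)\<^sup>2 - beta CARD('n) \<noteq> 0"
    and "\<bar>(norm s)\<^sup>2 - beta CARD('n)\<bar> - alpha CARD('n) * sqrt (1 + 4 * (Sc s)\<^sup>2) + m\<^sup>2 > 0"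
    and "4 * m\<^sup>2 * \<bar>(norm s)\<^sup>2 - beta CARD('n)\<bar> - 4 * real CARD('n) * M\<^sup>2 * (Sc s)\<^sup>2
          - 4 * (m\<^sup>2 * alpha CARD('n) + M\<^sup>2 * (1 + alpha CARD('n)) * sqrt (real CARD('n)))
              * sqrt (1 + 4 * (Sc s)\<^sup>2)
         > M\<^sup>2 * (4 * (1 + alpha CARD('n))\<^sup>2 + real CARD('n))"
  shows "\<forall>f\<in>L2 \<Omega>.
      (\<exists>F. weak_solution \<Omega> s f F \<and>
         (\<forall>F'. weak_solution \<Omega> s f F' \<longrightarrow> (AE x in lebesgue_on \<Omega>. F' x = F x))) \<and>
      norm2 \<Omega> (Q_inverse \<Omega> s f) \<le> 1 / K_const m M s * norm2 \<Omega> f \<and>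
      normD \<Omega> (Q_inverse \<Omega> s f) \<le> 1 / K_const m M s * norm2 \<Omega> f"
proof
  fix f assume f: "f \<in> L2 \<Omega>"
  have half: "0 < ycoord p" if "p \<in> \<Omega>" for p using that assms(4) by (auto simp: half_space_def)
  then have "bdd_below (ycoord ` \<Omega>)" by (auto intro!: bdd_belowI[of _ 0] less_imp_le)
  then have lower: "m \<le> ycoord p" if "p \<in> \<Omega>" for p using that assms(7) by (auto intro: cINF_lower)
  have upper: "ycoord p \<le> M" if "p \<in> \<Omega>" for p using that assms(6,8) by (auto intro: cSUP_upper)
  note setting = assms(2) lower upper assms(9)
  note c = norm_square_ge_beta[OF assms(9,10,13,14)] and K = K_const_pos[OF assms(9,10,13,14)]
  obtain F where F: "weak_solution \<Omega> s f F"
    using weak_solution_exists[OF setting c K f] by blast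
  then have "weak_solution \<Omega> s f (Q_inverse \<Omega> s f)"
    unfolding Q_inverse_def by (rule someI[of "weak_solution \<Omega> s f"])
  then show "(\<exists>F. weak_solution \<Omega> s f F \<and>
         (\<forall>F'. weak_solution \<Omega> s f F' \<longrightarrow> (AE x in lebesgue_on \<Omega>. F' x = F x))) \<and>
      norm2 \<Omega> (Q_inverse \<Omega> s f) \<le> 1 / K_const m M s * norm2 \<Omega> f \<and>
      normD \<Omega> (Q_inverse \<Omega> s f) \<le> 1 / K_const m M s * norm2 \<Omega> f"
    using F weak_solution_unique[OF setting c K f F] weak_solution_bounds[OF setting c K f] by blast
qed

end
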